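(* Let $H=\{H_\alpha\}_{\alpha\in\pi}$ be a Hopf $\pi$-coalgebra with $\dim H_\alpha<\infty$ for all $\alpha\in\pi$, let $(C,\sigma)$ be a left $\pi$-coisotropic quantum subgroup of $H$, and let $(V,\rho)$ and $(W,\psi)$ be left $\pi$-comodules over $C$. If there exists a vector space isomorphism $F_1:V_1\to W_1$ such that $$\psi_{1,1}F_1=(I_{C_1}\otimes F_1)\rho_{1,1},$$ then the coinduced representations $Coind(\rho)$ and $Coind(\psi)$ are equivalent right $\pi$-comodules over $H$.
   Context: Everything is over a field $K$: spaces, linear maps, tensor products; algebras are associative and unital. $I$ denotes identity maps. $\pi$ is a group with neutral element $1$. A $\pi$-coalgebra is a family $C=\{C_\alpha\}_{\alpha\in\pi}$ of $K$-spaces with linear maps $\Delta_{\alpha,\beta}:C_{\alpha\beta}\to C_\alpha\otimes C_\beta$ and $\epsilon:C_1\to K$ such that $(\Delta_{\alpha,\beta}\otimes I)\Delta_{\alpha\beta,\gamma}=(I\otimes\Delta_{\beta,\gamma})\Delta_{\alpha,\beta\gamma}$ and $(\epsilon\otimes I)\Delta_{1,\alpha}=I=(I\otimes\epsilon)\Delta_{\alpha,1}$ (identifying $K\otimes C_\alpha\cong C_\alpha\cong C_\alpha\otimes K$). A Hopf $\pi$-coalgebra is a $\pi$-coalgebra $H=\{H_\alpha\}$ with linear maps $S_\alpha:H_\alpha\to H_{\alpha^{-1}}$ such that each $H_\alpha$ is an algebra (multiplication $\mu_\alpha$, unit $1_\alpha$), all $\Delta_{\alpha,\beta}$ and $\epsilon$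 are algebra maps, and $\mu_\alpha(S_{\alpha^{-1}}\otimes I)\Delta_{\alpha^{-1},\alpha}=1_\alpha\epsilon=\mu_\alpha(I\otimes S_{\alpha^{-1}})\Delta_{\alpha,\alpha^{-1}}$. A right $\pi$-comodule $(M,\theta)$ over a $\pi$-coalgebra $C$ is a family $M=\{M_\alpha\}$ of spaces with linear maps $\theta_{\alpha,\beta}:M_{\alpha\beta}\to M_\alpha\otimes C_\beta$ such that $(\theta_{\alpha,\beta}\otimes I)\theta_{\alpha\beta,\gamma}=(I\otimes\Delta_{\beta,\gamma})\theta_{\alpha,\beta\gamma}$ and $(I\otimes\epsilon)\theta_{\alpha,1}=I$. A left $\pi$-comodule $(V,\rho)$ over $C$ is a family $V=\{V_\alpha\}$ with linear maps $\rho_{\alpha,\beta}:V_{\alpha\beta}\to C_\alpha\otimes V_\beta$ such that $(\Delta_{\alpha,\beta}\otimes I)\rho_{\alpha\beta,\gamma}=(I\otimes\rho_{\beta,\gamma})\rho_{\alpha,\beta\gamma}$ and $(\epsilon\otimes I)\rho_{1,\alpha}=I$. (Canonical identifications with tensoring by $K$ are used.) Right $\pi$-comodules $(M,\theta)$, $(N,\theta')$ are equivalent if there is a family of vector space isomorphisms $F_\alpha:M_\alpha\to N_\alpha$ with $\theta'_{\alpha,\beta}F_{\alpha\beta}=(F_\alpha\otimes I)\theta_{\alpha,\beta}$ for all $\alpha,\beta\in\pi$. A left $\pi$-coisotropic quantum subgroup of $H$ is a pair $(C,\sigma)$ where $C$ is a $\pi$-coalgebra, each $C_\alpha$ carries a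 left $H_\alpha$-module structure, and $\sigma=\{\sigma_\alpha:H_\alpha\to C_\alpha\}$ is a family of surjective linear maps such that each $\sigma_\alpha$ is left $H_\alpha$-linear, $\Delta^C_{\alpha,\beta}\sigma_{\alpha\beta}=(\sigma_\alpha\otimes\sigma_\beta)\Delta^H_{\alpha,\beta}$, and $\epsilon^C\sigma_1=\epsilon^H$. For a left $\pi$-comodule $(V,\rho)$ over $C$, the coinduced representation $Coind(\rho)$ is the right $\pi$-comodule over $H$ with $Coind(\rho)_\alpha=\{F\in Hom_K(V_1,H_\alpha): L_{1,\alpha}F=(I_{C_1}\otimes F)\rho_{1,1}\}$, where $L_{1,\alpha}=(\sigma_1\otimes I_{H_\alpha})\Delta^H_{1,\alpha}$, and coaction $Coind(\rho)_{\alpha\beta}\to Coind(\rho)_\alpha\otimes H_\beta$, $F\mapsto\sum_i[(I_{H_\alpha}\otimes g_i^\beta)\Delta^H_{\alpha,\beta}F]\otimes e_i^\beta$, where $\{e_i^\beta\},\{g_i^\beta\}$ are dual bases of $H_\beta$ and $H_\beta^*$ and $H_\alpha\otimes K\cong H_\alpha$. *)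

theory Defs
  imports "HOL-Algebra.AbelCoset" "Jordan_Normal_Form.Missing_VectorSpace"
begin

text \<open>
  Vector spaces over a field \<open>K\<close> are the \<^const>\<open>vectorspace\<close>s of the AFP, i.e. records of type
  \<open>module\<close>. Such a record also has a multiplication and a unit, which are meaningful
  for algebras only and are left \<open>undefined\<close> for bare vector spaces. Families indexed by the
  group \<open>\<pi>\<close> are functions of which only the values on \<open>carrier \<pi>\<close> matter.
\<close>

section \<open>Tensor products of vector spaces\<close>

definition self_space :: "('k, 'm) ring_scheme \<Rightarrow> ('k, 'k) module" where
  "self_space K = \<lparr>carrier = carrier K, mult = mult K, one = one K, zero = zero K, add = add K,
     smult = mult K\<rparr>"

definition free_space :: "('k, 'm) ring_scheme \<Rightarrow> 'x set \<Rightarrow> ('k, 'x \<Rightarrow> 'k) module" where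
  "free_space K A = \<lparr>
     carrier = {\<phi>. (\<forall>x\<in>A. \<phi> x \<in> carrier K) \<and> (\<forall>x. x \<notin> A \<longrightarrow> \<phi> x = \<zero>\<^bsub>K\<^esub>) \<and> finite {x. \<phi> x \<noteq> \<zero>\<^bsub>K\<^esub>}},
     mult = undefined, one = undefined,
     zero = (\<lambda>x. \<zero>\<^bsub>K\<^esub>),
     add = (\<lambda>\<phi> \<psi> x. \<phi> x \<oplus>\<^bsub>K\<^esub> \<psi> x),
     smult = (\<lambda>a \<phi> x. a \<otimes>\<^bsub>K\<^esub> \<phi> x)\<rparr>"

definition free_gen :: "('k, 'm) ring_scheme \<Rightarrow> 'x \<Rightarrow> 'x \<Rightarrow> 'k" where
  "free_gen K x = (\<lambda>y. if y = x then \<one>\<^bsub>K\<^esub> else \<zero>\<^bsub>K\<^esub>)"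

abbreviation pair_space ::
  "('k, 'm) ring_scheme \<Rightarrow> ('k, 'a) module \<Rightarrow> ('k, 'b) module \<Rightarrow> ('k, 'a \<times> 'b \<Rightarrow> 'k) module" where
  "pair_space K M N \<equiv> free_space K (carrier M \<times> carrier N)"

definition tensor_rels ::
  "('k, 'm) ring_scheme \<Rightarrow> ('k, 'a) module \<Rightarrow> ('k, 'b) module \<Rightarrow> ('a \<times> 'b \<Rightarrow> 'k) set" where
  "tensor_rels K M N = (let F = pair_space K M N; \<delta> = free_gen K in
     {\<delta> (m \<oplus>\<^bsub>M\<^esub> m', n) \<ominus>\<^bsub>F\<^esub> (\<delta> (m, n) \<oplus>\<^bsub>F\<^esub> \<delta> (m', n)) | m m' n.
        m \<in> carrier M \<and> m' \<in> carrier M \<and> n \<in> carrier N} \<union>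
     {\<delta> (m, n \<oplus>\<^bsub>N\<^esub> n') \<ominus>\<^bsub>F\<^esub> (\<delta> (m, n) \<oplus>\<^bsub>F\<^esub> \<delta> (m, n')) | m n n'.
        m \<in> carrier M \<and> n \<in> carrier N \<and> n' \<in> carrier N} \<union>
     {\<delta> (a \<odot>\<^bsub>M\<^esub> m, n) \<ominus>\<^bsub>F\<^esub> a \<odot>\<^bsub>F\<^esub> \<delta> (m, n) | a m n.
        a \<in> carrier K \<and> m \<in> carrier M \<and> n \<in> carrier N} \<union>
     {\<delta> (m, a \<odot>\<^bsub>N\<^esub> n) \<ominus>\<^bsub>F\<^esub> a \<odot>\<^bsub>F\<^esub> \<delta> (m, n) | a m n.
        a \<in> carrier K \<and> m \<in> carrier M \<and> n \<in> carrier N})"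

definition tensor_null ::
  "('k, 'm) ring_scheme \<Rightarrow> ('k, 'a) module \<Rightarrow> ('k, 'b) module \<Rightarrow> ('a \<times> 'b \<Rightarrow> 'k) set" where
  "tensor_null K M N = LinearCombinations.module.span K (pair_space K M N) (tensor_rels K M N)"

type_synonym ('k, 'a, 'b) tensor = "('a \<times> 'b \<Rightarrow> 'k) set"

definition tensor_space :: "('k, 'm) ring_scheme \<Rightarrow> ('k, 'a) module \<Rightarrow> ('k, 'b) module \<Rightarrow>
    ('k, ('k, 'a, 'b) tensor) module" where
  "tensor_space K M N = (let F = pair_space K M N; R = tensor_null K M N in \<lparr>
     carrier = a_rcosets\<^bsub>F\<^esub> R,
     mult = undefined, one = undefined,
     zero = R,
     add = set_add F,
     smult = (\<lambda>a X. \<Union>\<phi>\<in>X. R +>\<^bsub>F\<^esub> (a \<odot>\<^bsub>F\<^esub> \<phi>))\<rparr>)"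

definition pure_tensor :: "('k, 'm) ring_scheme \<Rightarrow> ('k, 'a) module \<Rightarrow> ('k, 'b) module \<Rightarrow>
    'a \<Rightarrow> 'b \<Rightarrow> ('k, 'a, 'b) tensor" where
  "pure_tensor K M N m n = tensor_null K M N +>\<^bsub>pair_space K M N\<^esub> free_gen K (m, n)"

text \<open>
  For a bilinear map \<open>b\<close> from two spaces into \<open>P\<close>, \<open>tensor_lift K P b\<close> is the induced linear map on
  their tensor product; the value does not depend on the chosen representative \<open>\<phi>\<close> of the coset.
\<close>

definition tensor_lift :: "('k, 'm) ring_scheme \<Rightarrow> ('k, 'c) module \<Rightarrow> ('a \<Rightarrow> 'b \<Rightarrow> 'c) \<Rightarrow>
    ('k, 'a, 'b) tensor \<Rightarrow> 'c" where
  "tensor_lift K P b X = (let \<phi> = (SOME \<phi>. \<phi> \<in> X) in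
     \<Oplus>\<^bsub>P\<^esub> x \<in> {x. \<phi> x \<noteq> \<zero>\<^bsub>K\<^esub>}. \<phi> x \<odot>\<^bsub>P\<^esub> b (fst x) (snd x))"

text \<open>\<open>tensor_map K P Q f g\<close> is \<open>f \<otimes> g\<close>, where \<open>P\<close> and \<open>Q\<close> are the codomains of \<open>f\<close> and \<open>g\<close>.\<close>

definition tensor_map :: "('k, 'm) ring_scheme \<Rightarrow> ('k, 'c) module \<Rightarrow> ('k, 'd) module \<Rightarrow>
    ('a \<Rightarrow> 'c) \<Rightarrow> ('b \<Rightarrow> 'd) \<Rightarrow> ('k, 'a, 'b) tensor \<Rightarrow> ('k, 'c, 'd) tensor" where
  "tensor_map K P Q f g =
     tensor_lift K (tensor_space K P Q) (\<lambda>m n. pure_tensor K P Q (f m) (g n))"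

text \<open>The canonical map from \<open>(M \<otimes> N) \<otimes> P\<close> to \<open>M \<otimes> (N \<otimes> P)\<close>.\<close>

definition tensor_assoc :: "('k, 'm) ring_scheme \<Rightarrow> ('k, 'a) module \<Rightarrow> ('k, 'b) module \<Rightarrow>
    ('k, 'c) module \<Rightarrow> ('k, ('k, 'a, 'b) tensor, 'c) tensor \<Rightarrow>
    ('k, 'a, ('k, 'b, 'c) tensor) tensor" where
  "tensor_assoc K M N P =
     (let NP = tensor_space K N P; T = tensor_space K M NP in
      tensor_lift K T (\<lambda>t p. tensor_lift K T (\<lambda>m n. pure_tensor K M NP m (pure_tensor K N P n p)) t))"

text \<open>The canonical maps from \<open>K \<otimes> M\<close> and \<open>M \<otimes> K\<close> to \<open>M\<close>.\<close>

definition tensor_lunit :: "('k, 'm) ring_scheme \<Rightarrow> ('k, 'a) module \<Rightarrow> ('k, 'k, 'a) tensor \<Rightarrow> 'a" where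
  "tensor_lunit K M = tensor_lift K M (\<lambda>k m. k \<odot>\<^bsub>M\<^esub> m)"

definition tensor_runit :: "('k, 'm) ring_scheme \<Rightarrow> ('k, 'a) module \<Rightarrow> ('k, 'a, 'k) tensor \<Rightarrow> 'a" where
  "tensor_runit K M = tensor_lift K M (\<lambda>m k. k \<odot>\<^bsub>M\<^esub> m)"


section \<open>Algebras and their modules\<close>

text \<open>The locale \<^locale>\<open>algebra\<close> of the library is restricted to commutative algebras.\<close>

locale unital_algebra = vectorspace K A + A: ring A for K and A +
  assumes smult_mult_left: "\<lbrakk>a \<in> carrier K; x \<in> carrier A; y \<in> carrier A\<rbrakk> \<Longrightarrow>
      (a \<odot>\<^bsub>A\<^esub> x) \<otimes>\<^bsub>A\<^esub> y = a \<odot>\<^bsub>A\<^esub> (x \<otimes>\<^bsub>A\<^esub> y)"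
    and smult_mult_right: "\<lbrakk>a \<in> carrier K; x \<in> carrier A; y \<in> carrier A\<rbrakk> \<Longrightarrow>
      x \<otimes>\<^bsub>A\<^esub> (a \<odot>\<^bsub>A\<^esub> y) = a \<odot>\<^bsub>A\<^esub> (x \<otimes>\<^bsub>A\<^esub> y)"

text \<open>The multiplication is determined by \<open>(a \<otimes> b) (a' \<otimes> b') = a a' \<otimes> b b'\<close>.\<close>

definition tensor_algebra :: "('k, 'm) ring_scheme \<Rightarrow> ('k, 'a) module \<Rightarrow> ('k, 'b) module \<Rightarrow>
    ('k, ('k, 'a, 'b) tensor) module" where
  "tensor_algebra K A B = (let T = tensor_space K A B in T\<lparr>
     mult := (\<lambda>X Y. tensor_lift K T (\<lambda>a b. tensor_lift K T
        (\<lambda>a' b'. pure_tensor K A B (a \<otimes>\<^bsub>A\<^esub> a') (b \<otimes>\<^bsub>B\<^esub> b')) Y) X),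
     one := pure_tensor K A B \<one>\<^bsub>A\<^esub> \<one>\<^bsub>B\<^esub>\<rparr>)"

locale left_algebra_module = A: unital_algebra K A + M: vectorspace K M for K and A and M +
  fixes act
  assumes act_closed: "\<lbrakk>h \<in> carrier A; m \<in> carrier M\<rbrakk> \<Longrightarrow> act h m \<in> carrier M"
    and act_add_left: "\<lbrakk>h \<in> carrier A; h' \<in> carrier A; m \<in> carrier M\<rbrakk> \<Longrightarrow>
      act (h \<oplus>\<^bsub>A\<^esub> h') m = act h m \<oplus>\<^bsub>M\<^esub> act h' m"
    and act_add_right: "\<lbrakk>h \<in> carrier A; m \<in> carrier M; m' \<in> carrier M\<rbrakk> \<Longrightarrow>
      act h (m \<oplus>\<^bsub>M\<^esub> m') = act h m \<oplus>\<^bsub>M\<^esub> act h m'"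
    and act_smult_left: "\<lbrakk>a \<in> carrier K; h \<in> carrier A; m \<in> carrier M\<rbrakk> \<Longrightarrow>
      act (a \<odot>\<^bsub>A\<^esub> h) m = a \<odot>\<^bsub>M\<^esub> act h m"
    and act_smult_right: "\<lbrakk>a \<in> carrier K; h \<in> carrier A; m \<in> carrier M\<rbrakk> \<Longrightarrow>
      act h (a \<odot>\<^bsub>M\<^esub> m) = a \<odot>\<^bsub>M\<^esub> act h m"
    and act_mult: "\<lbrakk>h \<in> carrier A; h' \<in> carrier A; m \<in> carrier M\<rbrakk> \<Longrightarrow>
      act (h \<otimes>\<^bsub>A\<^esub> h') m = act h (act h' m)"
    and act_one: "m \<in> carrier M \<Longrightarrow> act \<one>\<^bsub>A\<^esub> m = m"


section \<open>Coalgebras and Hopf coalgebras graded by a group\<close>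

locale pi_coalgebra = pi: group \<pi> + K: field K
  for \<pi> :: "('p, 'q) monoid_scheme" and K :: "('k, 'm) ring_scheme" +
  fixes C :: "'p \<Rightarrow> ('k, 'c) module"
    and \<Delta> :: "'p \<Rightarrow> 'p \<Rightarrow> 'c \<Rightarrow> ('k, 'c, 'c) tensor"
    and \<epsilon> :: "'c \<Rightarrow> 'k"
  assumes space: "\<alpha> \<in> carrier \<pi> \<Longrightarrow> vectorspace K (C \<alpha>)"
    and comult_linear: "\<lbrakk>\<alpha> \<in> carrier \<pi>; \<beta> \<in> carrier \<pi>\<rbrakk> \<Longrightarrow>
      linear_map K (C (\<alpha> \<otimes>\<^bsub>\<pi>\<^esub> \<beta>)) (tensor_space K (C \<alpha>) (C \<beta>)) (\<Delta> \<alpha> \<beta>)"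
    and counit_linear: "linear_map K (C \<one>\<^bsub>\<pi>\<^esub>) (self_space K) \<epsilon>"
    and coassoc: "\<lbrakk>\<alpha> \<in> carrier \<pi>; \<beta> \<in> carrier \<pi>; \<gamma> \<in> carrier \<pi>;
        x \<in> carrier (C (\<alpha> \<otimes>\<^bsub>\<pi>\<^esub> \<beta> \<otimes>\<^bsub>\<pi>\<^esub> \<gamma>))\<rbrakk> \<Longrightarrow>
      tensor_assoc K (C \<alpha>) (C \<beta>) (C \<gamma>)
        (tensor_map K (tensor_space K (C \<alpha>) (C \<beta>)) (C \<gamma>) (\<Delta> \<alpha> \<beta>) id (\<Delta> (\<alpha> \<otimes>\<^bsub>\<pi>\<^esub> \<beta>) \<gamma> x))
      = tensor_map K (C \<alpha>) (tensor_space K (C \<beta>) (C \<gamma>)) id (\<Delta> \<beta> \<gamma>) (\<Delta> \<alpha> (\<beta> \<otimes>\<^bsub>\<pi>\<^esub> \<gamma>) x)"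
    and counit_left: "\<lbrakk>\<alpha> \<in> carrier \<pi>; x \<in> carrier (C \<alpha>)\<rbrakk> \<Longrightarrow>
      tensor_lunit K (C \<alpha>) (tensor_map K (self_space K) (C \<alpha>) \<epsilon> id (\<Delta> \<one>\<^bsub>\<pi>\<^esub> \<alpha> x)) = x"
    and counit_right: "\<lbrakk>\<alpha> \<in> carrier \<pi>; x \<in> carrier (C \<alpha>)\<rbrakk> \<Longrightarrow>
      tensor_runit K (C \<alpha>) (tensor_map K (C \<alpha>) (self_space K) id \<epsilon> (\<Delta> \<alpha> \<one>\<^bsub>\<pi>\<^esub> x)) = x"

text \<open>\<open>tensor_lift K (H \<alpha>) (mult (H \<alpha>))\<close> is the multiplication as a linear map on \<open>H \<alpha> \<otimes> H \<alpha>\<close>.\<close>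

locale hopf_pi_coalgebra = pi_coalgebra \<pi> K H \<Delta> \<epsilon>
  for \<pi> :: "('p, 'q) monoid_scheme" and K :: "('k, 'm) ring_scheme"
    and H :: "'p \<Rightarrow> ('k, 'h) module" and \<Delta> and \<epsilon> +
  fixes S :: "'p \<Rightarrow> 'h \<Rightarrow> 'h"
  assumes algebra: "\<alpha> \<in> carrier \<pi> \<Longrightarrow> unital_algebra K (H \<alpha>)"
    and comult_hom: "\<lbrakk>\<alpha> \<in> carrier \<pi>; \<beta> \<in> carrier \<pi>\<rbrakk> \<Longrightarrow>
      \<Delta> \<alpha> \<beta> \<in> ring_hom (H (\<alpha> \<otimes>\<^bsub>\<pi>\<^esub> \<beta>)) (tensor_algebra K (H \<alpha>) (H \<beta>))"
    and counit_hom: "\<epsilon> \<in> ring_hom (H \<one>\<^bsub>\<pi>\<^esub>) K"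
    and antipode_linear: "\<alpha> \<in> carrier \<pi> \<Longrightarrow> linear_map K (H \<alpha>) (H (inv\<^bsub>\<pi>\<^esub> \<alpha>)) (S \<alpha>)"
    and antipode_left: "\<lbrakk>\<alpha> \<in> carrier \<pi>; x \<in> carrier (H \<one>\<^bsub>\<pi>\<^esub>)\<rbrakk> \<Longrightarrow>
      tensor_lift K (H \<alpha>) (mult (H \<alpha>))
        (tensor_map K (H \<alpha>) (H \<alpha>) (S (inv\<^bsub>\<pi>\<^esub> \<alpha>)) id (\<Delta> (inv\<^bsub>\<pi>\<^esub> \<alpha>) \<alpha> x))
      = \<epsilon> x \<odot>\<^bsub>H \<alpha>\<^esub> \<one>\<^bsub>H \<alpha>\<^esub>"
    and antipode_right: "\<lbrakk>\<alpha> \<in> carrier \<pi>; x \<in> carrier (H \<one>\<^bsub>\<pi>\<^esub>)\<rbrakk> \<Longrightarrow>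
      tensor_lift K (H \<alpha>) (mult (H \<alpha>))
        (tensor_map K (H \<alpha>) (H \<alpha>) id (S (inv\<^bsub>\<pi>\<^esub> \<alpha>)) (\<Delta> \<alpha> (inv\<^bsub>\<pi>\<^esub> \<alpha>) x))
      = \<epsilon> x \<odot>\<^bsub>H \<alpha>\<^esub> \<one>\<^bsub>H \<alpha>\<^esub>"


section \<open>Comodules\<close>

locale right_pi_comodule = pi_coalgebra \<pi> K C \<Delta> \<epsilon>
  for \<pi> :: "('p, 'q) monoid_scheme" and K :: "('k, 'm) ring_scheme"
    and C :: "'p \<Rightarrow> ('k, 'c) module" and \<Delta> and \<epsilon> +
  fixes M :: "'p \<Rightarrow> ('k, 'v) module"
    and \<theta> :: "'p \<Rightarrow> 'p \<Rightarrow> 'v \<Rightarrow> ('k, 'v, 'c) tensor"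
  assumes comodule_space: "\<alpha> \<in> carrier \<pi> \<Longrightarrow> vectorspace K (M \<alpha>)"
    and coaction_linear: "\<lbrakk>\<alpha> \<in> carrier \<pi>; \<beta> \<in> carrier \<pi>\<rbrakk> \<Longrightarrow>
      linear_map K (M (\<alpha> \<otimes>\<^bsub>\<pi>\<^esub> \<beta>)) (tensor_space K (M \<alpha>) (C \<beta>)) (\<theta> \<alpha> \<beta>)"
    and coaction_coassoc: "\<lbrakk>\<alpha> \<in> carrier \<pi>; \<beta> \<in> carrier \<pi>; \<gamma> \<in> carrier \<pi>;
        x \<in> carrier (M (\<alpha> \<otimes>\<^bsub>\<pi>\<^esub> \<beta> \<otimes>\<^bsub>\<pi>\<^esub> \<gamma>))\<rbrakk> \<Longrightarrow>
      tensor_assoc K (M \<alpha>) (C \<beta>) (C \<gamma>)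
        (tensor_map K (tensor_space K (M \<alpha>) (C \<beta>)) (C \<gamma>) (\<theta> \<alpha> \<beta>) id (\<theta> (\<alpha> \<otimes>\<^bsub>\<pi>\<^esub> \<beta>) \<gamma> x))
      = tensor_map K (M \<alpha>) (tensor_space K (C \<beta>) (C \<gamma>)) id (\<Delta> \<beta> \<gamma>) (\<theta> \<alpha> (\<beta> \<otimes>\<^bsub>\<pi>\<^esub> \<gamma>) x)"
    and coaction_counit: "\<lbrakk>\<alpha> \<in> carrier \<pi>; x \<in> carrier (M \<alpha>)\<rbrakk> \<Longrightarrow>
      tensor_runit K (M \<alpha>) (tensor_map K (M \<alpha>) (self_space K) id \<epsilon> (\<theta> \<alpha> \<one>\<^bsub>\<pi>\<^esub> x)) = x"

locale left_pi_comodule = pi_coalgebra \<pi> K C \<Delta> \<epsilon>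
  for \<pi> :: "('p, 'q) monoid_scheme" and K :: "('k, 'm) ring_scheme"
    and C :: "'p \<Rightarrow> ('k, 'c) module" and \<Delta> and \<epsilon> +
  fixes V :: "'p \<Rightarrow> ('k, 'v) module"
    and \<rho> :: "'p \<Rightarrow> 'p \<Rightarrow> 'v \<Rightarrow> ('k, 'c, 'v) tensor"
  assumes comodule_space: "\<alpha> \<in> carrier \<pi> \<Longrightarrow> vectorspace K (V \<alpha>)"
    and coaction_linear: "\<lbrakk>\<alpha> \<in> carrier \<pi>; \<beta> \<in> carrier \<pi>\<rbrakk> \<Longrightarrow>
      linear_map K (V (\<alpha> \<otimes>\<^bsub>\<pi>\<^esub> \<beta>)) (tensor_space K (C \<alpha>) (V \<beta>)) (\<rho> \<alpha> \<beta>)"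
    and coaction_coassoc: "\<lbrakk>\<alpha> \<in> carrier \<pi>; \<beta> \<in> carrier \<pi>; \<gamma> \<in> carrier \<pi>;
        x \<in> carrier (V (\<alpha> \<otimes>\<^bsub>\<pi>\<^esub> \<beta> \<otimes>\<^bsub>\<pi>\<^esub> \<gamma>))\<rbrakk> \<Longrightarrow>
      tensor_assoc K (C \<alpha>) (C \<beta>) (V \<gamma>)
        (tensor_map K (tensor_space K (C \<alpha>) (C \<beta>)) (V \<gamma>) (\<Delta> \<alpha> \<beta>) id (\<rho> (\<alpha> \<otimes>\<^bsub>\<pi>\<^esub> \<beta>) \<gamma> x))
      = tensor_map K (C \<alpha>) (tensor_space K (C \<beta>) (V \<gamma>)) id (\<rho> \<beta> \<gamma>) (\<rho> \<alpha> (\<beta> \<otimes>\<^bsub>\<pi>\<^esub> \<gamma>) x)"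
    and coaction_counit: "\<lbrakk>\<alpha> \<in> carrier \<pi>; x \<in> carrier (V \<alpha>)\<rbrakk> \<Longrightarrow>
      tensor_lunit K (V \<alpha>) (tensor_map K (self_space K) (V \<alpha>) \<epsilon> id (\<rho> \<one>\<^bsub>\<pi>\<^esub> \<alpha> x)) = x"

definition linear_iso :: "('k, 'm) ring_scheme \<Rightarrow> ('k, 'a) module \<Rightarrow> ('k, 'b) module \<Rightarrow>
    ('a \<Rightarrow> 'b) \<Rightarrow> bool" where
  "linear_iso K M N f \<longleftrightarrow> linear_map K M N f \<and> bij_betw f (carrier M) (carrier N)"

definition equivalent_right_pi_comodules :: "('p, 'q) monoid_scheme \<Rightarrow> ('k, 'm) ring_scheme \<Rightarrow>
    ('p \<Rightarrow> ('k, 'c) module) \<Rightarrow> ('p \<Rightarrow> 'p \<Rightarrow> 'c \<Rightarrow> ('k, 'c, 'c) tensor) \<Rightarrow> ('c \<Rightarrow> 'k) \<Rightarrow>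
    ('p \<Rightarrow> ('k, 'v) module) \<Rightarrow> ('p \<Rightarrow> 'p \<Rightarrow> 'v \<Rightarrow> ('k, 'v, 'c) tensor) \<Rightarrow>
    ('p \<Rightarrow> ('k, 'w) module) \<Rightarrow> ('p \<Rightarrow> 'p \<Rightarrow> 'w \<Rightarrow> ('k, 'w, 'c) tensor) \<Rightarrow> bool" where
  "equivalent_right_pi_comodules \<pi> K C \<Delta> \<epsilon> M \<theta> N \<theta>' \<longleftrightarrow>
     right_pi_comodule \<pi> K C \<Delta> \<epsilon> M \<theta> \<and> right_pi_comodule \<pi> K C \<Delta> \<epsilon> N \<theta>' \<and>
     (\<exists>F. (\<forall>\<alpha>\<in>carrier \<pi>. linear_iso K (M \<alpha>) (N \<alpha>) (F \<alpha>)) \<and>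
       (\<forall>\<alpha>\<in>carrier \<pi>. \<forall>\<beta>\<in>carrier \<pi>. \<forall>x\<in>carrier (M (\<alpha> \<otimes>\<^bsub>\<pi>\<^esub> \<beta>)).
          \<theta>' \<alpha> \<beta> (F (\<alpha> \<otimes>\<^bsub>\<pi>\<^esub> \<beta>) x) = tensor_map K (N \<alpha>) (C \<beta>) (F \<alpha>) id (\<theta> \<alpha> \<beta> x)))"


section \<open>Coisotropic quantum subgroups and coinduced representations\<close>

locale left_pi_coisotropic_subgroup =
  H: hopf_pi_coalgebra \<pi> K H \<Delta> \<epsilon> S + C: pi_coalgebra \<pi> K C \<Delta>C \<epsilon>C
  for \<pi> :: "('p, 'q) monoid_scheme" and K :: "('k, 'm) ring_scheme"
    and H :: "'p \<Rightarrow> ('k, 'h) module" and \<Delta> and \<epsilon> and S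
    and C :: "'p \<Rightarrow> ('k, 'c) module" and \<Delta>C and \<epsilon>C +
  fixes act :: "'p \<Rightarrow> 'h \<Rightarrow> 'c \<Rightarrow> 'c" and \<sigma> :: "'p \<Rightarrow> 'h \<Rightarrow> 'c"
  assumes act_module: "\<alpha> \<in> carrier \<pi> \<Longrightarrow> left_algebra_module K (H \<alpha>) (C \<alpha>) (act \<alpha>)"
    and proj_linear: "\<alpha> \<in> carrier \<pi> \<Longrightarrow> linear_map K (H \<alpha>) (C \<alpha>) (\<sigma> \<alpha>)"
    and proj_surj: "\<alpha> \<in> carrier \<pi> \<Longrightarrow> \<sigma> \<alpha> ` carrier (H \<alpha>) = carrier (C \<alpha>)"
    and proj_act: "\<lbrakk>\<alpha> \<in> carrier \<pi>; h \<in> carrier (H \<alpha>); x \<in> carrier (H \<alpha>)\<rbrakk> \<Longrightarrow>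
      \<sigma> \<alpha> (h \<otimes>\<^bsub>H \<alpha>\<^esub> x) = act \<alpha> h (\<sigma> \<alpha> x)"
    and proj_comult: "\<lbrakk>\<alpha> \<in> carrier \<pi>; \<beta> \<in> carrier \<pi>; x \<in> carrier (H (\<alpha> \<otimes>\<^bsub>\<pi>\<^esub> \<beta>))\<rbrakk> \<Longrightarrow>
      \<Delta>C \<alpha> \<beta> (\<sigma> (\<alpha> \<otimes>\<^bsub>\<pi>\<^esub> \<beta>) x) = tensor_map K (C \<alpha>) (C \<beta>) (\<sigma> \<alpha>) (\<sigma> \<beta>) (\<Delta> \<alpha> \<beta> x)"
    and proj_counit: "x \<in> carrier (H \<one>\<^bsub>\<pi>\<^esub>) \<Longrightarrow> \<epsilon>C (\<sigma> \<one>\<^bsub>\<pi>\<^esub> x) = \<epsilon> x"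

text \<open>As in \<^const>\<open>ring.func_space\<close>, maps are made unique by being \<open>undefined\<close> off \<open>carrier V\<close>.\<close>

definition hom_space :: "('k, 'm) ring_scheme \<Rightarrow> ('k, 'v) module \<Rightarrow> ('k, 'w) module \<Rightarrow>
    ('k, 'v \<Rightarrow> 'w) module" where
  "hom_space K V W = \<lparr>
     carrier = module_hom K V W \<inter> extensional (carrier V),
     mult = undefined, one = undefined,
     zero = (\<lambda>v\<in>carrier V. \<zero>\<^bsub>W\<^esub>),
     add = (\<lambda>F G. \<lambda>v\<in>carrier V. F v \<oplus>\<^bsub>W\<^esub> G v),
     smult = (\<lambda>a F. \<lambda>v\<in>carrier V. a \<odot>\<^bsub>W\<^esub> F v)\<rparr>"

definition coind_L :: "('p, 'q) monoid_scheme \<Rightarrow> ('k, 'm) ring_scheme \<Rightarrow> ('p \<Rightarrow> ('k, 'h) module) \<Rightarrow>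
    ('p \<Rightarrow> 'p \<Rightarrow> 'h \<Rightarrow> ('k, 'h, 'h) tensor) \<Rightarrow> ('p \<Rightarrow> ('k, 'c) module) \<Rightarrow> ('p \<Rightarrow> 'h \<Rightarrow> 'c) \<Rightarrow>
    'p \<Rightarrow> 'h \<Rightarrow> ('k, 'c, 'h) tensor" where
  "coind_L \<pi> K H \<Delta> C \<sigma> \<alpha> h = tensor_map K (C \<one>\<^bsub>\<pi>\<^esub>) (H \<alpha>) (\<sigma> \<one>\<^bsub>\<pi>\<^esub>) id (\<Delta> \<one>\<^bsub>\<pi>\<^esub> \<alpha> h)"

definition coind :: "('p, 'q) monoid_scheme \<Rightarrow> ('k, 'm) ring_scheme \<Rightarrow> ('p \<Rightarrow> ('k, 'h) module) \<Rightarrow>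
    ('p \<Rightarrow> 'p \<Rightarrow> 'h \<Rightarrow> ('k, 'h, 'h) tensor) \<Rightarrow> ('p \<Rightarrow> ('k, 'c) module) \<Rightarrow> ('p \<Rightarrow> 'h \<Rightarrow> 'c) \<Rightarrow>
    ('p \<Rightarrow> ('k, 'v) module) \<Rightarrow> ('p \<Rightarrow> 'p \<Rightarrow> 'v \<Rightarrow> ('k, 'c, 'v) tensor) \<Rightarrow>
    'p \<Rightarrow> ('k, 'v \<Rightarrow> 'h) module" where
  "coind \<pi> K H \<Delta> C \<sigma> V \<rho> \<alpha> = (hom_space K (V \<one>\<^bsub>\<pi>\<^esub>) (H \<alpha>))\<lparr>
     carrier := {F \<in> carrier (hom_space K (V \<one>\<^bsub>\<pi>\<^esub>) (H \<alpha>)). \<forall>v\<in>carrier (V \<one>\<^bsub>\<pi>\<^esub>).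
       coind_L \<pi> K H \<Delta> C \<sigma> \<alpha> (F v) = tensor_map K (C \<one>\<^bsub>\<pi>\<^esub>) (H \<alpha>) id F (\<rho> \<one>\<^bsub>\<pi>\<^esub> \<one>\<^bsub>\<pi>\<^esub> v)}\<rparr>"

text \<open>\<open>g e\<close> is the functional dual to the element \<open>e\<close> of the basis \<open>B\<close>.\<close>

definition dual_bases :: "('k, 'm) ring_scheme \<Rightarrow> ('k, 'h) module \<Rightarrow> 'h set \<Rightarrow>
    ('h \<Rightarrow> 'h \<Rightarrow> 'k) \<Rightarrow> bool" where
  "dual_bases K V B g \<longleftrightarrow> finite B \<and> vectorspace.basis K V B \<and>
     (\<forall>e\<in>B. linear_map K V (self_space K) (g e) \<and>
        (\<forall>e'\<in>B. g e e' = (if e' = e then \<one>\<^bsub>K\<^esub> else \<zero>\<^bsub>K\<^esub>)))"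

definition coind_coaction ::
   "('p, 'q) monoid_scheme \<Rightarrow> ('k, 'm) ring_scheme \<Rightarrow> ('p \<Rightarrow> ('k, 'h) module) \<Rightarrow>
    ('p \<Rightarrow> 'p \<Rightarrow> 'h \<Rightarrow> ('k, 'h, 'h) tensor) \<Rightarrow> ('p \<Rightarrow> ('k, 'c) module) \<Rightarrow> ('p \<Rightarrow> 'h \<Rightarrow> 'c) \<Rightarrow>
    ('p \<Rightarrow> 'h set) \<Rightarrow> ('p \<Rightarrow> 'h \<Rightarrow> 'h \<Rightarrow> 'k) \<Rightarrow>
    ('p \<Rightarrow> ('k, 'v) module) \<Rightarrow> ('p \<Rightarrow> 'p \<Rightarrow> 'v \<Rightarrow> ('k, 'c, 'v) tensor) \<Rightarrow>
    'p \<Rightarrow> 'p \<Rightarrow> ('v \<Rightarrow> 'h) \<Rightarrow> ('k, 'v \<Rightarrow> 'h, 'h) tensor" where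
  "coind_coaction \<pi> K H \<Delta> C \<sigma> B g V \<rho> \<alpha> \<beta> F =
     (\<Oplus>\<^bsub>tensor_space K (coind \<pi> K H \<Delta> C \<sigma> V \<rho> \<alpha>) (H \<beta>)\<^esub> e \<in> B \<beta>.
        pure_tensor K (coind \<pi> K H \<Delta> C \<sigma> V \<rho> \<alpha>) (H \<beta>)
          (\<lambda>v\<in>carrier (V \<one>\<^bsub>\<pi>\<^esub>).
             tensor_runit K (H \<alpha>) (tensor_map K (H \<alpha>) (self_space K) id (g \<beta> e) (\<Delta> \<alpha> \<beta> (F v))))
          e)"

end

theory Submission
  imports Defs
begin

text \<open>
  Linear maps out of a tensor product are determined by their values on pure tensors, so the
  comodule axioms of \<open>Coind(\<rho>)\<close> reduce to the behaviour of the slices \<open>(I \<otimes> f) \<Delta>\<^sub>\<alpha>\<^sub>,\<^sub>\<beta> F\<close> for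
  functionals \<open>f\<close> on \<open>H\<^sub>\<beta>\<close>: coassociativity of \<open>\<Delta>\<close> makes an iterated slice of \<open>F\<close> a slice along
  the functional \<open>(h \<otimes> f) \<Delta>\<^sub>\<beta>\<^sub>,\<^sub>\<gamma>\<close>, and every slice is expanded in the slices along a dual basis.
  The defining condition of \<open>Coind\<close> involves only \<open>V\<^sub>1\<close> and \<open>\<rho>\<^sub>1\<^sub>,\<^sub>1\<close>, so precomposition with the
  inverse of the given isomorphism \<open>V\<^sub>1 \<rightarrow> W\<^sub>1\<close> is the required equivalence.
\<close>

section \<open>Linear and bilinear maps\<close>

text \<open>Testing an equation in \<open>X \<alpha>\<close> \<otimes> \<open>H \<beta>\<close> by
  evaluating its left factors at the points of V1 would need injectivity of the induced map into the
  linear maps from V1 to \<open>H \<alpha>\<close> \<otimes> \<open>H \<beta>\<close>. Explicit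
  finite sums take the place of that argument. Both sides of the coassociativity law for the
  coaction become one triple sum, whose coefficients are the structure constants of \<Delta> in the
  chosen bases; what is left is to move scalars across a tensor sign and to reorder sums. Slices are
  needed along arbitrary functionals, because a functional of the form (h \<otimes> f) \<Delta> is
  in general not a member of the dual basis. The encoding is the other obstacle. Tensors are cosets
  in a free space, and \<open>tensor_lift\<close> evaluates a sum on an arbitrarily chosen
  representative, so nothing can be computed before this choice is shown to be harmless for bilinear
  maps. Moreover the coaction is built from pure tensors over \<open>X \<alpha>\<close> itself and
  not over the larger space of all linear maps, so every slice of a coinduced map must first be
  shown to be coinduced.\<close>

lemma linear_mapI:
  assumes "vectorspace K M" "vectorspace K N"
    and "\<And>x. x \<in> carrier M \<Longrightarrow> f x \<in> carrier N"
    and "\<And>x y. x \<in> carrier M \<Longrightarrow> y \<in> carrier M \<Longrightarrow> f (x \<oplus>\<^bsub>M\<^esub> y) = f x \<oplus>\<^bsub>N\<^esub> f y"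
    and "\<And>a x. a \<in> carrier K \<Longrightarrow> x \<in> carrier M \<Longrightarrow> f (a \<odot>\<^bsub>M\<^esub> x) = a \<odot>\<^bsub>N\<^esub> f x"
  shows "linear_map K M N f"
  using assms unfolding linear_map_def mod_hom_def mod_hom_axioms_def module_hom_def vectorspace_def
  by auto

lemma
  assumes "linear_map K M N f"
  shows linear_map_dom: "vectorspace K M"
    and linear_map_cod: "vectorspace K N"
    and linear_map_closed: "x \<in> carrier M \<Longrightarrow> f x \<in> carrier N"
    and linear_map_add:
      "x \<in> carrier M \<Longrightarrow> y \<in> carrier M \<Longrightarrow> f (x \<oplus>\<^bsub>M\<^esub> y) = f x \<oplus>\<^bsub>N\<^esub> f y"
    and linear_map_smult:
      "a \<in> carrier K \<Longrightarrow> x \<in> carrier M \<Longrightarrow> f (a \<odot>\<^bsub>M\<^esub> x) = a \<odot>\<^bsub>N\<^esub> f x"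
    and linear_map_zero: "f \<zero>\<^bsub>M\<^esub> = \<zero>\<^bsub>N\<^esub>"
proof -
  interpret linear_map K M N f by fact
  show "vectorspace K M" "vectorspace K N" by unfold_locales
  show "f \<zero>\<^bsub>M\<^esub> = \<zero>\<^bsub>N\<^esub>" by simp
qed (use assms in \<open>auto simp: linear_map_def mod_hom_def mod_hom_axioms_def module_hom_def\<close>)

lemma linear_map_comp:
  assumes "linear_map K M N f" "linear_map K N P h"
  shows "linear_map K M P (\<lambda>x. h (f x))"
  using assms by (intro linear_mapI)
    (auto simp: linear_map_closed linear_map_add linear_map_smult dest: linear_map_dom linear_map_cod)

lemma linear_map_id: "vectorspace K M \<Longrightarrow> linear_map K M M id"
  by (intro linear_mapI) auto

text \<open>Linearity constrains a map only on the carrier of its domain, so values elsewhere may be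
  changed. This transfers linearity to maps cut off by \<open>restrict\<close>.\<close>

lemma linear_map_cong:
  assumes "linear_map K M N f" "\<And>x. x \<in> carrier M \<Longrightarrow> h x = f x"
  shows "linear_map K M N h"
proof -
  interpret linear_map K M N f by fact
  show ?thesis
    using assms by (intro linear_mapI)
      (auto simp: linear_map_closed linear_map_add linear_map_smult dest: linear_map_dom linear_map_cod)
qed

lemma linear_map_finsum:
  assumes f: "linear_map K M N f" and x: "\<And>i. i \<in> A \<Longrightarrow> x i \<in> carrier M"
  shows "f (\<Oplus>\<^bsub>M\<^esub> i\<in>A. x i) = (\<Oplus>\<^bsub>N\<^esub> i\<in>A. f (x i))"
proof -
  interpret linear_map K M N f by fact
  show ?thesis
  proof (cases "finite A")
    case True
    then show ?thesis using x
      by (induct A) (auto simp: Pi_def)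
  \<comment> \<open>Over an infinite index set both sums take the default value zero, and
    \<open>f\<close> preserves zero.\<close>
  qed (simp add: finsum_def finprod_def)
qed

lemma linear_map_const_zero:
  assumes "vectorspace K M" "vectorspace K N"
  shows "linear_map K M N (\<lambda>x. \<zero>\<^bsub>N\<^esub>)"
proof -
  interpret N: vectorspace K N by fact
  show ?thesis using assms by (intro linear_mapI) auto
qed

lemma linear_map_plus:
  assumes f: "linear_map K M N f" and h: "linear_map K M N h"
  shows "linear_map K M N (\<lambda>x. f x \<oplus>\<^bsub>N\<^esub> h x)"
proof -
  interpret N: vectorspace K N by (rule linear_map_cod[OF f])
  interpret f: linear_map K M N f by fact
  interpret h: linear_map K M N h by fact
  show ?thesis
    using linear_map_dom[OF f] linear_map_cod[OF f]
    by (intro linear_mapI) (auto simp: N.smult_r_distr N.a_ac)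
qed

lemma linear_map_scale:
  assumes f: "linear_map K M N f" and a: "a \<in> carrier K"
  shows "linear_map K M N (\<lambda>x. a \<odot>\<^bsub>N\<^esub> f x)"
proof -
  interpret N: vectorspace K N by (rule linear_map_cod[OF f])
  interpret f: linear_map K M N f by fact
  show ?thesis
    using linear_map_dom[OF f] linear_map_cod[OF f] a
    by (intro linear_mapI)
      (auto simp: N.smult_r_distr N.smult_assoc1[symmetric] N.m_comm)
qed

lemma linear_map_sum:
  assumes M: "vectorspace K M" and N: "vectorspace K N"
    and f: "\<And>i. i \<in> A \<Longrightarrow> linear_map K M N (f i)"
  shows "linear_map K M N (\<lambda>x. \<Oplus>\<^bsub>N\<^esub> i\<in>A. f i x)"
proof (cases "finite A")
  case True
  interpret N: vectorspace K N by fact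
  show ?thesis
    using True f
  proof (induct A)
    case empty
    then show ?case using linear_map_const_zero[OF M N] by simp
  next
    case (insert i A)
    have "linear_map K M N (\<lambda>x. f i x \<oplus>\<^bsub>N\<^esub> (\<Oplus>\<^bsub>N\<^esub> i\<in>A. f i x))"
      using insert by (intro linear_map_plus) auto
    then show ?case
      by (rule linear_map_cong) (use insert linear_map_closed[OF insert.prems] in \<open>auto simp: Pi_iff\<close>)
  qed
qed (use linear_map_const_zero[OF M N] in \<open>simp add: finsum_def finprod_def\<close>)

text \<open>Serves to bring the triple sum of the coassociativity proof into the two orders in which
  it is read.\<close>

lemma (in abelian_monoid) finsum_swap:
  assumes "finite A" "finite B" "\<And>i j. i \<in> A \<Longrightarrow> j \<in> B \<Longrightarrow> x i j \<in> carrier G"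
  shows "(\<Oplus>i\<in>A. \<Oplus>j\<in>B. x i j) = (\<Oplus>j\<in>B. \<Oplus>i\<in>A. x i j)"
  using assms(1,3)
proof (induct A)
  case empty
  then show ?case using finsum_zero by simp
next
  case (insert i A)
  then have "(\<Oplus>i\<in>insert i A. \<Oplus>j\<in>B. x i j) = (\<Oplus>j\<in>B. x i j) \<oplus> (\<Oplus>j\<in>B. \<Oplus>i\<in>A. x i j)"
    by (subst finsum_insert) (auto intro!: finsum_closed)
  also have "\<dots> = (\<Oplus>j\<in>B. x i j \<oplus> (\<Oplus>i\<in>A. x i j))"
    using insert by (intro finsum_addf[symmetric]) (auto intro!: finsum_closed)
  also have "\<dots> = (\<Oplus>j\<in>B. \<Oplus>i\<in>insert i A. x i j)"
    using insert by (intro finsum_cong') (auto intro!: finsum_closed simp: finsum_insert Pi_iff)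
  finally show ?case .
qed

lemma linear_iso_inverse:
  assumes f: "linear_iso K M N f"
  shows "linear_map K N M (inv_into (carrier M) f)"
proof -
  have lin: "linear_map K M N f" and bij: "bij_betw f (carrier M) (carrier N)"
    using f by (auto simp: linear_iso_def)
  let ?h = "inv_into (carrier M) f"
  interpret M: vectorspace K M by (rule linear_map_dom[OF lin])
  have inj: "inj_on f (carrier M)" using bij by (rule bij_betw_imp_inj_on)
  have h: "?h y \<in> carrier M" "f (?h y) = y" if "y \<in> carrier N" for y
    using bij that by (auto simp: bij_betw_def inv_into_into f_inv_into_f)
  show ?thesis
  proof (rule linear_mapI[OF linear_map_cod[OF lin] linear_map_dom[OF lin] h(1)])
    fix x y assume "x \<in> carrier N" "y \<in> carrier N"
    then show "?h (x \<oplus>\<^bsub>N\<^esub> y) = ?h x \<oplus>\<^bsub>M\<^esub> ?h y"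
      using h by (intro inv_into_f_eq[OF inj]) (auto simp: linear_map_add[OF lin])
  next
    fix a x assume "a \<in> carrier K" "x \<in> carrier N"
    then show "?h (a \<odot>\<^bsub>N\<^esub> x) = a \<odot>\<^bsub>M\<^esub> ?h x"
      using h by (intro inv_into_f_eq[OF inj]) (auto simp: linear_map_smult[OF lin])
  qed
qed

text \<open>The vector space conditions belong to the predicate, so that this single assumption
  suffices for the universal property of the tensor product.\<close>

definition bilinear_map ::
  "('k, 'm) ring_scheme \<Rightarrow> ('k, 'a) module \<Rightarrow> ('k, 'b) module \<Rightarrow> ('k, 'c) module \<Rightarrow>
    ('a \<Rightarrow> 'b \<Rightarrow> 'c) \<Rightarrow> bool" where
  "bilinear_map K M N P b \<longleftrightarrow> vectorspace K M \<and> vectorspace K N \<and> vectorspace K P \<and>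
     (\<forall>m\<in>carrier M. linear_map K N P (b m)) \<and> (\<forall>n\<in>carrier N. linear_map K M P (\<lambda>m. b m n))"

lemma bilinear_mapI:
  assumes "vectorspace K M" "vectorspace K N" "vectorspace K P"
    and "\<And>m. m \<in> carrier M \<Longrightarrow> linear_map K N P (b m)"
    and "\<And>n. n \<in> carrier N \<Longrightarrow> linear_map K M P (\<lambda>m. b m n)"
  shows "bilinear_map K M N P b"
  using assms by (auto simp: bilinear_map_def)

lemma
  assumes "bilinear_map K M N P b"
  shows bilinear_map_left_linear: "n \<in> carrier N \<Longrightarrow> linear_map K M P (\<lambda>m. b m n)"
    and bilinear_map_right_linear: "m \<in> carrier M \<Longrightarrow> linear_map K N P (b m)"
    and bilinear_map_closed: "m \<in> carrier M \<Longrightarrow> n \<in> carrier N \<Longrightarrow> b m n \<in> carrier P"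
  using assms linear_map_closed by (fastforce simp: bilinear_map_def)+

section \<open>Free vector spaces\<close>

lemma
  shows free_space_add: "(\<phi> \<oplus>\<^bsub>free_space K A\<^esub> \<psi>) x = \<phi> x \<oplus>\<^bsub>K\<^esub> \<psi> x"
    and free_space_smult: "(a \<odot>\<^bsub>free_space K A\<^esub> \<phi>) x = a \<otimes>\<^bsub>K\<^esub> \<phi> x"
    and free_space_zero: "\<zero>\<^bsub>free_space K A\<^esub> x = \<zero>\<^bsub>K\<^esub>"
  by (simp_all add: free_space_def)

text \<open>Since zero lies in K, the separate demands on and off \<open>A\<close> merge into one
  condition on all values and one on the support.\<close>

lemma free_space_carrier_iff:
  assumes "field K"
  shows "\<phi> \<in> carrier (free_space K A) \<longleftrightarrow>
    (\<forall>x. \<phi> x \<in> carrier K) \<and> {x. \<phi> x \<noteq> \<zero>\<^bsub>K\<^esub>} \<subseteq> A \<and> finite {x. \<phi> x \<noteq> \<zero>\<^bsub>K\<^esub>}"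
proof -
  interpret K: field K by fact
  show ?thesis by (auto simp: free_space_def)
qed

lemma free_space_vectorspace:
  assumes "field K"
  shows "vectorspace K (free_space K A)"
proof -
  interpret K: field K by fact
  note iff = free_space_carrier_iff[OF assms]
  note simps = free_space_add free_space_smult free_space_zero
  have "module K (free_space K A)"
  \<comment> \<open>Cases 3, 4 and 5 are closure under addition, existence of negatives and closure
    under scalars. In each of them the point is that the support stays finite; the remaining axioms
    hold pointwise.\<close>
  proof (rule module_criteria, goal_cases)
    case 3
    show ?case
    proof (intro allI impI, elim conjE)
      fix v w assume vw: "v \<in> carrier (free_space K A)" "w \<in> carrier (free_space K A)"
      have "{x. v x \<oplus>\<^bsub>K\<^esub> w x \<noteq> \<zero>\<^bsub>K\<^esub>} \<subseteq> {x. v x \<noteq> \<zero>\<^bsub>K\<^esub>} \<union> {x. w x \<noteq> \<zero>\<^bsub>K\<^esub>}" by auto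
      with vw show "v \<oplus>\<^bsub>free_space K A\<^esub> w \<in> carrier (free_space K A)"
        by (auto simp: iff simps elim!: finite_subset)
    qed
  next
    case 4
    show ?case
    proof
      fix v assume v: "v \<in> carrier (free_space K A)"
      have "{x. \<ominus>\<^bsub>K\<^esub> v x \<noteq> \<zero>\<^bsub>K\<^esub>} \<subseteq> {x. v x \<noteq> \<zero>\<^bsub>K\<^esub>}" by auto
      with v have "(\<lambda>x. \<ominus>\<^bsub>K\<^esub> v x) \<in> carrier (free_space K A)"
        by (auto simp: iff elim!: finite_subset)
      with v show "\<exists>n\<in>carrier (free_space K A). v \<oplus>\<^bsub>free_space K A\<^esub> n = \<zero>\<^bsub>free_space K A\<^esub>"
        by (intro bexI[of _ "\<lambda>x. \<ominus>\<^bsub>K\<^esub> v x"]) (auto simp: iff simps K.r_neg fun_eq_iff)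
    qed
  next
    case 5
    show ?case
    proof (intro allI impI, elim conjE)
      fix c v assume cv: "c \<in> carrier K" "v \<in> carrier (free_space K A)"
      have "{x. c \<otimes>\<^bsub>K\<^esub> v x \<noteq> \<zero>\<^bsub>K\<^esub>} \<subseteq> {x. v x \<noteq> \<zero>\<^bsub>K\<^esub>}" using cv(1) by auto
      with cv show "c \<odot>\<^bsub>free_space K A\<^esub> v \<in> carrier (free_space K A)"
        by (auto simp: iff simps elim!: finite_subset)
    qed
  next
    case 1 show ?case by unfold_locales
  qed (auto simp: iff simps fun_eq_iff K.a_ac K.m_assoc K.l_distr K.r_distr)
  then show ?thesis by (simp add: vectorspace_def assms)
qed

lemma free_gen_closed: "field K \<Longrightarrow> x \<in> A \<Longrightarrow> free_gen K x \<in> carrier (free_space K A)"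
  by (auto simp: free_space_carrier_iff free_gen_def intro: monoid.one_closed
      abelian_monoid.zero_closed dest: field.is_ring ring.ring_simprules)

text \<open>The scalar is kept in the generator case, so no separate case for scalar multiples
  arises; for tensors it can then be absorbed into a factor.\<close>

lemma free_space_induct [consumes 2, case_names zero gen add]:
  assumes K: "field K" and \<phi>: "\<phi> \<in> carrier (free_space K A)"
    and zero: "P \<zero>\<^bsub>free_space K A\<^esub>"
    and gen: "\<And>a x. a \<in> carrier K \<Longrightarrow> x \<in> A \<Longrightarrow> P (a \<odot>\<^bsub>free_space K A\<^esub> free_gen K x)"
    and add: "\<And>\<phi> \<psi>. \<lbrakk>\<phi> \<in> carrier (free_space K A); \<psi> \<in> carrier (free_space K A); P \<phi>; P \<psi>\<rbrakk> \<Longrightarrow>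
      P (\<phi> \<oplus>\<^bsub>free_space K A\<^esub> \<psi>)"
  shows "P \<phi>"
proof -
  interpret K: field K by fact
  interpret F: vectorspace K "free_space K A" by (rule free_space_vectorspace[OF K])
  note iff = free_space_carrier_iff[OF K]
  note simps = free_space_add free_space_smult free_space_zero
  \<comment> \<open>The induction runs over a finite set containing the support instead of the
    support itself. Setting one value to zero then leaves a function covered by the smaller set,
    whether or not that value was zero before.\<close>
  have "P \<phi>" if "finite S" "{x. \<phi> x \<noteq> \<zero>\<^bsub>K\<^esub>} \<subseteq> S" "S \<subseteq> A" "\<phi> \<in> carrier (free_space K A)" for S \<phi>
    using that
  proof (induct S arbitrary: \<phi>)
    case empty
    then have "\<phi> = \<zero>\<^bsub>free_space K A\<^esub>" by (auto simp: simps fun_eq_iff)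
    then show ?case using zero by simp
  next
    case (insert x S)
    let ?\<psi> = "\<phi>(x := \<zero>\<^bsub>K\<^esub>)" and ?\<chi> = "\<phi> x \<odot>\<^bsub>free_space K A\<^esub> free_gen K x"
    have x: "\<phi> x \<in> carrier K" "x \<in> A" using insert.prems by (auto simp: iff)
    have "{y. ?\<psi> y \<noteq> \<zero>\<^bsub>K\<^esub>} \<subseteq> {y. \<phi> y \<noteq> \<zero>\<^bsub>K\<^esub>}" by auto
    with insert.prems have \<psi>: "?\<psi> \<in> carrier (free_space K A)"
      using finite_subset[of "{y. ?\<psi> y \<noteq> \<zero>\<^bsub>K\<^esub>}" "{y. \<phi> y \<noteq> \<zero>\<^bsub>K\<^esub>}"] by (auto simp: iff)
    have \<chi>: "?\<chi> \<in> carrier (free_space K A)"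
      using x free_gen_closed[OF K, of x A] by blast
    have "P ?\<psi>" by (rule insert.hyps) (use insert.prems \<psi> in \<open>auto simp: fun_upd_def\<close>)
    with add[OF \<psi> \<chi>] gen[OF x] have "P (?\<psi> \<oplus>\<^bsub>free_space K A\<^esub> ?\<chi>)" by blast
    also have "?\<psi> \<oplus>\<^bsub>free_space K A\<^esub> ?\<chi> = \<phi>"
      using insert.prems(3) by (auto simp: simps fun_eq_iff iff free_gen_def)
    finally show ?case .
  qed
  from this[of "{x. \<phi> x \<noteq> \<zero>\<^bsub>K\<^esub>}" \<phi>] show ?thesis using \<phi> by (auto simp: iff)
qed

text \<open>This is the sum inside \<open>tensor_lift\<close>, separated from the choice of a
  representative, so that its linearity can be proved on the free space.\<close>

definition free_lift ::
  "('k, 'm) ring_scheme \<Rightarrow> ('k, 'c) module \<Rightarrow> ('x \<Rightarrow> 'c) \<Rightarrow> ('x \<Rightarrow> 'k) \<Rightarrow> 'c" where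
  "free_lift K P h \<phi> = (\<Oplus>\<^bsub>P\<^esub> x \<in> {x. \<phi> x \<noteq> \<zero>\<^bsub>K\<^esub>}. \<phi> x \<odot>\<^bsub>P\<^esub> h x)"

text \<open>Functions with different supports can be added under the sum only over a common index
  set; the extra terms have coefficient zero.\<close>

lemma free_lift_superset:
  assumes "vectorspace K P" "h \<in> A \<rightarrow> carrier P" "\<phi> \<in> carrier (free_space K A)"
    and "finite S" "{x. \<phi> x \<noteq> \<zero>\<^bsub>K\<^esub>} \<subseteq> S" "S \<subseteq> A"
  shows "free_lift K P h \<phi> = (\<Oplus>\<^bsub>P\<^esub> x \<in> S. \<phi> x \<odot>\<^bsub>P\<^esub> h x)"
proof -
  interpret P: vectorspace K P by fact
  have K: "field K" by unfold_locales
  show ?thesis unfolding free_lift_def using assms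
    by (intro P.add.finprod_mono_neutral_cong_left) (auto simp: free_space_carrier_iff[OF K] Pi_iff)
qed

lemma free_lift_linear:
  assumes P: "vectorspace K P" and h: "h \<in> A \<rightarrow> carrier P"
  shows "linear_map K (free_space K A) P (free_lift K P h)"
proof -
  interpret P: vectorspace K P by fact
  have K: "field K" by unfold_locales
  interpret F: vectorspace K "free_space K A" by (rule free_space_vectorspace[OF K])
  note iff = free_space_carrier_iff[OF K]
  note simps = free_space_add free_space_smult free_space_zero
  have cl: "\<phi> x \<odot>\<^bsub>P\<^esub> h x \<in> carrier P" if "\<phi> \<in> carrier (free_space K A)" "x \<in> A" for \<phi> x
    using that h by (auto simp: iff Pi_iff)
  show ?thesis
  proof (rule linear_mapI)
    fix \<phi> assume "\<phi> \<in> carrier (free_space K A)"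
    then show "free_lift K P h \<phi> \<in> carrier P"
      unfolding free_lift_def by (intro P.finsum_closed) (use cl in \<open>auto simp: iff\<close>)
  next
    fix \<phi> \<psi> assume \<phi>\<psi>: "\<phi> \<in> carrier (free_space K A)" "\<psi> \<in> carrier (free_space K A)"
    let ?S = "{x. \<phi> x \<noteq> \<zero>\<^bsub>K\<^esub>} \<union> {x. \<psi> x \<noteq> \<zero>\<^bsub>K\<^esub>}"
    have S: "finite ?S" "?S \<subseteq> A" using \<phi>\<psi> by (auto simp: iff)
    have "free_lift K P h (\<phi> \<oplus>\<^bsub>free_space K A\<^esub> \<psi>) =
        (\<Oplus>\<^bsub>P\<^esub> x \<in> ?S. (\<phi> \<oplus>\<^bsub>free_space K A\<^esub> \<psi>) x \<odot>\<^bsub>P\<^esub> h x)"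
      using \<phi>\<psi> S by (intro free_lift_superset[OF P h]) (auto simp: simps)
    also have "\<dots> = (\<Oplus>\<^bsub>P\<^esub> x \<in> ?S. \<phi> x \<odot>\<^bsub>P\<^esub> h x \<oplus>\<^bsub>P\<^esub> \<psi> x \<odot>\<^bsub>P\<^esub> h x)"
      using \<phi>\<psi> S h cl by (intro P.finsum_cong') (auto simp: simps iff P.smult_l_distr Pi_iff)
    also have "\<dots> = (\<Oplus>\<^bsub>P\<^esub> x \<in> ?S. \<phi> x \<odot>\<^bsub>P\<^esub> h x) \<oplus>\<^bsub>P\<^esub> (\<Oplus>\<^bsub>P\<^esub> x \<in> ?S. \<psi> x \<odot>\<^bsub>P\<^esub> h x)"
      using \<phi>\<psi> S cl by (intro P.finsum_addf) auto
    also have "(\<Oplus>\<^bsub>P\<^esub> x \<in> ?S. \<phi> x \<odot>\<^bsub>P\<^esub> h x) = free_lift K P h \<phi>"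
      using \<phi>\<psi> S by (intro free_lift_superset[OF P h, symmetric]) auto
    also have "(\<Oplus>\<^bsub>P\<^esub> x \<in> ?S. \<psi> x \<odot>\<^bsub>P\<^esub> h x) = free_lift K P h \<psi>"
      using \<phi>\<psi> S by (intro free_lift_superset[OF P h, symmetric]) auto
    finally show "free_lift K P h (\<phi> \<oplus>\<^bsub>free_space K A\<^esub> \<psi>) = free_lift K P h \<phi> \<oplus>\<^bsub>P\<^esub> free_lift K P h \<psi>" .
  next
    fix a \<phi> assume a: "a \<in> carrier K" and \<phi>: "\<phi> \<in> carrier (free_space K A)"
    let ?S = "{x. \<phi> x \<noteq> \<zero>\<^bsub>K\<^esub>}"
    have S: "finite ?S" "?S \<subseteq> A" using \<phi> by (auto simp: iff)
    have "free_lift K P h (a \<odot>\<^bsub>free_space K A\<^esub> \<phi>) =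
        (\<Oplus>\<^bsub>P\<^esub> x \<in> ?S. (a \<odot>\<^bsub>free_space K A\<^esub> \<phi>) x \<odot>\<^bsub>P\<^esub> h x)"
      using a \<phi> S by (intro free_lift_superset[OF P h]) (auto simp: simps)
    also have "\<dots> = (\<Oplus>\<^bsub>P\<^esub> x \<in> ?S. a \<odot>\<^bsub>P\<^esub> (\<phi> x \<odot>\<^bsub>P\<^esub> h x))"
      using a \<phi> S h cl by (intro P.finsum_cong') (auto simp: simps iff P.smult_assoc1 Pi_iff subset_iff)
    also have "\<dots> = a \<odot>\<^bsub>P\<^esub> free_lift K P h \<phi>"
      unfolding free_lift_def using a \<phi> S cl by (intro P.finsum_smult_ldistr[symmetric]) auto
    finally show "free_lift K P h (a \<odot>\<^bsub>free_space K A\<^esub> \<phi>) = a \<odot>\<^bsub>P\<^esub> free_lift K P h \<phi>" .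
  qed (use P F.vectorspace_axioms in auto)
qed

lemma free_lift_gen:
  assumes P: "vectorspace K P" and h: "h \<in> A \<rightarrow> carrier P" and x: "x \<in> A"
  shows "free_lift K P h (free_gen K x) = h x"
proof -
  interpret P: vectorspace K P by fact
  have K: "field K" by unfold_locales
  have "free_lift K P h (free_gen K x) = (\<Oplus>\<^bsub>P\<^esub> y \<in> {x}. free_gen K x y \<odot>\<^bsub>P\<^esub> h y)"
    using x by (intro free_lift_superset[OF P h] free_gen_closed[OF K]) (auto simp: free_gen_def)
  also have "\<dots> = h x"
    using h x by (subst P.finsum_insert) (auto simp: free_gen_def Pi_iff)
  finally show ?thesis .
qed

section \<open>The tensor product\<close>

lemma tensor_rels_carrier:
  assumes "vectorspace K M" "vectorspace K N"
  shows "tensor_rels K M N \<subseteq> carrier (pair_space K M N)"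
proof -
  interpret M: vectorspace K M by fact
  interpret N: vectorspace K N by fact
  have K: "field K" by unfold_locales
  interpret F: vectorspace K "pair_space K M N" by (rule free_space_vectorspace[OF K])
  show ?thesis
    unfolding tensor_rels_def Let_def by (auto intro!: free_gen_closed[OF K] F.minus_closed)
qed

lemma tensor_null_submodule:
  assumes "vectorspace K M" "vectorspace K N"
  shows "submodule K (tensor_null K M N) (pair_space K M N)"
proof -
  interpret M: vectorspace K M by fact
  have K: "field K" by unfold_locales
  interpret F: vectorspace K "pair_space K M N" by (rule free_space_vectorspace[OF K])
  show ?thesis
    unfolding tensor_null_def by (rule F.span_is_submodule) (rule tensor_rels_carrier[OF assms])
qed

lemma tensor_rels_null:
  assumes "vectorspace K M" "vectorspace K N"
  shows "tensor_rels K M N \<subseteq> tensor_null K M N"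
proof -
  interpret M: vectorspace K M by fact
  have K: "field K" by unfold_locales
  interpret F: vectorspace K "pair_space K M N" by (rule free_space_vectorspace[OF K])
  show ?thesis
    unfolding tensor_null_def by (rule F.in_own_span) (rule tensor_rels_carrier[OF assms])
qed

section \<open>The quotient map onto the tensor product\<close>

definition tensor_class ::
  "('k, 'm) ring_scheme \<Rightarrow> ('k, 'a) module \<Rightarrow> ('k, 'b) module \<Rightarrow> ('a \<times> 'b \<Rightarrow> 'k) \<Rightarrow>
    ('k, 'a, 'b) tensor" where
  "tensor_class K M N \<phi> = tensor_null K M N +>\<^bsub>pair_space K M N\<^esub> \<phi>"

text \<open>A span is known to be a submodule, whereas the calculus of cosets asks for an additive
  subgroup. Negatives come from multiplication by the scalar -1.\<close>

lemma tensor_null_subgroup: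
  assumes "vectorspace K M" "vectorspace K N"
  shows "abelian_subgroup (tensor_null K M N) (pair_space K M N)"
proof -
  interpret M: vectorspace K M by fact
  have K: "field K" by unfold_locales
  interpret F: vectorspace K "pair_space K M N" by (rule free_space_vectorspace[OF K])
  interpret R: LinearCombinations.submodule K "tensor_null K M N" "pair_space K M N"
    by (rule tensor_null_submodule[OF assms])
  show ?thesis
  proof (rule abelian_subgroupI3, rule additive_subgroupI)
    show "subgroup (tensor_null K M N) (add_monoid (pair_space K M N))"
    proof (rule F.add.subgroupI)
      fix a assume a: "a \<in> tensor_null K M N"
      then have "a \<in> carrier (pair_space K M N)" using R.subset by blast
      with a show "\<ominus>\<^bsub>pair_space K M N\<^esub> a \<in> tensor_null K M N"
        using R.smult_closed[of "\<ominus>\<^bsub>K\<^esub> \<one>\<^bsub>K\<^esub>" a] F.smult_minus_1[of a] by simp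
    qed (use R.subset in \<open>auto intro: R.zero_closed\<close>)
  qed unfold_locales
qed

lemma tensor_space_carrier:
  "carrier (tensor_space K M N) = tensor_class K M N ` carrier (pair_space K M N)"
  by (auto simp: tensor_space_def tensor_class_def Let_def A_RCOSETS_def' RCOSETS_def a_r_coset_def)

lemma
  assumes M: "vectorspace K M" and N: "vectorspace K N"
    and \<phi>: "\<phi> \<in> carrier (pair_space K M N)"
  shows tensor_class_rep: "\<phi> \<in> tensor_class K M N \<phi>"
    and tensor_class_add: "\<psi> \<in> carrier (pair_space K M N) \<Longrightarrow>
      tensor_class K M N (\<phi> \<oplus>\<^bsub>pair_space K M N\<^esub> \<psi>) =
      tensor_class K M N \<phi> \<oplus>\<^bsub>tensor_space K M N\<^esub> tensor_class K M N \<psi>"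
    and tensor_class_smult: "a \<in> carrier K \<Longrightarrow>
      tensor_class K M N (a \<odot>\<^bsub>pair_space K M N\<^esub> \<phi>) = a \<odot>\<^bsub>tensor_space K M N\<^esub> tensor_class K M N \<phi>"
    and tensor_class_eqI: "\<psi> \<in> carrier (pair_space K M N) \<Longrightarrow>
      \<phi> \<ominus>\<^bsub>pair_space K M N\<^esub> \<psi> \<in> tensor_null K M N \<Longrightarrow>
      tensor_class K M N \<phi> = tensor_class K M N \<psi>"
    and tensor_class_repD: "\<psi> \<in> tensor_class K M N \<phi> \<Longrightarrow>
      \<exists>r\<in>tensor_null K M N. \<psi> = r \<oplus>\<^bsub>pair_space K M N\<^esub> \<phi>"
proof -
  interpret M: vectorspace K M by fact
  have K: "field K" by unfold_locales
  interpret F: vectorspace K "pair_space K M N" by (rule free_space_vectorspace[OF K])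
  interpret S: LinearCombinations.submodule K "tensor_null K M N" "pair_space K M N"
    by (rule tensor_null_submodule[OF M N])
  interpret R: abelian_subgroup "tensor_null K M N" "pair_space K M N"
    by (rule tensor_null_subgroup[OF M N])
  have rep: "\<phi> \<in> tensor_class K M N \<phi>" if "\<phi> \<in> carrier (pair_space K M N)" for \<phi>
    unfolding tensor_class_def using that by (rule R.a_rcos_self)
  have repD: "\<exists>r\<in>tensor_null K M N. \<psi> = r \<oplus>\<^bsub>pair_space K M N\<^esub> \<phi>"
    if "\<psi> \<in> tensor_class K M N \<phi>" for \<psi> \<phi>
    using that by (auto simp: tensor_class_def a_r_coset_def')
  show "tensor_class K M N (\<phi> \<oplus>\<^bsub>pair_space K M N\<^esub> \<psi>) =
      tensor_class K M N \<phi> \<oplus>\<^bsub>tensor_space K M N\<^esub> tensor_class K M N \<psi>"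
    if "\<psi> \<in> carrier (pair_space K M N)"
    using R.a_rcos_sum[OF \<phi> that] by (simp add: tensor_class_def tensor_space_def Let_def)
  have eqI: "tensor_class K M N \<phi> = tensor_class K M N \<psi>"
    if "\<phi> \<in> carrier (pair_space K M N)" "\<psi> \<in> carrier (pair_space K M N)"
      "\<phi> \<ominus>\<^bsub>pair_space K M N\<^esub> \<psi> \<in> tensor_null K M N" for \<phi> \<psi>
  proof -
    have "\<phi> = (\<phi> \<ominus>\<^bsub>pair_space K M N\<^esub> \<psi>) \<oplus>\<^bsub>pair_space K M N\<^esub> \<psi>"
      using that by (simp add: F.minus_eq F.a_assoc F.l_neg)
    then have "\<phi> \<in> tensor_class K M N \<psi>"
      using that by (auto simp: tensor_class_def a_r_coset_def')
    then show ?thesis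
      unfolding tensor_class_def
      using F.a_repr_independence[OF _ that(2) R.a_subgroup] by auto
  qed
  show "tensor_class K M N (a \<odot>\<^bsub>pair_space K M N\<^esub> \<phi>) = a \<odot>\<^bsub>tensor_space K M N\<^esub> tensor_class K M N \<phi>"
    if a: "a \<in> carrier K"
  proof -
    \<comment> \<open>Scalar multiplication of a coset is defined as a union over all its
      representatives. All members of that union coincide, because representatives differ by an
      element of the null space, which is closed under scalars.\<close>
    have "tensor_class K M N (a \<odot>\<^bsub>pair_space K M N\<^esub> \<psi>) = tensor_class K M N (a \<odot>\<^bsub>pair_space K M N\<^esub> \<phi>)"
      if "\<psi> \<in> tensor_class K M N \<phi>" for \<psi>
    proof -
      obtain r where r: "r \<in> tensor_null K M N" "\<psi> = r \<oplus>\<^bsub>pair_space K M N\<^esub> \<phi>"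
        using repD \<open>\<psi> \<in> tensor_class K M N \<phi>\<close> by blast
      have r': "r \<in> carrier (pair_space K M N)" using r S.subset by blast
      have "a \<odot>\<^bsub>pair_space K M N\<^esub> \<psi> \<ominus>\<^bsub>pair_space K M N\<^esub> a \<odot>\<^bsub>pair_space K M N\<^esub> \<phi> =
          a \<odot>\<^bsub>pair_space K M N\<^esub> r"
        using a r r' \<phi> by (simp add: F.smult_r_distr F.minus_eq F.a_assoc F.r_neg)
      then show ?thesis
        using a r r' \<phi> by (intro eqI) auto
    qed
    moreover have "\<phi> \<in> tensor_class K M N \<phi>" using rep \<phi> .
    ultimately have "(\<Union>\<psi>\<in>tensor_class K M N \<phi>. tensor_class K M N (a \<odot>\<^bsub>pair_space K M N\<^esub> \<psi>)) =
        tensor_class K M N (a \<odot>\<^bsub>pair_space K M N\<^esub> \<phi>)"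
      by blast
    then show ?thesis
      by (simp add: tensor_space_def tensor_class_def Let_def)
  qed
  show "\<phi> \<in> tensor_class K M N \<phi>" using rep \<phi> .
  show "\<exists>r\<in>tensor_null K M N. \<psi> = r \<oplus>\<^bsub>pair_space K M N\<^esub> \<phi>" if "\<psi> \<in> tensor_class K M N \<phi>"
    using repD that .
  show "tensor_class K M N \<phi> = tensor_class K M N \<psi>"
    if "\<psi> \<in> carrier (pair_space K M N)" "\<phi> \<ominus>\<^bsub>pair_space K M N\<^esub> \<psi> \<in> tensor_null K M N"
    using eqI \<phi> that .
qed

lemma tensor_space_zero:
  assumes M: "vectorspace K M" and N: "vectorspace K N"
  shows "\<zero>\<^bsub>tensor_space K M N\<^esub> = tensor_class K M N \<zero>\<^bsub>pair_space K M N\<^esub>"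
proof -
  interpret M: vectorspace K M by fact
  have K: "field K" by unfold_locales
  interpret F: vectorspace K "pair_space K M N" by (rule free_space_vectorspace[OF K])
  interpret R: abelian_subgroup "tensor_null K M N" "pair_space K M N"
    by (rule tensor_null_subgroup[OF M N])
  show ?thesis
    using F.a_coset_join2[OF F.M.zero_closed R.a_subgroup R.zero_closed]
    by (simp add: tensor_class_def tensor_space_def Let_def)
qed

text \<open>The quotient map hits every element and respects zero, addition and scalars, so the
  axioms descend from the free space.\<close>

lemma tensor_space_vectorspace:
  assumes M: "vectorspace K M" and N: "vectorspace K N"
  shows "vectorspace K (tensor_space K M N)"
proof -
  interpret M: vectorspace K M by fact
  have K: "field K" by unfold_locales
  interpret F: vectorspace K "pair_space K M N" by (rule free_space_vectorspace[OF K])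
  note simps = tensor_space_carrier tensor_space_zero[OF M N] tensor_class_add[OF M N, symmetric]
    tensor_class_smult[OF M N, symmetric]
  have "module K (tensor_space K M N)"
  proof (rule module_criteria, goal_cases)
    case 1 show ?case by unfold_locales
  next
    case 4
    show ?case
    proof
      fix v assume "v \<in> carrier (tensor_space K M N)"
      then obtain \<phi> where \<phi>: "\<phi> \<in> carrier (pair_space K M N)" "v = tensor_class K M N \<phi>"
        by (auto simp: simps)
      then show "\<exists>n\<in>carrier (tensor_space K M N). v \<oplus>\<^bsub>tensor_space K M N\<^esub> n = \<zero>\<^bsub>tensor_space K M N\<^esub>"
        by (intro bexI[of _ "tensor_class K M N (\<ominus>\<^bsub>pair_space K M N\<^esub> \<phi>)"]) (auto simp: simps F.r_neg)
    qed
  qed (auto simp: simps F.smult_r_distr F.smult_l_distr F.smult_assoc1 F.a_ac)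
  then show ?thesis by (simp add: vectorspace_def K)
qed

lemma tensor_class_linear:
  assumes M: "vectorspace K M" and N: "vectorspace K N"
  shows "linear_map K (pair_space K M N) (tensor_space K M N) (tensor_class K M N)"
proof -
  interpret M: vectorspace K M by fact
  have K: "field K" by unfold_locales
  show ?thesis
    using free_space_vectorspace[OF K] tensor_space_vectorspace[OF M N]
    by (intro linear_mapI)
      (auto simp: tensor_space_carrier tensor_class_add[OF M N] tensor_class_smult[OF M N])
qed

lemma pure_tensor_class: "pure_tensor K M N m n = tensor_class K M N (free_gen K (m, n))"
  by (simp add: pure_tensor_def tensor_class_def)

text \<open>Each of the four families in \<open>tensor_rels\<close> is one of the four bilinearity
  equations read modulo the null space.\<close>

lemma pure_tensor_bilinear:
  assumes M: "vectorspace K M" and N: "vectorspace K N"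
  shows "bilinear_map K M N (tensor_space K M N) (pure_tensor K M N)"
proof -
  interpret M: vectorspace K M by fact
  interpret N: vectorspace K N by fact
  have K: "field K" by unfold_locales
  interpret F: vectorspace K "pair_space K M N" by (rule free_space_vectorspace[OF K])
  interpret q: linear_map K "pair_space K M N" "tensor_space K M N" "tensor_class K M N"
    by (rule tensor_class_linear[OF M N])
  note gen = free_gen_closed[OF K, of _ "carrier M \<times> carrier N"]
  note relD = tensor_rels_null[OF M N, THEN subsetD]
  let ?F = "pair_space K M N" and ?\<delta> = "free_gen K" and ?T = "tensor_space K M N"
  have cl: "pure_tensor K M N m n \<in> carrier ?T" if "m \<in> carrier M" "n \<in> carrier N" for m n
    using that unfolding pure_tensor_class by (intro q.f_im gen) auto
  have eq: "tensor_class K M N (?\<delta> x) = tensor_class K M N \<psi>"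
    if "x \<in> carrier M \<times> carrier N" "\<psi> \<in> carrier ?F" "?\<delta> x \<ominus>\<^bsub>?F\<^esub> \<psi> \<in> tensor_rels K M N" for x \<psi>
    using that gen relD by (intro tensor_class_eqI[OF M N]) auto
  have 1: "pure_tensor K M N (m \<oplus>\<^bsub>M\<^esub> m') n = pure_tensor K M N m n \<oplus>\<^bsub>?T\<^esub> pure_tensor K M N m' n"
    if "m \<in> carrier M" "m' \<in> carrier M" "n \<in> carrier N" for m m' n
  proof -
    have "tensor_class K M N (?\<delta> (m \<oplus>\<^bsub>M\<^esub> m', n)) =
        tensor_class K M N (?\<delta> (m, n) \<oplus>\<^bsub>?F\<^esub> ?\<delta> (m', n))"
      using that gen by (intro eq) (auto simp: tensor_rels_def Let_def)
    with that gen show ?thesis by (simp add: pure_tensor_class)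
  qed
  have 2: "pure_tensor K M N m (n \<oplus>\<^bsub>N\<^esub> n') = pure_tensor K M N m n \<oplus>\<^bsub>?T\<^esub> pure_tensor K M N m n'"
    if "m \<in> carrier M" "n \<in> carrier N" "n' \<in> carrier N" for m n n'
  proof -
    have "tensor_class K M N (?\<delta> (m, n \<oplus>\<^bsub>N\<^esub> n')) =
        tensor_class K M N (?\<delta> (m, n) \<oplus>\<^bsub>?F\<^esub> ?\<delta> (m, n'))"
      using that gen by (intro eq) (auto simp: tensor_rels_def Let_def)
    with that gen show ?thesis by (simp add: pure_tensor_class)
  qed
  have 3: "pure_tensor K M N (a \<odot>\<^bsub>M\<^esub> m) n = a \<odot>\<^bsub>?T\<^esub> pure_tensor K M N m n"
    if "a \<in> carrier K" "m \<in> carrier M" "n \<in> carrier N" for a m n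
  proof -
    have "tensor_class K M N (?\<delta> (a \<odot>\<^bsub>M\<^esub> m, n)) = tensor_class K M N (a \<odot>\<^bsub>?F\<^esub> ?\<delta> (m, n))"
      using that gen by (intro eq) (auto simp: tensor_rels_def Let_def)
    with that gen show ?thesis by (simp add: pure_tensor_class)
  qed
  have 4: "pure_tensor K M N m (a \<odot>\<^bsub>N\<^esub> n) = a \<odot>\<^bsub>?T\<^esub> pure_tensor K M N m n"
    if "a \<in> carrier K" "m \<in> carrier M" "n \<in> carrier N" for a m n
  proof -
    have "tensor_class K M N (?\<delta> (m, a \<odot>\<^bsub>N\<^esub> n)) = tensor_class K M N (a \<odot>\<^bsub>?F\<^esub> ?\<delta> (m, n))"
      using that gen by (intro eq) (auto simp: tensor_rels_def Let_def)
    with that gen show ?thesis by (simp add: pure_tensor_class)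
  qed
  show ?thesis
    using cl 1 2 3 4 M N tensor_space_vectorspace[OF M N]
    by (intro bilinear_mapI linear_mapI) auto
qed

lemma pure_tensor_closed:
  assumes "vectorspace K M" "vectorspace K N" "m \<in> carrier M" "n \<in> carrier N"
  shows "pure_tensor K M N m n \<in> carrier (tensor_space K M N)"
  using bilinear_map_closed[OF pure_tensor_bilinear] assms .

section \<open>The universal property of the tensor product\<close>

text \<open>A scalar multiple of a generator becomes a pure tensor once the scalar is absorbed into
  the left factor, so sums of pure tensors exhaust the space and no case for scalars is
  needed.\<close>

lemma tensor_induct [consumes 3, case_names zero pure add]:
  assumes M: "vectorspace K M" and N: "vectorspace K N" and t: "t \<in> carrier (tensor_space K M N)"
    and zero: "P \<zero>\<^bsub>tensor_space K M N\<^esub>"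
    and pure: "\<And>m n. m \<in> carrier M \<Longrightarrow> n \<in> carrier N \<Longrightarrow> P (pure_tensor K M N m n)"
    and add: "\<And>t u. \<lbrakk>t \<in> carrier (tensor_space K M N); u \<in> carrier (tensor_space K M N); P t; P u\<rbrakk> \<Longrightarrow>
      P (t \<oplus>\<^bsub>tensor_space K M N\<^esub> u)"
  shows "P t"
proof -
  interpret M: vectorspace K M by fact
  have K: "field K" by unfold_locales
  obtain \<phi> where \<phi>: "\<phi> \<in> carrier (pair_space K M N)" "t = tensor_class K M N \<phi>"
    using t by (auto simp: tensor_space_carrier)
  from K \<phi>(1) have "P (tensor_class K M N \<phi>)"
  proof (induct rule: free_space_induct)
    case zero
    then show ?case using assms(4) by (simp add: tensor_space_zero[OF M N])
  next
    case (gen a x)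
    obtain m n where x: "x = (m, n)" "m \<in> carrier M" "n \<in> carrier N" using gen by auto
    have "tensor_class K M N (a \<odot>\<^bsub>pair_space K M N\<^esub> free_gen K x) = pure_tensor K M N (a \<odot>\<^bsub>M\<^esub> m) n"
      using gen x linear_map_smult[OF bilinear_map_left_linear[OF pure_tensor_bilinear[OF M N] x(3)]]
      by (subst tensor_class_smult[OF M N])
        (auto intro!: free_gen_closed[OF K] simp: pure_tensor_class)
    then show ?case using pure[of "a \<odot>\<^bsub>M\<^esub> m" n] gen x by simp
  next
    case (add \<phi> \<psi>)
    then show ?case
      by (subst tensor_class_add[OF M N]) (auto intro!: assms(6) simp: tensor_space_carrier)
  qed
  then show ?thesis using \<phi> by simp
qed

lemma tensor_linear_eqI:
  assumes f: "linear_map K (tensor_space K M N) P f" and g: "linear_map K (tensor_space K M N) P g"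
    and M: "vectorspace K M" and N: "vectorspace K N"
    and eq: "\<And>m n. m \<in> carrier M \<Longrightarrow> n \<in> carrier N \<Longrightarrow> f (pure_tensor K M N m n) = g (pure_tensor K M N m n)"
    and t: "t \<in> carrier (tensor_space K M N)"
  shows "f t = g t"
  using M N t
  by (induct rule: tensor_induct)
    (simp_all add: linear_map_zero[OF f] linear_map_zero[OF g] linear_map_add[OF f] linear_map_add[OF g] eq)

text \<open>Bilinearity of \<open>b\<close> puts the relations into the kernel of the linear
  extension to the free space; the kernel is a submodule and hence contains their span. The
  representative picked by \<open>tensor_lift\<close> differs from \<phi> by an element of that
  span, so the choice does not affect the value.\<close>

lemma tensor_lift_class:
  assumes b: "bilinear_map K M N P b" and \<phi>: "\<phi> \<in> carrier (pair_space K M N)"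
  shows "tensor_lift K P b (tensor_class K M N \<phi>) = free_lift K P (\<lambda>x. b (fst x) (snd x)) \<phi>"
proof -
  have M: "vectorspace K M" and N: "vectorspace K N" and P: "vectorspace K P"
    using b by (auto simp: bilinear_map_def)
  interpret M: vectorspace K M by fact
  interpret N: vectorspace K N by fact
  interpret P: vectorspace K P by fact
  have K: "field K" by unfold_locales
  let ?h = "\<lambda>x. b (fst x) (snd x)"
  have h: "?h \<in> carrier M \<times> carrier N \<rightarrow> carrier P"
    using bilinear_map_closed[OF b] by auto
  interpret F: vectorspace K "pair_space K M N" by (rule free_space_vectorspace[OF K])
  interpret L: linear_map K "pair_space K M N" P "free_lift K P ?h"
    by (rule free_lift_linear[OF P h])
  note gen = free_gen_closed[OF K, of _ "carrier M \<times> carrier N"]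
  note lift_gen = free_lift_gen[OF P h]
  have "tensor_rels K M N \<subseteq> L.ker"
    using gen bilinear_map_closed[OF b]
    unfolding tensor_rels_def Let_def L.ker_def
    by (auto simp: lift_gen P.r_neg P.minus_eq
      linear_map_add[OF bilinear_map_left_linear[OF b]] linear_map_add[OF bilinear_map_right_linear[OF b]]
      linear_map_smult[OF bilinear_map_left_linear[OF b]]
      linear_map_smult[OF bilinear_map_right_linear[OF b]])
  then have ker: "tensor_null K M N \<subseteq> L.ker"
    unfolding tensor_null_def
    by (intro F.span_is_subset L.ker_is_submodule)
  let ?\<psi> = "SOME \<psi>. \<psi> \<in> tensor_class K M N \<phi>"
  have "?\<psi> \<in> tensor_class K M N \<phi>"
    by (rule someI[of "\<lambda>\<psi>. \<psi> \<in> tensor_class K M N \<phi>"]) (rule tensor_class_rep[OF M N \<phi>])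
  then obtain r where r: "r \<in> tensor_null K M N" "?\<psi> = r \<oplus>\<^bsub>pair_space K M N\<^esub> \<phi>"
    using tensor_class_repD[OF M N \<phi>] by blast
  have "r \<in> L.ker" using r ker by blast
  then have "free_lift K P ?h ?\<psi> = free_lift K P ?h \<phi>"
    using \<phi> by (simp add: r L.ker_def)
  then show ?thesis by (simp add: tensor_lift_def free_lift_def Let_def)
qed

lemma
  assumes b: "bilinear_map K M N P b"
  shows tensor_lift_linear: "linear_map K (tensor_space K M N) P (tensor_lift K P b)"
    and tensor_lift_pure: "m \<in> carrier M \<Longrightarrow> n \<in> carrier N \<Longrightarrow>
      tensor_lift K P b (pure_tensor K M N m n) = b m n"
proof -
  have M: "vectorspace K M" and N: "vectorspace K N" and P: "vectorspace K P"
    using b by (auto simp: bilinear_map_def)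
  interpret P: vectorspace K P by fact
  have K: "field K" by unfold_locales
  let ?h = "\<lambda>x. b (fst x) (snd x)"
  have h: "?h \<in> carrier M \<times> carrier N \<rightarrow> carrier P"
    using bilinear_map_closed[OF b] by auto
  interpret F: vectorspace K "pair_space K M N" by (rule free_space_vectorspace[OF K])
  note L = free_lift_linear[OF P h]
  show "linear_map K (tensor_space K M N) P (tensor_lift K P b)"
    using linear_map_closed[OF L] linear_map_add[OF L] linear_map_smult[OF L]
    by (intro linear_mapI tensor_space_vectorspace M N P)
      (auto simp: tensor_space_carrier tensor_lift_class[OF b]
        tensor_class_add[OF M N, symmetric] tensor_class_smult[OF M N, symmetric])
  show "tensor_lift K P b (pure_tensor K M N m n) = b m n" if "m \<in> carrier M" "n \<in> carrier N"
    using that free_gen_closed[OF K, of "(m, n)" "carrier M \<times> carrier N"]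
      free_lift_gen[OF P h, of "(m, n)"]
    by (simp add: pure_tensor_class tensor_lift_class[OF b])
qed

section \<open>Maps on tensor products\<close>

lemma
  assumes M: "vectorspace K M" and N: "vectorspace K N"
  shows pure_tensor_linear_left: "n \<in> carrier N \<Longrightarrow>
      linear_map K M (tensor_space K M N) (\<lambda>m. pure_tensor K M N m n)"
    and pure_tensor_linear_right: "m \<in> carrier M \<Longrightarrow>
      linear_map K N (tensor_space K M N) (pure_tensor K M N m)"
  by - (erule bilinear_map_left_linear[OF pure_tensor_bilinear[OF M N]],
    erule bilinear_map_right_linear[OF pure_tensor_bilinear[OF M N]])

lemma pure_tensor_smult_shift:
  assumes "vectorspace K M" "vectorspace K N" "a \<in> carrier K" "m \<in> carrier M" "n \<in> carrier N"
  shows "pure_tensor K M N (a \<odot>\<^bsub>M\<^esub> m) n = pure_tensor K M N m (a \<odot>\<^bsub>N\<^esub> n)"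
  using assms by (simp add: linear_map_smult[OF pure_tensor_linear_left]
      linear_map_smult[OF pure_tensor_linear_right])

lemma
  assumes f: "linear_map K M P f" and g: "linear_map K N Q g"
  shows tensor_map_linear:
      "linear_map K (tensor_space K M N) (tensor_space K P Q) (tensor_map K P Q f g)"
    and tensor_map_pure: "m \<in> carrier M \<Longrightarrow> n \<in> carrier N \<Longrightarrow>
      tensor_map K P Q f g (pure_tensor K M N m n) = pure_tensor K P Q (f m) (g n)"
proof -
  note vs = linear_map_dom[OF f] linear_map_cod[OF f] linear_map_dom[OF g] linear_map_cod[OF g]
  have b: "bilinear_map K M N (tensor_space K P Q) (\<lambda>m n. pure_tensor K P Q (f m) (g n))"
    using vs linear_map_closed[OF f] linear_map_closed[OF g]
    by (intro bilinear_mapI tensor_space_vectorspace linear_map_comp[OF f pure_tensor_linear_left]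
        linear_map_comp[OF g pure_tensor_linear_right]) auto
  show "linear_map K (tensor_space K M N) (tensor_space K P Q) (tensor_map K P Q f g)"
    unfolding tensor_map_def by (rule tensor_lift_linear[OF b])
  show "tensor_map K P Q f g (pure_tensor K M N m n) = pure_tensor K P Q (f m) (g n)"
    if "m \<in> carrier M" "n \<in> carrier N"
    unfolding tensor_map_def using that by (rule tensor_lift_pure[OF b])
qed

lemma tensor_map_comp:
  assumes f: "linear_map K M P f" and g: "linear_map K N Q g"
    and f': "linear_map K P P' f'" and g': "linear_map K Q Q' g'"
    and t: "t \<in> carrier (tensor_space K M N)"
  shows "tensor_map K P' Q' f' g' (tensor_map K P Q f g t) =
    tensor_map K P' Q' (\<lambda>m. f' (f m)) (\<lambda>n. g' (g n)) t"
  using linear_map_comp[OF tensor_map_linear[OF f g] tensor_map_linear[OF f' g']]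
    tensor_map_linear[OF linear_map_comp[OF f f'] linear_map_comp[OF g g']]
    linear_map_dom[OF f] linear_map_dom[OF g]
  by (rule tensor_linear_eqI)
    (simp_all add: t tensor_map_pure[OF f g] tensor_map_pure[OF f' g']
      tensor_map_pure[OF linear_map_comp[OF f f'] linear_map_comp[OF g g']]
      linear_map_closed[OF f] linear_map_closed[OF g])

lemma tensor_map_cong:
  assumes f: "linear_map K M P f" and g: "linear_map K N Q g"
    and f': "\<And>m. m \<in> carrier M \<Longrightarrow> f' m = f m" and g': "\<And>n. n \<in> carrier N \<Longrightarrow> g' n = g n"
    and t: "t \<in> carrier (tensor_space K M N)"
  shows "tensor_map K P Q f' g' t = tensor_map K P Q f g t"
  using tensor_map_linear[OF linear_map_cong[OF f f'] linear_map_cong[OF g g']]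
    tensor_map_linear[OF f g] linear_map_dom[OF f] linear_map_dom[OF g]
  by (rule tensor_linear_eqI)
    (simp_all add: t f' g' tensor_map_pure[OF f g]
      tensor_map_pure[OF linear_map_cong[OF f f'] linear_map_cong[OF g g']])

text \<open>For a fixed last factor, the inner lift in \<open>tensor_assoc\<close> is a
  \<open>tensor_map\<close>. The value is given for an arbitrary tensor t in the left factor, since
  in the coassociativity proof that factor is a whole coaction and not a pure tensor.\<close>

lemma
  assumes M: "vectorspace K M" and N: "vectorspace K N" and P: "vectorspace K P"
  shows tensor_assoc_linear:
      "linear_map K (tensor_space K (tensor_space K M N) P) (tensor_space K M (tensor_space K N P))
        (tensor_assoc K M N P)"
    and tensor_assoc_pure: "t \<in> carrier (tensor_space K M N) \<Longrightarrow> p \<in> carrier P \<Longrightarrow>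
      tensor_assoc K M N P (pure_tensor K (tensor_space K M N) P t p) =
      tensor_map K M (tensor_space K N P) id (\<lambda>n. pure_tensor K N P n p) t"
proof -
  let ?NP = "tensor_space K N P"
  let ?T = "tensor_space K M ?NP"
  let ?b = "\<lambda>t p. tensor_map K M ?NP id (\<lambda>n. pure_tensor K N P n p) t"
  note MN = tensor_space_vectorspace[OF M N] and NP = tensor_space_vectorspace[OF N P]
  note T = tensor_space_vectorspace[OF M NP]
  have assoc: "tensor_assoc K M N P = tensor_lift K ?T ?b"
    by (simp add: tensor_assoc_def tensor_map_def Let_def)
  note lin = tensor_map_linear[OF linear_map_id[OF M] pure_tensor_linear_left[OF N P]]
  note pure_id = tensor_map_pure[OF linear_map_id[OF M] pure_tensor_linear_left[OF N P]]
  have b: "bilinear_map K (tensor_space K M N) P ?T ?b"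
  proof (rule bilinear_mapI[OF MN P T])
    \<comment> \<open>Linearity in t is that of \<open>tensor_map\<close>. Linearity in p, which is
      hidden inside one of the mapped functions, is proved by induction on t.\<close>
    fix t assume "t \<in> carrier (tensor_space K M N)"
    with M N show "linear_map K P ?T (?b t)"
    proof (induct rule: tensor_induct)
      case zero
      show ?case
        by (rule linear_map_cong[OF linear_map_const_zero[OF P T]]) (rule linear_map_zero[OF lin])
    next
      case (pure m n)
      have "linear_map K P ?T (\<lambda>p. pure_tensor K M ?NP m (pure_tensor K N P n p))"
        using pure
        by (intro linear_map_comp[OF pure_tensor_linear_right[OF N P]
              pure_tensor_linear_right[OF M NP]])
      then show ?case
        by (rule linear_map_cong) (subst pure_id; simp add: pure)
    next
      case (add t u)
      show ?case
        by (rule linear_map_cong[OF linear_map_plus[OF add(3,4)]])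
          (subst linear_map_add[OF lin]; simp add: add(1,2))
    qed
  qed (rule lin)
  show "linear_map K (tensor_space K (tensor_space K M N) P) ?T (tensor_assoc K M N P)"
    unfolding assoc by (rule tensor_lift_linear[OF b])
  show "tensor_assoc K M N P (pure_tensor K (tensor_space K M N) P t p) = ?b t p"
    if "t \<in> carrier (tensor_space K M N)" "p \<in> carrier P" for t
    unfolding assoc using that by (rule tensor_lift_pure[OF b])
qed

section \<open>Slicing a tensor by a functional\<close>

lemma self_space_vectorspace:
  assumes "field K"
  shows "vectorspace K (self_space K)"
proof -
  interpret K: field K by fact
  have "module K (self_space K)"
  proof (rule module_criteria, goal_cases)
    case 1 show ?case by unfold_locales
  next
    case 4
    show ?case using K.r_neg by (auto simp: self_space_def intro!: bexI[of _ "\<ominus>\<^bsub>K\<^esub> _"])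
  qed (auto simp: self_space_def K.a_ac K.m_assoc K.l_distr K.r_distr)
  then show ?thesis by (simp add: vectorspace_def assms)
qed

lemma
  assumes M: "vectorspace K M"
  shows tensor_runit_linear: "linear_map K (tensor_space K M (self_space K)) M (tensor_runit K M)"
    and tensor_runit_pure: "m \<in> carrier M \<Longrightarrow> k \<in> carrier K \<Longrightarrow>
      tensor_runit K M (pure_tensor K M (self_space K) m k) = k \<odot>\<^bsub>M\<^esub> m"
proof -
  interpret M: vectorspace K M by fact
  have K: "field K" by unfold_locales
  have b: "bilinear_map K M (self_space K) M (\<lambda>m k. k \<odot>\<^bsub>M\<^esub> m)"
    by (intro bilinear_mapI linear_mapI M self_space_vectorspace[OF K])
      (auto simp: self_space_def M.smult_l_distr M.smult_r_distr M.smult_assoc1[symmetric] M.R.m_comm)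
  show "linear_map K (tensor_space K M (self_space K)) M (tensor_runit K M)"
    unfolding tensor_runit_def by (rule tensor_lift_linear[OF b])
  show "tensor_runit K M (pure_tensor K M (self_space K) m k) = k \<odot>\<^bsub>M\<^esub> m"
    if "m \<in> carrier M" "k \<in> carrier K"
    unfolding tensor_runit_def using that by (intro tensor_lift_pure[OF b]) (auto simp: self_space_def)
qed

text \<open>The scalar produced by the functional is absorbed into the left factor. The components
  of \<open>coind_coaction\<close> are values of this map.\<close>

definition tensor_slice :: "('k, 'm) ring_scheme \<Rightarrow> ('k, 'a) module \<Rightarrow> ('b \<Rightarrow> 'k) \<Rightarrow>
    ('k, 'a, 'b) tensor \<Rightarrow> 'a" where
  "tensor_slice K M g t = tensor_runit K M (tensor_map K M (self_space K) id g t)"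

lemma linear_functional_closed:
  "linear_map K N (self_space K) g \<Longrightarrow> n \<in> carrier N \<Longrightarrow> g n \<in> carrier K"
  by (drule (1) linear_map_closed) (simp add: self_space_def)

lemma
  assumes M: "vectorspace K M" and g: "linear_map K N (self_space K) g"
  shows tensor_slice_linear: "linear_map K (tensor_space K M N) M (tensor_slice K M g)"
    and tensor_slice_pure: "m \<in> carrier M \<Longrightarrow> n \<in> carrier N \<Longrightarrow>
      tensor_slice K M g (pure_tensor K M N m n) = g n \<odot>\<^bsub>M\<^esub> m"
proof -
  show "linear_map K (tensor_space K M N) M (tensor_slice K M g)"
    unfolding tensor_slice_def
    by (intro linear_map_comp[OF tensor_map_linear tensor_runit_linear] linear_map_id M g)
  show "tensor_slice K M g (pure_tensor K M N m n) = g n \<odot>\<^bsub>M\<^esub> m" if "m \<in> carrier M" "n \<in> carrier N"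
    unfolding tensor_slice_def using that
    by (simp add: tensor_map_pure[OF linear_map_id[OF M] g] tensor_runit_pure[OF M]
        linear_functional_closed[OF g])
qed

text \<open>Naturality of slicing: a map on the sliced leg is absorbed into the functional, and a
  map on the other leg comes out in front. With \<Delta> in the role of \<open>f\<close> it turns
  \<Delta> of a slice into a slice of (\<Delta> \<otimes> I).\<close>

lemma tensor_slice_map:
  assumes f: "linear_map K M P f" and h: "linear_map K N Q h"
    and g: "linear_map K Q (self_space K) g" and t: "t \<in> carrier (tensor_space K M N)"
  shows "tensor_slice K P g (tensor_map K P Q f h t) = f (tensor_slice K M (\<lambda>n. g (h n)) t)"
proof -
  note gh = linear_map_comp[OF h g]
  note M = linear_map_dom[OF f] and P = linear_map_cod[OF f]
  note N = linear_map_dom[OF h] and Q = linear_map_cod[OF h]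
  from linear_map_comp[OF tensor_map_linear[OF f h] tensor_slice_linear[OF P g]]
    linear_map_comp[OF tensor_slice_linear[OF M gh] f] M N
  show ?thesis
    by (rule tensor_linear_eqI)
      (simp_all add: t tensor_map_pure[OF f h] tensor_slice_pure[OF P g] tensor_slice_pure[OF M gh]
        linear_map_closed[OF f] linear_map_closed[OF h] linear_map_smult[OF f] linear_functional_closed[OF gh])
qed

text \<open>On t \<otimes> p both sides multiply t by the scalar g p, once from outside and once
  inside its second factor. It moves a slice of the last leg through the associator, where
  coassociativity can be applied.\<close>

lemma tensor_slice_assoc:
  assumes M: "vectorspace K M" and N: "vectorspace K N"
    and g: "linear_map K P (self_space K) g"
    and u: "u \<in> carrier (tensor_space K (tensor_space K M N) P)"
  shows "tensor_slice K (tensor_space K M N) g u =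
    tensor_map K M N id (tensor_slice K N g) (tensor_assoc K M N P u)"
proof -
  note P = linear_map_dom[OF g] and MN = tensor_space_vectorspace[OF M N]
  note NP = tensor_space_vectorspace[OF N P]
  note id = linear_map_id[OF M] and sl = tensor_slice_linear[OF N g]
  have "tensor_slice K (tensor_space K M N) g (pure_tensor K (tensor_space K M N) P t p) =
      tensor_map K M N id (tensor_slice K N g)
        (tensor_assoc K M N P (pure_tensor K (tensor_space K M N) P t p))"
    if t: "t \<in> carrier (tensor_space K M N)" and p: "p \<in> carrier P" for t p
  proof -
    have gp: "g p \<in> carrier K" using linear_functional_closed[OF g p] .
    note pl = pure_tensor_linear_left[OF N P p]
    note L = linear_map_comp[OF tensor_map_linear[OF id pl] tensor_map_linear[OF id sl]]
    \<comment> \<open>Here t is itself an arbitrary tensor, so a second reduction to pure tensors is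
      nested in the first. The \<open>id\<close> presents the left side as a linear map of
      t.\<close>
    have "g p \<odot>\<^bsub>tensor_space K M N\<^esub> id t = tensor_map K M N id (tensor_slice K N g)
        (tensor_map K M (tensor_space K N P) id (\<lambda>n. pure_tensor K N P n p) t)"
      using linear_map_scale[OF linear_map_id[OF MN] gp] L M N
    proof (rule tensor_linear_eqI)
      fix m n assume mn: "m \<in> carrier M" "n \<in> carrier N"
      then show "g p \<odot>\<^bsub>tensor_space K M N\<^esub> id (pure_tensor K M N m n) =
          tensor_map K M N id (tensor_slice K N g) (tensor_map K M (tensor_space K N P) id
            (\<lambda>n. pure_tensor K N P n p) (pure_tensor K M N m n))"
        using p gp by (simp add: tensor_map_pure[OF id pl] tensor_map_pure[OF id sl]
            pure_tensor_closed[OF N P] tensor_slice_pure[OF N g]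
            linear_map_smult[OF pure_tensor_linear_right[OF M N]])
    qed (rule t)
    then show ?thesis
      using t p by (simp add: tensor_slice_pure[OF MN g] tensor_assoc_pure[OF M N P])
  qed
  with tensor_slice_linear[OF MN g]
    linear_map_comp[OF tensor_assoc_linear[OF M N P] tensor_map_linear[OF id sl]] MN P
  show ?thesis by (rule tensor_linear_eqI[OF _ _ _ _ _ u])
qed

text \<open>The functional on the right is h \<otimes> g on N \<otimes> P. Writing it as h after a
  slice avoids an identification of K \<otimes> K with K.\<close>

lemma tensor_slice_slice:
  assumes M: "vectorspace K M" and h: "linear_map K N (self_space K) h"
    and g: "linear_map K P (self_space K) g"
    and u: "u \<in> carrier (tensor_space K (tensor_space K M N) P)"
  shows "tensor_slice K M h (tensor_slice K (tensor_space K M N) g u) =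
    tensor_slice K M (\<lambda>x. h (tensor_slice K N g x)) (tensor_assoc K M N P u)"
proof -
  note N = linear_map_dom[OF h] and P = linear_map_dom[OF g]
  show ?thesis
    unfolding tensor_slice_assoc[OF M N g u]
    using tensor_slice_map[OF linear_map_id[OF M] tensor_slice_linear[OF N g] h
        linear_map_closed[OF tensor_assoc_linear[OF M N P] u]]
    by simp
qed

section \<open>Expansion in dual bases\<close>

text \<open>Applying \<open>g e\<close> to any expression of n as a combination of the basis picks
  out the coefficient at e.\<close>

lemma dual_bases_expansion:
  assumes N: "vectorspace K N" and B: "dual_bases K N B g" and n: "n \<in> carrier N"
  shows "n = (\<Oplus>\<^bsub>N\<^esub> e\<in>B. g e n \<odot>\<^bsub>N\<^esub> e)"
proof -
  interpret N: vectorspace K N by fact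
  have fin: "finite B" and BN: "B \<subseteq> carrier N" and gen: "N.span B = carrier N"
    and g: "\<And>e. e \<in> B \<Longrightarrow> linear_map K N (self_space K) (g e)"
    and dual: "\<And>e e'. e \<in> B \<Longrightarrow> e' \<in> B \<Longrightarrow> g e e' = (if e' = e then \<one>\<^bsub>K\<^esub> else \<zero>\<^bsub>K\<^esub>)"
    using B by (auto simp: dual_bases_def N.basis_def)
  obtain a where a: "a \<in> B \<rightarrow> carrier K" "n = (\<Oplus>\<^bsub>N\<^esub> e\<in>B. a e \<odot>\<^bsub>N\<^esub> e)"
    using N.finite_in_span[OF fin BN] n gen by (auto simp: N.lincomb_def)
  have "g e n = a e" if e: "e \<in> B" for e
  proof -
    have self: "vectorspace K (self_space K)" using g[OF e] by (rule linear_map_cod)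
    interpret S: vectorspace K "self_space K" by fact
    have "g e n = (\<Oplus>\<^bsub>self_space K\<^esub> e'\<in>B. g e (a e' \<odot>\<^bsub>N\<^esub> e'))"
      unfolding a(2) using a(1) BN by (intro linear_map_finsum[OF g[OF e]]) (auto simp: Pi_iff)
    also have "\<dots> = (\<Oplus>\<^bsub>self_space K\<^esub> e'\<in>B. if e = e' then a e' else \<zero>\<^bsub>self_space K\<^esub>)"
      using a(1) BN e linear_map_smult[OF g[OF e]]
      by (intro S.finsum_cong') (auto simp: Pi_iff dual self_space_def subset_iff)
    also have "\<dots> = a e"
      using a(1) e fin by (intro S.finsum_singleton) (auto simp: self_space_def)
    finally show ?thesis .
  qed
  then show ?thesis
    using a BN by (subst a(2), intro N.finsum_cong') (auto simp: Pi_iff)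
qed

text \<open>On m \<otimes> n the slice along \<open>g e\<close> is a multiple of m; its scalar moves
  across the tensor sign and the right factors add up to n.\<close>

lemma tensor_expansion:
  assumes M: "vectorspace K M" and N: "vectorspace K N" and B: "dual_bases K N B g"
    and t: "t \<in> carrier (tensor_space K M N)"
  shows "t = (\<Oplus>\<^bsub>tensor_space K M N\<^esub> e\<in>B. pure_tensor K M N (tensor_slice K M (g e) t) e)"
proof -
  interpret N: vectorspace K N by fact
  have BN: "e \<in> carrier N" and g: "linear_map K N (self_space K) (g e)" if "e \<in> B" for e
    using B that by (auto simp: dual_bases_def N.basis_def)
  note MN = tensor_space_vectorspace[OF M N]
  interpret MN: vectorspace K "tensor_space K M N" by fact
  have "id t = (\<Oplus>\<^bsub>tensor_space K M N\<^esub> e\<in>B. pure_tensor K M N (tensor_slice K M (g e) t) e)"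
  proof (rule tensor_linear_eqI[OF linear_map_id[OF MN] _ M N _ t])
    show "linear_map K (tensor_space K M N) (tensor_space K M N)
        (\<lambda>t. \<Oplus>\<^bsub>tensor_space K M N\<^esub> e\<in>B. pure_tensor K M N (tensor_slice K M (g e) t) e)"
      using BN g by (intro linear_map_sum MN
          linear_map_comp[OF tensor_slice_linear[OF M] pure_tensor_linear_left[OF M N]])
  next
    fix m n assume m: "m \<in> carrier M" and n: "n \<in> carrier N"
    have cl: "g e n \<in> carrier K" if "e \<in> B" for e
      using linear_functional_closed[OF g[OF that] n] .
    have "pure_tensor K M N m n = pure_tensor K M N m (\<Oplus>\<^bsub>N\<^esub> e\<in>B. g e n \<odot>\<^bsub>N\<^esub> e)"
      using dual_bases_expansion[OF N B n] by simp
    also have "\<dots> = (\<Oplus>\<^bsub>tensor_space K M N\<^esub> e\<in>B. pure_tensor K M N m (g e n \<odot>\<^bsub>N\<^esub> e))"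
      using BN cl by (intro linear_map_finsum[OF pure_tensor_linear_right[OF M N m]]) auto
    also have "\<dots> = (\<Oplus>\<^bsub>tensor_space K M N\<^esub> e\<in>B.
        pure_tensor K M N (tensor_slice K M (g e) (pure_tensor K M N m n)) e)"
      using m n BN cl g
      by (intro MN.finsum_cong')
        (auto simp: tensor_slice_pure[OF M] pure_tensor_smult_shift[OF M N]
          intro!: pure_tensor_closed[OF M N] linear_map_closed[OF tensor_slice_linear[OF M]])
    finally show "id (pure_tensor K M N m n) = \<dots>" by simp
  qed
  then show ?thesis by simp
qed

text \<open>Slices depend linearly on the functional, and f is the combination of the dual basis
  with coefficients f e. The proof obtains this by slicing the basis expansion of t.\<close>

lemma tensor_slice_expansion:
  assumes M: "vectorspace K M" and B: "dual_bases K N B g"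
    and f: "linear_map K N (self_space K) f" and t: "t \<in> carrier (tensor_space K M N)"
  shows "tensor_slice K M f t = (\<Oplus>\<^bsub>M\<^esub> e\<in>B. f e \<odot>\<^bsub>M\<^esub> tensor_slice K M (g e) t)"
proof -
  note N = linear_map_dom[OF f]
  interpret N: vectorspace K N by (rule N)
  interpret M: vectorspace K M by fact
  have BN: "e \<in> carrier N" and g: "linear_map K N (self_space K) (g e)" if "e \<in> B" for e
    using B that by (auto simp: dual_bases_def N.basis_def)
  have cl: "tensor_slice K M (g e) t \<in> carrier M" if "e \<in> B" for e
    using linear_map_closed[OF tensor_slice_linear[OF M g[OF that]] t] .
  have "tensor_slice K M f t = tensor_slice K M f
      (\<Oplus>\<^bsub>tensor_space K M N\<^esub> e\<in>B. pure_tensor K M N (tensor_slice K M (g e) t) e)"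
    using tensor_expansion[OF M N B t] by simp
  also have "\<dots> = (\<Oplus>\<^bsub>M\<^esub> e\<in>B. tensor_slice K M f (pure_tensor K M N (tensor_slice K M (g e) t) e))"
    using cl BN
    by (intro linear_map_finsum[OF tensor_slice_linear[OF M f]]) (auto intro!: pure_tensor_closed[OF M N])
  also have "\<dots> = (\<Oplus>\<^bsub>M\<^esub> e\<in>B. f e \<odot>\<^bsub>M\<^esub> tensor_slice K M (g e) t)"
    using cl BN linear_functional_closed[OF f]
    by (intro M.finsum_cong') (auto simp: tensor_slice_pure[OF M f])
  finally show ?thesis .
qed

section \<open>Spaces of linear maps\<close>

lemma hom_space_carrier_iff:
  assumes "vectorspace K V" "vectorspace K W"
  shows "F \<in> carrier (hom_space K V W) \<longleftrightarrow> linear_map K V W F \<and> F \<in> extensional (carrier V)"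
proof -
  have "linear_map K V W F \<longleftrightarrow> F \<in> module_hom K V W"
  proof
    assume "linear_map K V W F"
    then interpret linear_map K V W F .
    show "F \<in> module_hom K V W" by (rule f_hom)
  next
    assume "F \<in> module_hom K V W"
    then show "linear_map K V W F"
      using module_hom_closed[of F K V W]
      by (intro linear_mapI[OF assms]) (auto simp: module_hom_add module_hom_smult)
  qed
  then show ?thesis by (simp add: hom_space_def)
qed

lemma
  shows hom_space_add: "v \<in> carrier V \<Longrightarrow> (F \<oplus>\<^bsub>hom_space K V W\<^esub> G) v = F v \<oplus>\<^bsub>W\<^esub> G v"
    and hom_space_smult: "v \<in> carrier V \<Longrightarrow> (a \<odot>\<^bsub>hom_space K V W\<^esub> F) v = a \<odot>\<^bsub>W\<^esub> F v"
    and hom_space_zero: "v \<in> carrier V \<Longrightarrow> \<zero>\<^bsub>hom_space K V W\<^esub> v = \<zero>\<^bsub>W\<^esub>"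
    and hom_space_extensional:
      "F \<oplus>\<^bsub>hom_space K V W\<^esub> G \<in> extensional (carrier V)"
      "a \<odot>\<^bsub>hom_space K V W\<^esub> F \<in> extensional (carrier V)"
      "\<zero>\<^bsub>hom_space K V W\<^esub> \<in> extensional (carrier V)"
  by (simp_all add: hom_space_def)

lemma hom_space_vectorspace:
  assumes V: "vectorspace K V" and W: "vectorspace K W"
  shows "vectorspace K (hom_space K V W)"
proof -
  interpret V: vectorspace K V by fact
  interpret W: vectorspace K W by fact
  note iff = hom_space_carrier_iff[OF V W]
  note simps = hom_space_add hom_space_smult hom_space_zero
  have ext: "F = G" if "F \<in> extensional (carrier V)" "G \<in> extensional (carrier V)"
    "\<And>v. v \<in> carrier V \<Longrightarrow> F v = G v" for F G
    using that by (rule extensionalityI)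
  have "module K (hom_space K V W)"
  proof (rule module_criteria, goal_cases)
    case 1 show ?case by unfold_locales
  next
    case 2
    show ?case unfolding iff
      by (intro conjI linear_map_cong[OF linear_map_const_zero[OF V W]])
        (auto simp: simps hom_space_extensional)
  next
    case 3
    show ?case unfolding iff
      by (auto intro: linear_map_cong[OF linear_map_plus] simp: simps hom_space_extensional)
  next
    case 4
    show ?case
    proof
      fix F assume F: "F \<in> carrier (hom_space K V W)"
      have m: "\<ominus>\<^bsub>K\<^esub> \<one>\<^bsub>K\<^esub> \<in> carrier K" by simp
      \<comment> \<open>The negative is formed as a scalar multiple, so that its linearity and
        extensionality are those of scalar multiples.\<close>
      let ?G = "(\<ominus>\<^bsub>K\<^esub> \<one>\<^bsub>K\<^esub>) \<odot>\<^bsub>hom_space K V W\<^esub> F"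
      have "linear_map K V W ?G"
        by (rule linear_map_cong[OF linear_map_scale[of K V W F]]) (use F m in \<open>auto simp: iff simps\<close>)
      then have "?G \<in> carrier (hom_space K V W)"
        by (simp add: iff hom_space_extensional)
      moreover have "F \<oplus>\<^bsub>hom_space K V W\<^esub> ?G = \<zero>\<^bsub>hom_space K V W\<^esub>"
        using F by (intro ext hom_space_extensional)
          (auto simp: iff simps W.smult_minus_1 linear_map_closed W.r_neg)
      ultimately show "\<exists>G\<in>carrier (hom_space K V W). F \<oplus>\<^bsub>hom_space K V W\<^esub> G = \<zero>\<^bsub>hom_space K V W\<^esub>"
        by blast
    qed
  next
    case 5
    show ?case unfolding iff
      by (auto intro: linear_map_cong[OF linear_map_scale] simp: simps hom_space_extensional)
  qed (auto intro!: ext hom_space_extensional simp: iff simps linear_map_closed W.a_ac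
      W.smult_assoc1 W.smult_l_distr W.smult_r_distr)
  then show ?thesis using V by (simp add: vectorspace_def)
qed

lemma hom_space_eval_linear:
  assumes "vectorspace K V" "vectorspace K W" "v \<in> carrier V"
  shows "linear_map K (hom_space K V W) W (\<lambda>F. F v)"
proof (rule linear_mapI[OF hom_space_vectorspace[OF assms(1,2)] assms(2)])
  fix F assume "F \<in> carrier (hom_space K V W)"
  then have "linear_map K V W F" by (simp add: hom_space_carrier_iff[OF assms(1,2)])
  then show "F v \<in> carrier W" by (rule linear_map_closed[OF _ assms(3)])
qed (simp_all add: hom_space_add[OF assms(3)] hom_space_smult[OF assms(3)])

text \<open>In the defining condition of Coind the unknown F occurs on the right inside
  \<open>tensor_map\<close>. With t fixed this dependence is linear, by induction on t, so the
  condition cuts out a subspace.\<close>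

lemma tensor_map_hom_linear:
  assumes C: "vectorspace K C" and V: "vectorspace K V" and W: "vectorspace K W"
    and t: "t \<in> carrier (tensor_space K C V)"
  shows "linear_map K (hom_space K V W) (tensor_space K C W) (\<lambda>F. tensor_map K C W id F t)"
proof -
  note HV = hom_space_vectorspace[OF V W] and CW = tensor_space_vectorspace[OF C W]
  have F: "linear_map K V W F" if "F \<in> carrier (hom_space K V W)" for F
    using that by (simp add: hom_space_carrier_iff[OF V W])
  note tm = tensor_map_linear[OF linear_map_id[OF C] F]
  from C V t show ?thesis
  proof (induct rule: tensor_induct)
    case zero
    show ?case
      by (rule linear_map_cong[OF linear_map_const_zero[OF HV CW]]) (rule linear_map_zero[OF tm])
  next
    case (pure c v)
    show ?case
      by (rule linear_map_cong[OF linear_map_comp[OF hom_space_eval_linear[OF V W pure(2)]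
              pure_tensor_linear_right[OF C W pure(1)]]])
        (subst tensor_map_pure[OF linear_map_id[OF C] F]; simp add: pure)
  next
    case (add t u)
    show ?case
      by (rule linear_map_cong[OF linear_map_plus[OF add(3,4)]])
        (subst linear_map_add[OF tm]; simp add: add(1,2))
  qed
qed

lemma tensor_map_id:
  assumes M: "vectorspace K M" and N: "vectorspace K N" and t: "t \<in> carrier (tensor_space K M N)"
  shows "tensor_map K M N id id t = t"
proof -
  note id = linear_map_id[OF M] linear_map_id[OF N]
  have "tensor_map K M N id id t = id t"
    by (rule tensor_linear_eqI[OF tensor_map_linear[OF id] linear_map_id[OF tensor_space_vectorspace[OF M N]] M N _ t])
      (simp add: tensor_map_pure[OF id])
  then show ?thesis by simp
qed

lemma submodule_vectorspace:
  assumes "vectorspace K V" "LinearCombinations.submodule K U V"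
  shows "vectorspace K (V\<lparr>carrier := U\<rparr>)"
proof -
  interpret V: vectorspace K V by fact
  have "field K" by unfold_locales
  then show ?thesis
    using V.submodule_is_module[OF assms(2)] by (simp add: vectorspace_def)
qed

text \<open>Stated for a family of pairs because Coind imposes one linear equation for each v in
  V1.\<close>

lemma linear_equalizer_submodule:
  assumes f: "\<And>i. i \<in> I \<Longrightarrow> linear_map K V W (f i)" and h: "\<And>i. i \<in> I \<Longrightarrow> linear_map K V W (h i)"
    and V: "vectorspace K V"
  shows "LinearCombinations.submodule K {x \<in> carrier V. \<forall>i\<in>I. f i x = h i x} V"
proof -
  interpret V: vectorspace K V by fact
  show ?thesis
    by (rule LinearCombinations.submodule.intro)
      (auto simp: linear_map_add[OF f] linear_map_add[OF h] linear_map_smult[OF f] linear_map_smult[OF h]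
        linear_map_zero[OF f] linear_map_zero[OF h] V.module_axioms)
qed

section \<open>Coinduced comodules\<close>

text \<open>The locale is interpreted once with (V, \<rho>) and once with (W, \<psi>), over the same
  dual bases, so that the two coactions can be compared summand by summand.\<close>

locale coinduced_comodule = pi_coalgebra \<pi> K H \<Delta> \<epsilon>
  for \<pi> :: "('p, 'q) monoid_scheme" and K :: "('k, 'm) ring_scheme"
    and H :: "'p \<Rightarrow> ('k, 'h) module" and \<Delta> and \<epsilon> +
  fixes C :: "'p \<Rightarrow> ('k, 'c) module" and \<sigma> :: "'p \<Rightarrow> 'h \<Rightarrow> 'c"
    and V :: "'p \<Rightarrow> ('k, 'v) module" and \<rho> :: "'p \<Rightarrow> 'p \<Rightarrow> 'v \<Rightarrow> ('k, 'c, 'v) tensor"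
    and B :: "'p \<Rightarrow> 'h set" and g :: "'p \<Rightarrow> 'h \<Rightarrow> 'h \<Rightarrow> 'k"
  assumes sigma_linear: "linear_map K (H \<one>\<^bsub>\<pi>\<^esub>) (C \<one>\<^bsub>\<pi>\<^esub>) (\<sigma> \<one>\<^bsub>\<pi>\<^esub>)"
    and rho_linear: "linear_map K (V \<one>\<^bsub>\<pi>\<^esub>) (tensor_space K (C \<one>\<^bsub>\<pi>\<^esub>) (V \<one>\<^bsub>\<pi>\<^esub>)) (\<rho> \<one>\<^bsub>\<pi>\<^esub> \<one>\<^bsub>\<pi>\<^esub>)"
    and dual: "\<beta> \<in> carrier \<pi> \<Longrightarrow> dual_bases K (H \<beta>) (B \<beta>) (g \<beta>)"
begin

abbreviation "C1 \<equiv> C \<one>\<^bsub>\<pi>\<^esub>"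
abbreviation "V1 \<equiv> V \<one>\<^bsub>\<pi>\<^esub>"
abbreviation "L \<equiv> coind_L \<pi> K H \<Delta> C \<sigma>"
abbreviation "X \<equiv> coind \<pi> K H \<Delta> C \<sigma> V \<rho>"
abbreviation "\<theta> \<equiv> coind_coaction \<pi> K H \<Delta> C \<sigma> B g V \<rho>"

lemmas C1_space = linear_map_cod[OF sigma_linear]
lemmas V1_space = linear_map_dom[OF rho_linear]

lemma
  assumes "\<beta> \<in> carrier \<pi>"
  shows B_finite: "finite (B \<beta>)"
    and B_closed: "e \<in> B \<beta> \<Longrightarrow> e \<in> carrier (H \<beta>)"
    and g_linear: "e \<in> B \<beta> \<Longrightarrow> linear_map K (H \<beta>) (self_space K) (g \<beta> e)"
  using dual[OF assms] vectorspace.basis_def[OF space[OF assms]] by (auto simp: dual_bases_def)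

lemma L_linear:
  assumes "\<alpha> \<in> carrier \<pi>"
  shows "linear_map K (H \<alpha>) (tensor_space K C1 (H \<alpha>)) (L \<alpha>)"
proof -
  have "linear_map K (H \<alpha>) (tensor_space K (H \<one>\<^bsub>\<pi>\<^esub>) (H \<alpha>)) (\<Delta> \<one>\<^bsub>\<pi>\<^esub> \<alpha>)"
    using comult_linear[of "\<one>\<^bsub>\<pi>\<^esub>" \<alpha>] assms by simp
  from linear_map_comp[OF this tensor_map_linear[OF sigma_linear linear_map_id[OF space[OF assms]]]]
  show ?thesis by (rule linear_map_cong) (simp add: coind_L_def)
qed

lemma coind_carrier_iff:
  assumes "\<alpha> \<in> carrier \<pi>"
  shows "F \<in> carrier (X \<alpha>) \<longleftrightarrow> linear_map K V1 (H \<alpha>) F \<and> F \<in> extensional (carrier V1) \<and>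
    (\<forall>v\<in>carrier V1. L \<alpha> (F v) = tensor_map K C1 (H \<alpha>) id F (\<rho> \<one>\<^bsub>\<pi>\<^esub> \<one>\<^bsub>\<pi>\<^esub> v))"
  by (auto simp: coind_def hom_space_carrier_iff[OF V1_space space[OF assms]])

lemma coind_vectorspace:
  assumes "\<alpha> \<in> carrier \<pi>"
  shows "vectorspace K (X \<alpha>)"
proof -
  note H = space[OF assms]
  have "LinearCombinations.submodule K {F \<in> carrier (hom_space K V1 (H \<alpha>)). \<forall>v\<in>carrier V1.
      L \<alpha> (F v) = tensor_map K C1 (H \<alpha>) id F (\<rho> \<one>\<^bsub>\<pi>\<^esub> \<one>\<^bsub>\<pi>\<^esub> v)} (hom_space K V1 (H \<alpha>))"
    by (rule linear_equalizer_submodule[OF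
        linear_map_comp[OF hom_space_eval_linear[OF V1_space H] L_linear[OF assms]]
        tensor_map_hom_linear[OF C1_space V1_space H linear_map_closed[OF rho_linear]]
        hom_space_vectorspace[OF V1_space H]])
  then show ?thesis
    unfolding coind_def by (rule submodule_vectorspace[OF hom_space_vectorspace[OF V1_space H]])
qed

lemma coind_eval_linear:
  assumes "\<alpha> \<in> carrier \<pi>" "v \<in> carrier V1"
  shows "linear_map K (X \<alpha>) (H \<alpha>) (\<lambda>F. F v)"
proof (rule linear_mapI[OF coind_vectorspace[OF assms(1)] space[OF assms(1)]])
  fix F assume "F \<in> carrier (X \<alpha>)"
  then have "linear_map K V1 (H \<alpha>) F" by (simp add: coind_carrier_iff[OF assms(1)])
  then show "F v \<in> carrier (H \<alpha>)" by (rule linear_map_closed[OF _ assms(2)])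
qed (simp_all add: coind_def hom_space_add[OF assms(2)] hom_space_smult[OF assms(2)])

lemma coind_eqI:
  assumes "\<alpha> \<in> carrier \<pi>" "F \<in> carrier (X \<alpha>)" "G \<in> carrier (X \<alpha>)"
    and "\<And>v. v \<in> carrier V1 \<Longrightarrow> F v = G v"
  shows "F = G"
  using assms(2,3) unfolding coind_carrier_iff[OF assms(1)]
  by (intro extensionalityI[of _ "carrier V1"] assms(4)) auto

text \<open>Evaluations at points of V1 are linear on \<open>X \<alpha>\<close> and together
  separate its elements, so linearity of a map into \<open>X \<alpha>\<close> can be checked
  pointwise.\<close>

lemma coind_linear_mapI:
  assumes \<alpha>: "\<alpha> \<in> carrier \<pi>" and N: "vectorspace K N"
    and cl: "\<And>x. x \<in> carrier N \<Longrightarrow> f x \<in> carrier (X \<alpha>)"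
    and lin: "\<And>v. v \<in> carrier V1 \<Longrightarrow> linear_map K N (H \<alpha>) (\<lambda>x. f x v)"
  shows "linear_map K N (X \<alpha>) f"
proof -
  note ev = coind_eval_linear[OF \<alpha>] and X = coind_vectorspace[OF \<alpha>]
  interpret N: vectorspace K N by fact
  interpret X: vectorspace K "X \<alpha>" by fact
  show ?thesis
  proof (rule linear_mapI[OF N X cl])
    fix x y assume "x \<in> carrier N" "y \<in> carrier N"
    then show "f (x \<oplus>\<^bsub>N\<^esub> y) = f x \<oplus>\<^bsub>X \<alpha>\<^esub> f y"
      by (intro coind_eqI[OF \<alpha>]) (auto simp: cl linear_map_add[OF lin] linear_map_add[OF ev])
  next
    fix a x assume "a \<in> carrier K" "x \<in> carrier N"
    then show "f (a \<odot>\<^bsub>N\<^esub> x) = a \<odot>\<^bsub>X \<alpha>\<^esub> f x"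
      by (intro coind_eqI[OF \<alpha>]) (auto simp: cl linear_map_smult[OF lin] linear_map_smult[OF ev])
  qed
qed

section \<open>Slices of coinduced maps\<close>

text \<open>The functional is arbitrary rather than a member of the dual basis, because iterated
  slices and the counit lead to functionals outside that basis. The restriction makes the result
  extensional, as elements of \<open>hom_space\<close> must be.\<close>

definition coind_slice :: "'p \<Rightarrow> 'p \<Rightarrow> ('h \<Rightarrow> 'k) \<Rightarrow> ('v \<Rightarrow> 'h) \<Rightarrow> 'v \<Rightarrow> 'h" where
  "coind_slice \<alpha> \<beta> f F = (\<lambda>v\<in>carrier V1. tensor_slice K (H \<alpha>) f (\<Delta> \<alpha> \<beta> (F v)))"

lemma coaction_eq:
  "\<theta> \<alpha> \<beta> F = (\<Oplus>\<^bsub>tensor_space K (X \<alpha>) (H \<beta>)\<^esub> e\<in>B \<beta>.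
     pure_tensor K (X \<alpha>) (H \<beta>) (coind_slice \<alpha> \<beta> (g \<beta> e) F) e)"
  by (simp add: coind_coaction_def coind_slice_def tensor_slice_def)

text \<open>\<open>L\<close> works on the left leg of \<Delta> and the slice consumes the right one,
  so by coassociativity they commute. The condition on F at \<alpha>\<beta> therefore passes to its
  slices at \<alpha>, which makes the coaction land in \<open>X \<alpha>\<close> \<otimes>
  \<open>H \<beta>\<close>.\<close>

lemma coind_slice_closed:
  assumes \<alpha>: "\<alpha> \<in> carrier \<pi>" and \<beta>: "\<beta> \<in> carrier \<pi>"
    and f: "linear_map K (H \<beta>) (self_space K) f" and F: "F \<in> carrier (X (\<alpha> \<otimes>\<^bsub>\<pi>\<^esub> \<beta>))"
  shows "coind_slice \<alpha> \<beta> f F \<in> carrier (X \<alpha>)"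
proof -
  have \<alpha>\<beta>: "\<alpha> \<otimes>\<^bsub>\<pi>\<^esub> \<beta> \<in> carrier \<pi>" using \<alpha> \<beta> by simp
  have one: "\<one>\<^bsub>\<pi>\<^esub> \<in> carrier \<pi>" by simp
  note H\<alpha> = space[OF \<alpha>] and H\<beta> = space[OF \<beta>] and H1 = space[OF one] and H\<alpha>\<beta> = space[OF \<alpha>\<beta>]
  have F_lin: "linear_map K V1 (H (\<alpha> \<otimes>\<^bsub>\<pi>\<^esub> \<beta>)) F"
    and F_L: "\<And>v. v \<in> carrier V1 \<Longrightarrow>
      L (\<alpha> \<otimes>\<^bsub>\<pi>\<^esub> \<beta>) (F v) = tensor_map K C1 (H (\<alpha> \<otimes>\<^bsub>\<pi>\<^esub> \<beta>)) id F (\<rho> \<one>\<^bsub>\<pi>\<^esub> \<one>\<^bsub>\<pi>\<^esub> v)"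
    using F by (auto simp: coind_carrier_iff[OF \<alpha>\<beta>])
  note sl = tensor_slice_linear[OF H\<alpha> f] and D = comult_linear[OF \<alpha> \<beta>]
  note slD = linear_map_comp[OF D sl]
  have D1: "linear_map K (H \<alpha>) (tensor_space K (H \<one>\<^bsub>\<pi>\<^esub>) (H \<alpha>)) (\<Delta> \<one>\<^bsub>\<pi>\<^esub> \<alpha>)"
    using comult_linear[OF one \<alpha>] \<alpha> by simp
  have D1': "linear_map K (H (\<alpha> \<otimes>\<^bsub>\<pi>\<^esub> \<beta>)) (tensor_space K (H \<one>\<^bsub>\<pi>\<^esub>) (H (\<alpha> \<otimes>\<^bsub>\<pi>\<^esub> \<beta>)))
      (\<Delta> \<one>\<^bsub>\<pi>\<^esub> (\<alpha> \<otimes>\<^bsub>\<pi>\<^esub> \<beta>))"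
    using comult_linear[OF one \<alpha>\<beta>] \<alpha>\<beta> by simp
  note id\<beta> = linear_map_id[OF H\<beta>] and id1 = linear_map_id[OF H1] and idC = linear_map_id[OF C1_space]
  have lin: "linear_map K V1 (H \<alpha>) (coind_slice \<alpha> \<beta> f F)"
    by (rule linear_map_cong[OF linear_map_comp[OF F_lin slD]]) (simp add: coind_slice_def)
  have "L \<alpha> (coind_slice \<alpha> \<beta> f F v) =
      tensor_map K C1 (H \<alpha>) id (coind_slice \<alpha> \<beta> f F) (\<rho> \<one>\<^bsub>\<pi>\<^esub> \<one>\<^bsub>\<pi>\<^esub> v)"
    if v: "v \<in> carrier V1" for v
  proof -
    let ?x = "F v"
    have x: "?x \<in> carrier (H (\<alpha> \<otimes>\<^bsub>\<pi>\<^esub> \<beta>))" using linear_map_closed[OF F_lin v] .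
    note Dx = linear_map_closed[OF D x] and D1x = linear_map_closed[OF D1' x]
    have "\<Delta> \<one>\<^bsub>\<pi>\<^esub> \<alpha> (tensor_slice K (H \<alpha>) f (\<Delta> \<alpha> \<beta> ?x)) =
        tensor_slice K (tensor_space K (H \<one>\<^bsub>\<pi>\<^esub>) (H \<alpha>)) f
          (tensor_map K (tensor_space K (H \<one>\<^bsub>\<pi>\<^esub>) (H \<alpha>)) (H \<beta>) (\<Delta> \<one>\<^bsub>\<pi>\<^esub> \<alpha>) id (\<Delta> \<alpha> \<beta> ?x))"
      using tensor_slice_map[OF D1 id\<beta> f Dx] by simp
    also have "\<dots> = tensor_map K (H \<one>\<^bsub>\<pi>\<^esub>) (H \<alpha>) id (tensor_slice K (H \<alpha>) f)
        (tensor_assoc K (H \<one>\<^bsub>\<pi>\<^esub>) (H \<alpha>) (H \<beta>)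
          (tensor_map K (tensor_space K (H \<one>\<^bsub>\<pi>\<^esub>) (H \<alpha>)) (H \<beta>) (\<Delta> \<one>\<^bsub>\<pi>\<^esub> \<alpha>) id (\<Delta> \<alpha> \<beta> ?x)))"
      by (rule tensor_slice_assoc[OF H1 H\<alpha> f linear_map_closed[OF tensor_map_linear[OF D1 id\<beta>] Dx]])
    \<comment> \<open>Coassociativity for the indices 1, \<alpha>, \<beta>; the neutral element
      drops out of the products.\<close>
    also have "\<dots> = tensor_map K (H \<one>\<^bsub>\<pi>\<^esub>) (H \<alpha>) id (tensor_slice K (H \<alpha>) f)
        (tensor_map K (H \<one>\<^bsub>\<pi>\<^esub>) (tensor_space K (H \<alpha>) (H \<beta>)) id (\<Delta> \<alpha> \<beta>) (\<Delta> \<one>\<^bsub>\<pi>\<^esub> (\<alpha> \<otimes>\<^bsub>\<pi>\<^esub> \<beta>) ?x))"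
      using coassoc[OF one \<alpha> \<beta>, of ?x] x \<alpha> \<beta> by simp
    also have "\<dots> = tensor_map K (H \<one>\<^bsub>\<pi>\<^esub>) (H \<alpha>) (\<lambda>m. id (id m))
        (\<lambda>n. tensor_slice K (H \<alpha>) f (\<Delta> \<alpha> \<beta> n)) (\<Delta> \<one>\<^bsub>\<pi>\<^esub> (\<alpha> \<otimes>\<^bsub>\<pi>\<^esub> \<beta>) ?x)"
      by (rule tensor_map_comp[OF id1 D id1 sl D1x])
    finally have "L \<alpha> (tensor_slice K (H \<alpha>) f (\<Delta> \<alpha> \<beta> ?x)) = tensor_map K C1 (H \<alpha>) (\<sigma> \<one>\<^bsub>\<pi>\<^esub>) id
        (tensor_map K (H \<one>\<^bsub>\<pi>\<^esub>) (H \<alpha>) id (\<lambda>n. tensor_slice K (H \<alpha>) f (\<Delta> \<alpha> \<beta> n))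
          (\<Delta> \<one>\<^bsub>\<pi>\<^esub> (\<alpha> \<otimes>\<^bsub>\<pi>\<^esub> \<beta>) ?x))"
      by (simp add: coind_L_def id_def)
    \<comment> \<open>Both composites apply \<open>\<sigma>\<close> to the left leg and the slice of
      \<Delta> to the right leg, so the order does not matter.\<close>
    also have "\<dots> = tensor_map K C1 (H \<alpha>) id (\<lambda>n. tensor_slice K (H \<alpha>) f (\<Delta> \<alpha> \<beta> n))
        (tensor_map K C1 (H (\<alpha> \<otimes>\<^bsub>\<pi>\<^esub> \<beta>)) (\<sigma> \<one>\<^bsub>\<pi>\<^esub>) id (\<Delta> \<one>\<^bsub>\<pi>\<^esub> (\<alpha> \<otimes>\<^bsub>\<pi>\<^esub> \<beta>) ?x))"
      using tensor_map_comp[OF id1 slD sigma_linear linear_map_id[OF H\<alpha>] D1x]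
        tensor_map_comp[OF sigma_linear linear_map_id[OF H\<alpha>\<beta>] idC slD D1x]
      by simp
    \<comment> \<open>The inner expression is now \<open>L\<close> at the value F v, to which the
      condition on F at \<alpha>\<beta> applies.\<close>
    also have "\<dots> = tensor_map K C1 (H \<alpha>) id (\<lambda>n. tensor_slice K (H \<alpha>) f (\<Delta> \<alpha> \<beta> n))
        (tensor_map K C1 (H (\<alpha> \<otimes>\<^bsub>\<pi>\<^esub> \<beta>)) id F (\<rho> \<one>\<^bsub>\<pi>\<^esub> \<one>\<^bsub>\<pi>\<^esub> v))"
      using F_L[OF v] by (simp add: coind_L_def)
    also have "\<dots> = tensor_map K C1 (H \<alpha>) (\<lambda>m. id (id m)) (\<lambda>v. tensor_slice K (H \<alpha>) f (\<Delta> \<alpha> \<beta> (F v)))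
        (\<rho> \<one>\<^bsub>\<pi>\<^esub> \<one>\<^bsub>\<pi>\<^esub> v)"
      by (rule tensor_map_comp[OF idC F_lin idC slD linear_map_closed[OF rho_linear v]])
    also have "\<dots> = tensor_map K C1 (H \<alpha>) id (coind_slice \<alpha> \<beta> f F) (\<rho> \<one>\<^bsub>\<pi>\<^esub> \<one>\<^bsub>\<pi>\<^esub> v)"
      by (rule tensor_map_cong[OF idC lin]) (auto simp: coind_slice_def linear_map_closed[OF rho_linear v])
    finally show ?thesis using v by (simp add: coind_slice_def)
  qed
  with lin show ?thesis by (simp add: coind_carrier_iff[OF \<alpha>] coind_slice_def)
qed

lemma coind_slice_linear:
  assumes \<alpha>: "\<alpha> \<in> carrier \<pi>" and \<beta>: "\<beta> \<in> carrier \<pi>" and f: "linear_map K (H \<beta>) (self_space K) f"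
  shows "linear_map K (X (\<alpha> \<otimes>\<^bsub>\<pi>\<^esub> \<beta>)) (X \<alpha>) (coind_slice \<alpha> \<beta> f)"
proof -
  have \<alpha>\<beta>: "\<alpha> \<otimes>\<^bsub>\<pi>\<^esub> \<beta> \<in> carrier \<pi>" using \<alpha> \<beta> by simp
  show ?thesis
  proof (rule coind_linear_mapI[OF \<alpha> coind_vectorspace[OF \<alpha>\<beta>] coind_slice_closed[OF \<alpha> \<beta> f]])
    fix v assume v: "v \<in> carrier V1"
    show "linear_map K (X (\<alpha> \<otimes>\<^bsub>\<pi>\<^esub> \<beta>)) (H \<alpha>) (\<lambda>F. coind_slice \<alpha> \<beta> f F v)"
      by (rule linear_map_cong[OF linear_map_comp[OF coind_eval_linear[OF \<alpha>\<beta> v]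
              linear_map_comp[OF comult_linear[OF \<alpha> \<beta>] tensor_slice_linear[OF space[OF \<alpha>] f]]]])
        (simp add: coind_slice_def v)
  qed
qed

lemma coaction_linear:
  assumes \<alpha>: "\<alpha> \<in> carrier \<pi>" and \<beta>: "\<beta> \<in> carrier \<pi>"
  shows "linear_map K (X (\<alpha> \<otimes>\<^bsub>\<pi>\<^esub> \<beta>)) (tensor_space K (X \<alpha>) (H \<beta>)) (\<theta> \<alpha> \<beta>)"
proof -
  have \<alpha>\<beta>: "\<alpha> \<otimes>\<^bsub>\<pi>\<^esub> \<beta> \<in> carrier \<pi>" using \<alpha> \<beta> by simp
  show ?thesis
    unfolding coaction_eq using \<alpha> \<beta> \<alpha>\<beta> space[OF \<beta>]
    by (intro linear_map_sum tensor_space_vectorspace coind_vectorspace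
        linear_map_comp[OF coind_slice_linear pure_tensor_linear_left] g_linear B_closed) auto
qed

text \<open>The sum is the functional \<open>f\<close> applied to the second leg of \<open>\<theta> \<alpha> \<beta> F\<close>.\<close>

lemma coind_slice_expansion:
  assumes \<alpha>: "\<alpha> \<in> carrier \<pi>" and \<beta>: "\<beta> \<in> carrier \<pi>"
    and f: "linear_map K (H \<beta>) (self_space K) f" and F: "F \<in> carrier (X (\<alpha> \<otimes>\<^bsub>\<pi>\<^esub> \<beta>))"
  shows "coind_slice \<alpha> \<beta> f F = (\<Oplus>\<^bsub>X \<alpha>\<^esub> e\<in>B \<beta>. f e \<odot>\<^bsub>X \<alpha>\<^esub> coind_slice \<alpha> \<beta> (g \<beta> e) F)"
proof -
  have \<alpha>\<beta>: "\<alpha> \<otimes>\<^bsub>\<pi>\<^esub> \<beta> \<in> carrier \<pi>" using \<alpha> \<beta> by simp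
  interpret X: vectorspace K "X \<alpha>" by (rule coind_vectorspace[OF \<alpha>])
  interpret H: vectorspace K "H \<alpha>" by (rule space[OF \<alpha>])
  have cl: "f e \<odot>\<^bsub>X \<alpha>\<^esub> coind_slice \<alpha> \<beta> (g \<beta> e) F \<in> carrier (X \<alpha>)" if "e \<in> B \<beta>" for e
    using that linear_functional_closed[OF f] B_closed[OF \<beta>] coind_slice_closed[OF \<alpha> \<beta> g_linear[OF \<beta>] F]
    by auto
  show ?thesis
  proof (rule coind_eqI[OF \<alpha> coind_slice_closed[OF \<alpha> \<beta> f F]])
    show "(\<Oplus>\<^bsub>X \<alpha>\<^esub> e\<in>B \<beta>. f e \<odot>\<^bsub>X \<alpha>\<^esub> coind_slice \<alpha> \<beta> (g \<beta> e) F) \<in> carrier (X \<alpha>)"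
      using cl by (intro X.finsum_closed) auto
  next
    fix v assume v: "v \<in> carrier V1"
    note ev = coind_eval_linear[OF \<alpha> v]
    have t: "\<Delta> \<alpha> \<beta> (F v) \<in> carrier (tensor_space K (H \<alpha>) (H \<beta>))"
      using linear_map_closed[OF comult_linear[OF \<alpha> \<beta>] linear_map_closed[OF coind_eval_linear[OF \<alpha>\<beta> v] F]] .
    have "coind_slice \<alpha> \<beta> f F v =
        (\<Oplus>\<^bsub>H \<alpha>\<^esub> e\<in>B \<beta>. f e \<odot>\<^bsub>H \<alpha>\<^esub> tensor_slice K (H \<alpha>) (g \<beta> e) (\<Delta> \<alpha> \<beta> (F v)))"
      using v tensor_slice_expansion[OF space[OF \<alpha>] dual[OF \<beta>] f t] by (simp add: coind_slice_def)
    also have "\<dots> = (\<Oplus>\<^bsub>H \<alpha>\<^esub> e\<in>B \<beta>. (f e \<odot>\<^bsub>X \<alpha>\<^esub> coind_slice \<alpha> \<beta> (g \<beta> e) F) v)"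
    proof (intro H.finsum_cong' refl Pi_I)
      fix e assume e: "e \<in> B \<beta>"
      show "(f e \<odot>\<^bsub>X \<alpha>\<^esub> coind_slice \<alpha> \<beta> (g \<beta> e) F) v \<in> carrier (H \<alpha>)"
        using linear_map_closed[OF ev cl[OF e]] .
      show "f e \<odot>\<^bsub>H \<alpha>\<^esub> tensor_slice K (H \<alpha>) (g \<beta> e) (\<Delta> \<alpha> \<beta> (F v)) =
          (f e \<odot>\<^bsub>X \<alpha>\<^esub> coind_slice \<alpha> \<beta> (g \<beta> e) F) v"
        using linear_map_smult[OF ev linear_functional_closed[OF f B_closed[OF \<beta> e]]
            coind_slice_closed[OF \<alpha> \<beta> g_linear[OF \<beta> e] F]] v
        by (simp add: coind_slice_def)
    qed
    also have "\<dots> = (\<Oplus>\<^bsub>X \<alpha>\<^esub> e\<in>B \<beta>. f e \<odot>\<^bsub>X \<alpha>\<^esub> coind_slice \<alpha> \<beta> (g \<beta> e) F) v"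
      using cl by (intro linear_map_finsum[OF ev, symmetric])
    finally show "coind_slice \<alpha> \<beta> f F v = \<dots>" .
  qed
qed

lemma coind_slice_slice:
  assumes \<alpha>: "\<alpha> \<in> carrier \<pi>" and \<beta>: "\<beta> \<in> carrier \<pi>" and \<gamma>: "\<gamma> \<in> carrier \<pi>"
    and h: "linear_map K (H \<beta>) (self_space K) h" and f: "linear_map K (H \<gamma>) (self_space K) f"
    and F: "F \<in> carrier (X (\<alpha> \<otimes>\<^bsub>\<pi>\<^esub> \<beta> \<otimes>\<^bsub>\<pi>\<^esub> \<gamma>))"
  shows "coind_slice \<alpha> \<beta> h (coind_slice (\<alpha> \<otimes>\<^bsub>\<pi>\<^esub> \<beta>) \<gamma> f F) =
    coind_slice \<alpha> (\<beta> \<otimes>\<^bsub>\<pi>\<^esub> \<gamma>) (\<lambda>x. h (tensor_slice K (H \<beta>) f (\<Delta> \<beta> \<gamma> x))) F"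
proof -
  have \<alpha>\<beta>: "\<alpha> \<otimes>\<^bsub>\<pi>\<^esub> \<beta> \<in> carrier \<pi>" and \<beta>\<gamma>: "\<beta> \<otimes>\<^bsub>\<pi>\<^esub> \<gamma> \<in> carrier \<pi>"
    and \<alpha>\<beta>\<gamma>: "\<alpha> \<otimes>\<^bsub>\<pi>\<^esub> \<beta> \<otimes>\<^bsub>\<pi>\<^esub> \<gamma> \<in> carrier \<pi>" using \<alpha> \<beta> \<gamma> by auto
  note H\<alpha> = space[OF \<alpha>] and H\<beta> = space[OF \<beta>] and H\<gamma> = space[OF \<gamma>]
  note D = comult_linear[OF \<alpha> \<beta>] and D' = comult_linear[OF \<beta> \<gamma>]
  note D2 = comult_linear[OF \<alpha>\<beta> \<gamma>]
  \<comment> \<open>The comultiplication has domain index \<alpha>(\<beta>\<gamma>); it is restated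
    for the bracketing under which F is given.\<close>
  have D3: "linear_map K (H (\<alpha> \<otimes>\<^bsub>\<pi>\<^esub> \<beta> \<otimes>\<^bsub>\<pi>\<^esub> \<gamma>)) (tensor_space K (H \<alpha>) (H (\<beta> \<otimes>\<^bsub>\<pi>\<^esub> \<gamma>)))
      (\<Delta> \<alpha> (\<beta> \<otimes>\<^bsub>\<pi>\<^esub> \<gamma>))"
    using comult_linear[OF \<alpha> \<beta>\<gamma>] \<alpha> \<beta> \<gamma> by (simp add: pi.m_assoc)
  have "tensor_slice K (H \<alpha>) h (\<Delta> \<alpha> \<beta> (tensor_slice K (H (\<alpha> \<otimes>\<^bsub>\<pi>\<^esub> \<beta>)) f
        (\<Delta> (\<alpha> \<otimes>\<^bsub>\<pi>\<^esub> \<beta>) \<gamma> x))) =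
      tensor_slice K (H \<alpha>) (\<lambda>x. h (tensor_slice K (H \<beta>) f (\<Delta> \<beta> \<gamma> x))) (\<Delta> \<alpha> (\<beta> \<otimes>\<^bsub>\<pi>\<^esub> \<gamma>) x)"
    if x: "x \<in> carrier (H (\<alpha> \<otimes>\<^bsub>\<pi>\<^esub> \<beta> \<otimes>\<^bsub>\<pi>\<^esub> \<gamma>))" for x
  proof -
    note D2x = linear_map_closed[OF D2 x] and D3x = linear_map_closed[OF D3 x]
    \<comment> \<open>Naturality of slicing exposes (\<Delta> \<otimes> I) \<Delta>, to which
      coassociativity applies after the two slices have been merged through the associator.\<close>
    have "\<Delta> \<alpha> \<beta> (tensor_slice K (H (\<alpha> \<otimes>\<^bsub>\<pi>\<^esub> \<beta>)) f (\<Delta> (\<alpha> \<otimes>\<^bsub>\<pi>\<^esub> \<beta>) \<gamma> x)) =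
        tensor_slice K (tensor_space K (H \<alpha>) (H \<beta>)) f
          (tensor_map K (tensor_space K (H \<alpha>) (H \<beta>)) (H \<gamma>) (\<Delta> \<alpha> \<beta>) id (\<Delta> (\<alpha> \<otimes>\<^bsub>\<pi>\<^esub> \<beta>) \<gamma> x))"
      using tensor_slice_map[OF D linear_map_id[OF H\<gamma>] f D2x] by simp
    also have "tensor_slice K (H \<alpha>) h \<dots> = tensor_slice K (H \<alpha>) (\<lambda>x. h (tensor_slice K (H \<beta>) f x))
        (tensor_assoc K (H \<alpha>) (H \<beta>) (H \<gamma>)
          (tensor_map K (tensor_space K (H \<alpha>) (H \<beta>)) (H \<gamma>) (\<Delta> \<alpha> \<beta>) id (\<Delta> (\<alpha> \<otimes>\<^bsub>\<pi>\<^esub> \<beta>) \<gamma> x)))"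
      by (rule tensor_slice_slice[OF H\<alpha> h f
            linear_map_closed[OF tensor_map_linear[OF D linear_map_id[OF H\<gamma>]] D2x]])
    also have "\<dots> = tensor_slice K (H \<alpha>) (\<lambda>x. h (tensor_slice K (H \<beta>) f x))
        (tensor_map K (H \<alpha>) (tensor_space K (H \<beta>) (H \<gamma>)) id (\<Delta> \<beta> \<gamma>) (\<Delta> \<alpha> (\<beta> \<otimes>\<^bsub>\<pi>\<^esub> \<gamma>) x))"
      using coassoc[OF \<alpha> \<beta> \<gamma> x] by simp
    also have "\<dots> = tensor_slice K (H \<alpha>) (\<lambda>x. h (tensor_slice K (H \<beta>) f (\<Delta> \<beta> \<gamma> x)))
        (\<Delta> \<alpha> (\<beta> \<otimes>\<^bsub>\<pi>\<^esub> \<gamma>) x)"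
      using tensor_slice_map[OF linear_map_id[OF H\<alpha>] D'
          linear_map_comp[OF tensor_slice_linear[OF H\<beta> f] h] D3x] by simp
    finally show ?thesis .
  qed
  then show ?thesis
    using linear_map_closed[OF coind_eval_linear[OF \<alpha>\<beta>\<gamma>] F]
    by (simp add: coind_slice_def fun_eq_iff restrict_def)
qed

section \<open>Coassociativity and counit of the coinduced coaction\<close>

text \<open>The same constants occur twice: as coefficients of \<Delta> k in the basis tensors j
  \<otimes> i, and as coefficients of the iterated slice of F along i and j in the slices
  \<open>G k\<close>. Hence both sides are the sum of all \<open>z i j k\<close>, with k innermost
  on the left and outermost on the right.\<close>

lemma coaction_coassoc:
  assumes \<alpha>: "\<alpha> \<in> carrier \<pi>" and \<beta>: "\<beta> \<in> carrier \<pi>" and \<gamma>: "\<gamma> \<in> carrier \<pi>"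
    and F: "F \<in> carrier (X (\<alpha> \<otimes>\<^bsub>\<pi>\<^esub> \<beta> \<otimes>\<^bsub>\<pi>\<^esub> \<gamma>))"
  shows "tensor_assoc K (X \<alpha>) (H \<beta>) (H \<gamma>)
      (tensor_map K (tensor_space K (X \<alpha>) (H \<beta>)) (H \<gamma>) (\<theta> \<alpha> \<beta>) id (\<theta> (\<alpha> \<otimes>\<^bsub>\<pi>\<^esub> \<beta>) \<gamma> F)) =
    tensor_map K (X \<alpha>) (tensor_space K (H \<beta>) (H \<gamma>)) id (\<Delta> \<beta> \<gamma>) (\<theta> \<alpha> (\<beta> \<otimes>\<^bsub>\<pi>\<^esub> \<gamma>) F)"
    (is "?lhs = ?rhs")
proof -
  have \<alpha>\<beta>: "\<alpha> \<otimes>\<^bsub>\<pi>\<^esub> \<beta> \<in> carrier \<pi>" and \<beta>\<gamma>: "\<beta> \<otimes>\<^bsub>\<pi>\<^esub> \<gamma> \<in> carrier \<pi>" using \<alpha> \<beta> \<gamma> by auto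
  have F': "F \<in> carrier (X (\<alpha> \<otimes>\<^bsub>\<pi>\<^esub> (\<beta> \<otimes>\<^bsub>\<pi>\<^esub> \<gamma>)))" using F \<alpha> \<beta> \<gamma> by (simp add: pi.m_assoc)
  note X\<alpha> = coind_vectorspace[OF \<alpha>] and X\<alpha>\<beta> = coind_vectorspace[OF \<alpha>\<beta>]
  note H\<beta> = space[OF \<beta>] and H\<gamma> = space[OF \<gamma>] and H\<beta>\<gamma> = space[OF \<beta>\<gamma>]
  note HH = tensor_space_vectorspace[OF H\<beta> H\<gamma>]
  note XH = tensor_space_vectorspace[OF X\<alpha> H\<beta>]
  let ?HH = "tensor_space K (H \<beta>) (H \<gamma>)"
  let ?T = "tensor_space K (X \<alpha>) ?HH"
  interpret T: vectorspace K ?T by (rule tensor_space_vectorspace[OF X\<alpha> HH])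
  interpret HH: vectorspace K ?HH by (rule HH)
  interpret X: vectorspace K "X \<alpha>" by (rule X\<alpha>)
  note D = comult_linear[OF \<beta> \<gamma>]
  note B\<beta> = B_closed[OF \<beta>] and B\<gamma> = B_closed[OF \<gamma>] and B\<beta>\<gamma> = B_closed[OF \<beta>\<gamma>]
  note g\<beta> = g_linear[OF \<beta>] and g\<gamma> = g_linear[OF \<gamma>] and g\<beta>\<gamma> = g_linear[OF \<beta>\<gamma>]
  \<comment> \<open>As a function of x this is the functional (g j \<otimes> g i) \<Delta>; at a
    basis element k it is the coefficient of j \<otimes> i in \<Delta> k.\<close>
  define c where "c = (\<lambda>i j x. g \<beta> j (tensor_slice K (H \<beta>) (g \<gamma> i) (\<Delta> \<beta> \<gamma> x)))"
  define G where "G k = coind_slice \<alpha> (\<beta> \<otimes>\<^bsub>\<pi>\<^esub> \<gamma>) (g (\<beta> \<otimes>\<^bsub>\<pi>\<^esub> \<gamma>) k) F" for k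
  \<comment> \<open>With the coefficient in the right factor, the sums over i and j rebuild \<Delta>
    k. Moved to the left factor, it lets the sum over k rebuild the slice along
    \<open>c i j\<close>.\<close>
  define z where "z = (\<lambda>i j k. pure_tensor K (X \<alpha>) ?HH (G k)
    (c i j k \<odot>\<^bsub>?HH\<^esub> pure_tensor K (H \<beta>) (H \<gamma>) j i))"
  have c: "linear_map K (H (\<beta> \<otimes>\<^bsub>\<pi>\<^esub> \<gamma>)) (self_space K) (c i j)" if "i \<in> B \<gamma>" "j \<in> B \<beta>" for i j
    unfolding c_def using that
    by (intro linear_map_comp[OF D linear_map_comp[OF tensor_slice_linear[OF H\<beta> g\<gamma>] g\<beta>]])
  have ck: "c i j k \<in> carrier K" if "i \<in> B \<gamma>" "j \<in> B \<beta>" "k \<in> B (\<beta> \<otimes>\<^bsub>\<pi>\<^esub> \<gamma>)" for i j k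
    using linear_functional_closed[OF c[OF that(1,2)] B\<beta>\<gamma>[OF that(3)]] .
  have G: "G k \<in> carrier (X \<alpha>)" if "k \<in> B (\<beta> \<otimes>\<^bsub>\<pi>\<^esub> \<gamma>)" for k
    unfolding G_def by (rule coind_slice_closed[OF \<alpha> \<beta>\<gamma> g\<beta>\<gamma>[OF that] F'])
  have p: "pure_tensor K (H \<beta>) (H \<gamma>) j i \<in> carrier ?HH" if "i \<in> B \<gamma>" "j \<in> B \<beta>" for i j
    by (rule pure_tensor_closed[OF H\<beta> H\<gamma> B\<beta>[OF that(2)] B\<gamma>[OF that(1)]])
  have z: "z i j k \<in> carrier ?T" if "i \<in> B \<gamma>" "j \<in> B \<beta>" "k \<in> B (\<beta> \<otimes>\<^bsub>\<pi>\<^esub> \<gamma>)" for i j k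
    unfolding z_def using that ck G p by (intro pure_tensor_closed[OF X\<alpha> HH]) auto
  have Fi: "coind_slice (\<alpha> \<otimes>\<^bsub>\<pi>\<^esub> \<beta>) \<gamma> (g \<gamma> i) F \<in> carrier (X (\<alpha> \<otimes>\<^bsub>\<pi>\<^esub> \<beta>))" if "i \<in> B \<gamma>" for i
    by (rule coind_slice_closed[OF \<alpha>\<beta> \<gamma> g\<gamma>[OF that] F])
  \<comment> \<open>The two slices merge into one along \<open>c i j\<close>, which is expanded in
    the dual basis at \<beta>\<gamma>; each coefficient is then carried across the tensor
    sign.\<close>
  have Fij: "pure_tensor K (X \<alpha>) ?HH (coind_slice \<alpha> \<beta> (g \<beta> j) (coind_slice (\<alpha> \<otimes>\<^bsub>\<pi>\<^esub> \<beta>) \<gamma> (g \<gamma> i) F))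
      (pure_tensor K (H \<beta>) (H \<gamma>) j i) = (\<Oplus>\<^bsub>?T\<^esub> k\<in>B (\<beta> \<otimes>\<^bsub>\<pi>\<^esub> \<gamma>). z i j k)"
    if i: "i \<in> B \<gamma>" and j: "j \<in> B \<beta>" for i j
  proof -
    have "coind_slice \<alpha> \<beta> (g \<beta> j) (coind_slice (\<alpha> \<otimes>\<^bsub>\<pi>\<^esub> \<beta>) \<gamma> (g \<gamma> i) F) =
        coind_slice \<alpha> (\<beta> \<otimes>\<^bsub>\<pi>\<^esub> \<gamma>) (c i j) F"
      unfolding c_def by (rule coind_slice_slice[OF \<alpha> \<beta> \<gamma> g\<beta>[OF j] g\<gamma>[OF i] F])
    also have "\<dots> = (\<Oplus>\<^bsub>X \<alpha>\<^esub> k\<in>B (\<beta> \<otimes>\<^bsub>\<pi>\<^esub> \<gamma>). c i j k \<odot>\<^bsub>X \<alpha>\<^esub> G k)"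
      unfolding G_def by (rule coind_slice_expansion[OF \<alpha> \<beta>\<gamma> c[OF i j] F'])
    finally have "pure_tensor K (X \<alpha>) ?HH
        (coind_slice \<alpha> \<beta> (g \<beta> j) (coind_slice (\<alpha> \<otimes>\<^bsub>\<pi>\<^esub> \<beta>) \<gamma> (g \<gamma> i) F))
        (pure_tensor K (H \<beta>) (H \<gamma>) j i) =
      pure_tensor K (X \<alpha>) ?HH
        (\<Oplus>\<^bsub>X \<alpha>\<^esub> k\<in>B (\<beta> \<otimes>\<^bsub>\<pi>\<^esub> \<gamma>). c i j k \<odot>\<^bsub>X \<alpha>\<^esub> G k)
        (pure_tensor K (H \<beta>) (H \<gamma>) j i)"
      by (rule arg_cong)
    also have "\<dots> =
        (\<Oplus>\<^bsub>?T\<^esub> k\<in>B (\<beta> \<otimes>\<^bsub>\<pi>\<^esub> \<gamma>).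
          pure_tensor K (X \<alpha>) ?HH (c i j k \<odot>\<^bsub>X \<alpha>\<^esub> G k) (pure_tensor K (H \<beta>) (H \<gamma>) j i))"
      using i j ck G by (intro linear_map_finsum[OF pure_tensor_linear_left[OF X\<alpha> HH p]]) auto
    also have "\<dots> = (\<Oplus>\<^bsub>?T\<^esub> k\<in>B (\<beta> \<otimes>\<^bsub>\<pi>\<^esub> \<gamma>). z i j k)"
      unfolding z_def
      by (intro T.finsum_cong' refl Pi_I z[OF i j, unfolded z_def]
          pure_tensor_smult_shift[OF X\<alpha> HH ck[OF i j] G p[OF i j]])
    finally show ?thesis .
  qed
  note tm = tensor_map_linear[OF coaction_linear[OF \<alpha> \<beta>] linear_map_id[OF H\<gamma>]]
  note as = tensor_assoc_linear[OF X\<alpha> H\<beta> H\<gamma>]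
  have "?lhs = (\<Oplus>\<^bsub>?T\<^esub> i\<in>B \<gamma>. tensor_assoc K (X \<alpha>) (H \<beta>) (H \<gamma>)
      (tensor_map K (tensor_space K (X \<alpha>) (H \<beta>)) (H \<gamma>) (\<theta> \<alpha> \<beta>) id
        (pure_tensor K (X (\<alpha> \<otimes>\<^bsub>\<pi>\<^esub> \<beta>)) (H \<gamma>) (coind_slice (\<alpha> \<otimes>\<^bsub>\<pi>\<^esub> \<beta>) \<gamma> (g \<gamma> i) F) i)))"
    unfolding coaction_eq[of "\<alpha> \<otimes>\<^bsub>\<pi>\<^esub> \<beta>" \<gamma> F]
    by (intro linear_map_finsum[OF linear_map_comp[OF tm as]] pure_tensor_closed[OF X\<alpha>\<beta> H\<gamma>] Fi B\<gamma>)
  also have "\<dots> = (\<Oplus>\<^bsub>?T\<^esub> i\<in>B \<gamma>. \<Oplus>\<^bsub>?T\<^esub> j\<in>B \<beta>. \<Oplus>\<^bsub>?T\<^esub> k\<in>B (\<beta> \<otimes>\<^bsub>\<pi>\<^esub> \<gamma>). z i j k)"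
  proof (intro T.finsum_cong' refl Pi_I)
    fix i assume i: "i \<in> B \<gamma>"
    show "(\<Oplus>\<^bsub>?T\<^esub> j\<in>B \<beta>. \<Oplus>\<^bsub>?T\<^esub> k\<in>B (\<beta> \<otimes>\<^bsub>\<pi>\<^esub> \<gamma>). z i j k) \<in> carrier ?T"
      using z[OF i] by (intro T.finsum_closed Pi_I) auto
    let ?Fi = "coind_slice (\<alpha> \<otimes>\<^bsub>\<pi>\<^esub> \<beta>) \<gamma> (g \<gamma> i) F"
    note Bi = B\<gamma>[OF i] and Fi = Fi[OF i]
    have Fij_cl: "coind_slice \<alpha> \<beta> (g \<beta> j) ?Fi \<in> carrier (X \<alpha>)" if "j \<in> B \<beta>" for j
      by (rule coind_slice_closed[OF \<alpha> \<beta> g\<beta>[OF that] Fi])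
    note pl = pure_tensor_linear_left[OF H\<beta> H\<gamma> Bi]
    have "tensor_assoc K (X \<alpha>) (H \<beta>) (H \<gamma>) (tensor_map K (tensor_space K (X \<alpha>) (H \<beta>)) (H \<gamma>) (\<theta> \<alpha> \<beta>) id
        (pure_tensor K (X (\<alpha> \<otimes>\<^bsub>\<pi>\<^esub> \<beta>)) (H \<gamma>) ?Fi i)) =
        tensor_map K (X \<alpha>) ?HH id (\<lambda>n. pure_tensor K (H \<beta>) (H \<gamma>) n i) (\<theta> \<alpha> \<beta> ?Fi)"
      by (simp add: tensor_map_pure[OF coaction_linear[OF \<alpha> \<beta>] linear_map_id[OF H\<gamma>] Fi Bi]
          tensor_assoc_pure[OF X\<alpha> H\<beta> H\<gamma> linear_map_closed[OF coaction_linear[OF \<alpha> \<beta>] Fi] Bi])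
    also have "\<dots> = (\<Oplus>\<^bsub>?T\<^esub> j\<in>B \<beta>. tensor_map K (X \<alpha>) ?HH id (\<lambda>n. pure_tensor K (H \<beta>) (H \<gamma>) n i)
        (pure_tensor K (X \<alpha>) (H \<beta>) (coind_slice \<alpha> \<beta> (g \<beta> j) ?Fi) j))"
      unfolding coaction_eq[of \<alpha> \<beta>]
      by (intro linear_map_finsum[OF tensor_map_linear[OF linear_map_id[OF X\<alpha>] pl]]
          pure_tensor_closed[OF X\<alpha> H\<beta>] Fij_cl B\<beta>)
    also have "\<dots> = (\<Oplus>\<^bsub>?T\<^esub> j\<in>B \<beta>. \<Oplus>\<^bsub>?T\<^esub> k\<in>B (\<beta> \<otimes>\<^bsub>\<pi>\<^esub> \<gamma>). z i j k)"
    proof (intro T.finsum_cong' refl Pi_I T.finsum_closed z i)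
      fix j assume j: "j \<in> B \<beta>"
      show "tensor_map K (X \<alpha>) ?HH id (\<lambda>n. pure_tensor K (H \<beta>) (H \<gamma>) n i)
          (pure_tensor K (X \<alpha>) (H \<beta>) (coind_slice \<alpha> \<beta> (g \<beta> j) ?Fi) j) =
          (\<Oplus>\<^bsub>?T\<^esub> k\<in>B (\<beta> \<otimes>\<^bsub>\<pi>\<^esub> \<gamma>). z i j k)"
        unfolding tensor_map_pure[OF linear_map_id[OF X\<alpha>] pl Fij_cl[OF j] B\<beta>[OF j]] id_apply
        by (rule Fij[OF i j])
    qed
    finally show "tensor_assoc K (X \<alpha>) (H \<beta>) (H \<gamma>) (tensor_map K (tensor_space K (X \<alpha>) (H \<beta>)) (H \<gamma>) (\<theta> \<alpha> \<beta>) id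
        (pure_tensor K (X (\<alpha> \<otimes>\<^bsub>\<pi>\<^esub> \<beta>)) (H \<gamma>) ?Fi i)) = \<dots>" .
  qed
  \<comment> \<open>The sum over k is moved outwards by two exchanges, past j here and past i in the
    next step.\<close>
  also have "\<dots> = (\<Oplus>\<^bsub>?T\<^esub> i\<in>B \<gamma>. \<Oplus>\<^bsub>?T\<^esub> k\<in>B (\<beta> \<otimes>\<^bsub>\<pi>\<^esub> \<gamma>). \<Oplus>\<^bsub>?T\<^esub> j\<in>B \<beta>. z i j k)"
  proof (rule T.finsum_cong'[OF refl])
    show "(\<lambda>i. \<Oplus>\<^bsub>?T\<^esub> k\<in>B (\<beta> \<otimes>\<^bsub>\<pi>\<^esub> \<gamma>). \<Oplus>\<^bsub>?T\<^esub> j\<in>B \<beta>. z i j k) \<in> B \<gamma> \<rightarrow> carrier ?T"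
      by (intro Pi_I T.finsum_closed z)
  qed (intro T.finsum_swap z B_finite \<beta> \<beta>\<gamma>)
  also have "\<dots> = (\<Oplus>\<^bsub>?T\<^esub> k\<in>B (\<beta> \<otimes>\<^bsub>\<pi>\<^esub> \<gamma>). \<Oplus>\<^bsub>?T\<^esub> i\<in>B \<gamma>. \<Oplus>\<^bsub>?T\<^esub> j\<in>B \<beta>. z i j k)"
    by (intro T.finsum_swap T.finsum_closed Pi_I z B_finite \<gamma> \<beta>\<gamma>)
  also have "\<dots> = (\<Oplus>\<^bsub>?T\<^esub> k\<in>B (\<beta> \<otimes>\<^bsub>\<pi>\<^esub> \<gamma>). pure_tensor K (X \<alpha>) ?HH (G k) (\<Delta> \<beta> \<gamma> k))"
  proof (intro T.finsum_cong' refl Pi_I pure_tensor_closed[OF X\<alpha> HH] G linear_map_closed[OF D] B\<beta>\<gamma>)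
    fix k assume k: "k \<in> B (\<beta> \<otimes>\<^bsub>\<pi>\<^esub> \<gamma>)"
    note Dk = linear_map_closed[OF D B\<beta>\<gamma>[OF k]]
    have s: "tensor_slice K (H \<beta>) (g \<gamma> i) (\<Delta> \<beta> \<gamma> k) \<in> carrier (H \<beta>)" if "i \<in> B \<gamma>" for i
      by (rule linear_map_closed[OF tensor_slice_linear[OF H\<beta> g\<gamma>[OF that]] Dk])
    \<comment> \<open>The right leg is expanded first, and then each resulting slice in the basis of
      \<open>H \<beta>\<close>; the coefficients are \<open>c i j k\<close> by definition.\<close>
    have "\<Delta> \<beta> \<gamma> k = (\<Oplus>\<^bsub>?HH\<^esub> i\<in>B \<gamma>.
        pure_tensor K (H \<beta>) (H \<gamma>) (tensor_slice K (H \<beta>) (g \<gamma> i) (\<Delta> \<beta> \<gamma> k)) i)"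
      by (rule tensor_expansion[OF H\<beta> H\<gamma> dual[OF \<gamma>] Dk])
    also have "\<dots> = (\<Oplus>\<^bsub>?HH\<^esub> i\<in>B \<gamma>. \<Oplus>\<^bsub>?HH\<^esub> j\<in>B \<beta>. c i j k \<odot>\<^bsub>?HH\<^esub> pure_tensor K (H \<beta>) (H \<gamma>) j i)"
    proof (intro HH.finsum_cong' refl Pi_I HH.finsum_closed)
      fix i j assume "i \<in> B \<gamma>" "j \<in> B \<beta>"
      then show "c i j k \<odot>\<^bsub>?HH\<^esub> pure_tensor K (H \<beta>) (H \<gamma>) j i \<in> carrier ?HH"
        using ck[OF _ _ k] p by auto
    next
      fix i assume i: "i \<in> B \<gamma>"
      interpret H\<beta>: vectorspace K "H \<beta>" by (rule H\<beta>)
      note pl = pure_tensor_linear_left[OF H\<beta> H\<gamma> B\<gamma>[OF i]]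
      have "pure_tensor K (H \<beta>) (H \<gamma>) (tensor_slice K (H \<beta>) (g \<gamma> i) (\<Delta> \<beta> \<gamma> k)) i =
          pure_tensor K (H \<beta>) (H \<gamma>) (\<Oplus>\<^bsub>H \<beta>\<^esub> j\<in>B \<beta>. c i j k \<odot>\<^bsub>H \<beta>\<^esub> j) i"
        unfolding c_def using dual_bases_expansion[OF H\<beta> dual[OF \<beta>] s[OF i]] by simp
      also have "\<dots> = (\<Oplus>\<^bsub>?HH\<^esub> j\<in>B \<beta>. pure_tensor K (H \<beta>) (H \<gamma>) (c i j k \<odot>\<^bsub>H \<beta>\<^esub> j) i)"
        using ck[OF i _ k] B\<beta> by (intro linear_map_finsum[OF pl]) auto
      also have "\<dots> = (\<Oplus>\<^bsub>?HH\<^esub> j\<in>B \<beta>. c i j k \<odot>\<^bsub>?HH\<^esub> pure_tensor K (H \<beta>) (H \<gamma>) j i)"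
        using ck[OF i _ k] B\<beta> p[OF i]
        by (intro HH.finsum_cong') (auto simp: linear_map_smult[OF pl])
      finally show "pure_tensor K (H \<beta>) (H \<gamma>) (tensor_slice K (H \<beta>) (g \<gamma> i) (\<Delta> \<beta> \<gamma> k)) i = \<dots>" .
    qed
    finally have "pure_tensor K (X \<alpha>) ?HH (G k) (\<Delta> \<beta> \<gamma> k) = pure_tensor K (X \<alpha>) ?HH (G k)
        (\<Oplus>\<^bsub>?HH\<^esub> i\<in>B \<gamma>. \<Oplus>\<^bsub>?HH\<^esub> j\<in>B \<beta>. c i j k \<odot>\<^bsub>?HH\<^esub> pure_tensor K (H \<beta>) (H \<gamma>) j i)"
      by (rule arg_cong)
    also have "\<dots> = (\<Oplus>\<^bsub>?T\<^esub> i\<in>B \<gamma>. pure_tensor K (X \<alpha>) ?HH (G k)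
        (\<Oplus>\<^bsub>?HH\<^esub> j\<in>B \<beta>. c i j k \<odot>\<^bsub>?HH\<^esub> pure_tensor K (H \<beta>) (H \<gamma>) j i))"
      using ck[OF _ _ k] p
      by (intro linear_map_finsum[OF pure_tensor_linear_right[OF X\<alpha> HH G[OF k]]] HH.finsum_closed) auto
    also have "\<dots> = (\<Oplus>\<^bsub>?T\<^esub> i\<in>B \<gamma>. \<Oplus>\<^bsub>?T\<^esub> j\<in>B \<beta>. z i j k)"
    proof (intro T.finsum_cong' refl Pi_I T.finsum_closed z k)
      fix i assume i: "i \<in> B \<gamma>"
      show "pure_tensor K (X \<alpha>) ?HH (G k)
          (\<Oplus>\<^bsub>?HH\<^esub> j\<in>B \<beta>. c i j k \<odot>\<^bsub>?HH\<^esub> pure_tensor K (H \<beta>) (H \<gamma>) j i) = (\<Oplus>\<^bsub>?T\<^esub> j\<in>B \<beta>. z i j k)"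
        unfolding z_def using ck[OF i _ k] p[OF i]
        by (intro linear_map_finsum[OF pure_tensor_linear_right[OF X\<alpha> HH G[OF k]]]) auto
    qed
    finally show "(\<Oplus>\<^bsub>?T\<^esub> i\<in>B \<gamma>. \<Oplus>\<^bsub>?T\<^esub> j\<in>B \<beta>. z i j k) =
        pure_tensor K (X \<alpha>) ?HH (G k) (\<Delta> \<beta> \<gamma> k)" by (rule sym)
  qed
  also have "\<dots> = (\<Oplus>\<^bsub>?T\<^esub> k\<in>B (\<beta> \<otimes>\<^bsub>\<pi>\<^esub> \<gamma>). tensor_map K (X \<alpha>) ?HH id (\<Delta> \<beta> \<gamma>)
      (pure_tensor K (X \<alpha>) (H (\<beta> \<otimes>\<^bsub>\<pi>\<^esub> \<gamma>)) (G k) k))"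
    using G B\<beta>\<gamma> linear_map_closed[OF D]
    by (intro T.finsum_cong' refl Pi_I)
      (auto simp: tensor_map_pure[OF linear_map_id[OF X\<alpha>] D] intro!: pure_tensor_closed[OF X\<alpha> HH])
  also have "\<dots> = ?rhs"
    unfolding coaction_eq[of \<alpha> "\<beta> \<otimes>\<^bsub>\<pi>\<^esub> \<gamma>"] G_def[symmetric]
    by (intro linear_map_finsum[OF tensor_map_linear[OF linear_map_id[OF X\<alpha>] D], symmetric]
        pure_tensor_closed[OF X\<alpha> H\<beta>\<gamma>] G B\<beta>\<gamma>)
  finally show ?thesis .
qed

text \<open>Applying \<epsilon> to the second leg of the coaction gives the basis expansion of the
  slice of F along \<epsilon>. The values of that slice are those of F by the right counit law of
  H.\<close>

lemma coaction_counit: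
  assumes \<alpha>: "\<alpha> \<in> carrier \<pi>" and F: "F \<in> carrier (X \<alpha>)"
  shows "tensor_runit K (X \<alpha>) (tensor_map K (X \<alpha>) (self_space K) id \<epsilon> (\<theta> \<alpha> \<one>\<^bsub>\<pi>\<^esub> F)) = F"
proof -
  have one: "\<one>\<^bsub>\<pi>\<^esub> \<in> carrier \<pi>" by simp
  have F': "F \<in> carrier (X (\<alpha> \<otimes>\<^bsub>\<pi>\<^esub> \<one>\<^bsub>\<pi>\<^esub>))" using F \<alpha> by simp
  note X\<alpha> = coind_vectorspace[OF \<alpha>] and H1 = space[OF one]
  interpret X: vectorspace K "X \<alpha>" by (rule X\<alpha>)
  note cl = coind_slice_closed[OF \<alpha> one g_linear[OF one] F']
  have "tensor_slice K (X \<alpha>) \<epsilon> (\<theta> \<alpha> \<one>\<^bsub>\<pi>\<^esub> F) = (\<Oplus>\<^bsub>X \<alpha>\<^esub> e\<in>B \<one>\<^bsub>\<pi>\<^esub>. tensor_slice K (X \<alpha>) \<epsilon>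
      (pure_tensor K (X \<alpha>) (H \<one>\<^bsub>\<pi>\<^esub>) (coind_slice \<alpha> \<one>\<^bsub>\<pi>\<^esub> (g \<one>\<^bsub>\<pi>\<^esub> e) F) e))"
    unfolding coaction_eq
    by (intro linear_map_finsum[OF tensor_slice_linear[OF X\<alpha> counit_linear]]
        pure_tensor_closed[OF X\<alpha> H1] cl B_closed[OF one])
  also have "\<dots> = (\<Oplus>\<^bsub>X \<alpha>\<^esub> e\<in>B \<one>\<^bsub>\<pi>\<^esub>. \<epsilon> e \<odot>\<^bsub>X \<alpha>\<^esub> coind_slice \<alpha> \<one>\<^bsub>\<pi>\<^esub> (g \<one>\<^bsub>\<pi>\<^esub> e) F)"
    using cl B_closed[OF one] linear_functional_closed[OF counit_linear]
    by (intro X.finsum_cong') (auto simp: tensor_slice_pure[OF X\<alpha> counit_linear])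
  also have "\<dots> = coind_slice \<alpha> \<one>\<^bsub>\<pi>\<^esub> \<epsilon> F"
    by (rule coind_slice_expansion[OF \<alpha> one counit_linear F', symmetric])
  also have "\<dots> = F"
    using counit_right[OF \<alpha> linear_map_closed[OF coind_eval_linear[OF \<alpha>] F]]
    by (intro coind_eqI[OF \<alpha> coind_slice_closed[OF \<alpha> one counit_linear F'] F])
      (simp add: coind_slice_def tensor_slice_def)
  finally show ?thesis by (simp add: tensor_slice_def)
qed

lemma coind_right_pi_comodule: "right_pi_comodule \<pi> K H \<Delta> \<epsilon> X \<theta>"
  by (intro right_pi_comodule.intro[OF pi_coalgebra_axioms] right_pi_comodule_axioms.intro
      coind_vectorspace coaction_linear coaction_coassoc coaction_counit)

end

section \<open>Pullback of coinduced maps along a colinear map\<close>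

text \<open>Invertibility of G is not assumed, so the linearity statement applies both to the given
  isomorphism and to its inverse, yielding mutually inverse maps between the coinduced
  spaces.\<close>

lemma
  fixes G :: "'w \<Rightarrow> 'v" and V :: "'p \<Rightarrow> ('k, 'v) module" and W :: "'p \<Rightarrow> ('k, 'w) module"
  assumes V: "coinduced_comodule \<pi> K H \<Delta> \<epsilon> C \<sigma> V \<rho> B g"
    and W: "coinduced_comodule \<pi> K H \<Delta> \<epsilon> C \<sigma> W \<psi> B g"
    and G: "linear_map K (W \<one>\<^bsub>\<pi>\<^esub>) (V \<one>\<^bsub>\<pi>\<^esub>) G"
    and colinear: "\<And>w. w \<in> carrier (W \<one>\<^bsub>\<pi>\<^esub>) \<Longrightarrow>
      \<rho> \<one>\<^bsub>\<pi>\<^esub> \<one>\<^bsub>\<pi>\<^esub> (G w) = tensor_map K (C \<one>\<^bsub>\<pi>\<^esub>) (V \<one>\<^bsub>\<pi>\<^esub>) id G (\<psi> \<one>\<^bsub>\<pi>\<^esub> \<one>\<^bsub>\<pi>\<^esub> w)"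
    and \<alpha>: "\<alpha> \<in> carrier \<pi>"
  defines "\<Phi> \<equiv> \<lambda>F. \<lambda>w\<in>carrier (W \<one>\<^bsub>\<pi>\<^esub>). F (G w)"
  shows coind_pullback_linear:
      "linear_map K (coind \<pi> K H \<Delta> C \<sigma> V \<rho> \<alpha>) (coind \<pi> K H \<Delta> C \<sigma> W \<psi> \<alpha>) \<Phi>"
    and coind_pullback_coaction: "\<beta> \<in> carrier \<pi> \<Longrightarrow> F \<in> carrier (coind \<pi> K H \<Delta> C \<sigma> V \<rho> (\<alpha> \<otimes>\<^bsub>\<pi>\<^esub> \<beta>)) \<Longrightarrow>
      coind_coaction \<pi> K H \<Delta> C \<sigma> B g W \<psi> \<alpha> \<beta> (\<Phi> F) =
      tensor_map K (coind \<pi> K H \<Delta> C \<sigma> W \<psi> \<alpha>) (H \<beta>) \<Phi> id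
        (coind_coaction \<pi> K H \<Delta> C \<sigma> B g V \<rho> \<alpha> \<beta> F)"
proof -
  interpret V: coinduced_comodule \<pi> K H \<Delta> \<epsilon> C \<sigma> V \<rho> B g by (rule V)
  interpret W: coinduced_comodule \<pi> K H \<Delta> \<epsilon> C \<sigma> W \<psi> B g by (rule W)
  note Gw = linear_map_closed[OF G]
  have closed: "\<Phi> F \<in> carrier (W.X \<alpha>)" if F: "F \<in> carrier (V.X \<alpha>)" for F
  proof -
    have F_lin: "linear_map K V.V1 (H \<alpha>) F"
      and F_L: "\<And>v. v \<in> carrier V.V1 \<Longrightarrow> V.L \<alpha> (F v) = tensor_map K V.C1 (H \<alpha>) id F (\<rho> \<one>\<^bsub>\<pi>\<^esub> \<one>\<^bsub>\<pi>\<^esub> v)"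
      using F by (auto simp: V.coind_carrier_iff[OF \<alpha>])
    note idC = linear_map_id[OF V.C1_space]
    have lin: "linear_map K W.V1 (H \<alpha>) (\<Phi> F)"
      by (rule linear_map_cong[OF linear_map_comp[OF G F_lin]]) (simp add: \<Phi>_def)
    \<comment> \<open>The condition for F is used at the point G w; colinearity of G then replaces
      \<rho> at G w by \<psi> at w, and the two maps on the right leg compose.\<close>
    have "V.L \<alpha> (\<Phi> F w) = tensor_map K V.C1 (H \<alpha>) id (\<Phi> F) (\<psi> \<one>\<^bsub>\<pi>\<^esub> \<one>\<^bsub>\<pi>\<^esub> w)"
      if w: "w \<in> carrier W.V1" for w
    proof -
      note \<psi>w = linear_map_closed[OF W.rho_linear w]
      have "V.L \<alpha> (\<Phi> F w) = tensor_map K V.C1 (H \<alpha>) id F (\<rho> \<one>\<^bsub>\<pi>\<^esub> \<one>\<^bsub>\<pi>\<^esub> (G w))"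
        using F_L[OF Gw[OF w]] w by (simp add: \<Phi>_def)
      also have "\<dots> = tensor_map K V.C1 (H \<alpha>) id F (tensor_map K V.C1 V.V1 id G (\<psi> \<one>\<^bsub>\<pi>\<^esub> \<one>\<^bsub>\<pi>\<^esub> w))"
        by (simp add: colinear[OF w])
      also have "\<dots> = tensor_map K V.C1 (H \<alpha>) (\<lambda>m. id (id m)) (\<lambda>w. F (G w)) (\<psi> \<one>\<^bsub>\<pi>\<^esub> \<one>\<^bsub>\<pi>\<^esub> w)"
        by (rule tensor_map_comp[OF idC G idC F_lin \<psi>w])
      also have "\<dots> = tensor_map K V.C1 (H \<alpha>) id (\<Phi> F) (\<psi> \<one>\<^bsub>\<pi>\<^esub> \<one>\<^bsub>\<pi>\<^esub> w)"
        by (rule tensor_map_cong[OF idC lin _ _ \<psi>w]) (simp_all add: \<Phi>_def)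
      finally show ?thesis .
    qed
    with lin show ?thesis by (simp add: W.coind_carrier_iff[OF \<alpha>] \<Phi>_def)
  qed
  show \<Phi>: "linear_map K (V.X \<alpha>) (W.X \<alpha>) \<Phi>"
  proof (rule W.coind_linear_mapI[OF \<alpha> V.coind_vectorspace[OF \<alpha>] closed])
    fix w assume w: "w \<in> carrier W.V1"
    show "linear_map K (V.X \<alpha>) (H \<alpha>) (\<lambda>F. \<Phi> F w)"
      by (rule linear_map_cong[OF V.coind_eval_linear[OF \<alpha> Gw[OF w]]]) (simp add: \<Phi>_def w)
  qed
  show "W.\<theta> \<alpha> \<beta> (\<Phi> F) = tensor_map K (W.X \<alpha>) (H \<beta>) \<Phi> id (V.\<theta> \<alpha> \<beta> F)"
    if \<beta>: "\<beta> \<in> carrier \<pi>" and F: "F \<in> carrier (V.X (\<alpha> \<otimes>\<^bsub>\<pi>\<^esub> \<beta>))"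
  proof -
    note H\<beta> = V.space[OF \<beta>] and VX = V.coind_vectorspace[OF \<alpha>] and WX = W.coind_vectorspace[OF \<alpha>]
    note id = linear_map_id[OF H\<beta>]
    interpret T: vectorspace K "tensor_space K (W.X \<alpha>) (H \<beta>)"
      by (rule tensor_space_vectorspace[OF WX H\<beta>])
    note cl = V.coind_slice_closed[OF \<alpha> \<beta> V.g_linear[OF \<beta>] F]
    \<comment> \<open>Slicing acts on the values of F and pulling back on its arguments, so they
      commute.\<close>
    have slice: "W.coind_slice \<alpha> \<beta> (g \<beta> e) (\<Phi> F) = \<Phi> (V.coind_slice \<alpha> \<beta> (g \<beta> e) F)" for e
      unfolding W.coind_slice_def V.coind_slice_def \<Phi>_def by (rule restrict_ext) (simp add: Gw)
    have "tensor_map K (W.X \<alpha>) (H \<beta>) \<Phi> id (V.\<theta> \<alpha> \<beta> F) =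
        (\<Oplus>\<^bsub>tensor_space K (W.X \<alpha>) (H \<beta>)\<^esub> e\<in>B \<beta>. tensor_map K (W.X \<alpha>) (H \<beta>) \<Phi> id
          (pure_tensor K (V.X \<alpha>) (H \<beta>) (V.coind_slice \<alpha> \<beta> (g \<beta> e) F) e))"
      unfolding V.coaction_eq
      by (intro linear_map_finsum[OF tensor_map_linear[OF \<Phi> id]]
          pure_tensor_closed[OF VX H\<beta>] cl V.B_closed[OF \<beta>])
    also have "\<dots> = (\<Oplus>\<^bsub>tensor_space K (W.X \<alpha>) (H \<beta>)\<^esub> e\<in>B \<beta>.
        pure_tensor K (W.X \<alpha>) (H \<beta>) (W.coind_slice \<alpha> \<beta> (g \<beta> e) (\<Phi> F)) e)"
    proof (rule T.finsum_cong'[OF refl])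
      show "(\<lambda>e. pure_tensor K (W.X \<alpha>) (H \<beta>) (W.coind_slice \<alpha> \<beta> (g \<beta> e) (\<Phi> F)) e) \<in>
          B \<beta> \<rightarrow> carrier (tensor_space K (W.X \<alpha>) (H \<beta>))"
        unfolding slice
        by (intro Pi_I pure_tensor_closed[OF WX H\<beta>] linear_map_closed[OF \<Phi>] cl V.B_closed[OF \<beta>])
    next
      fix e assume e: "e \<in> B \<beta>"
      show "tensor_map K (W.X \<alpha>) (H \<beta>) \<Phi> id
          (pure_tensor K (V.X \<alpha>) (H \<beta>) (V.coind_slice \<alpha> \<beta> (g \<beta> e) F) e) =
          pure_tensor K (W.X \<alpha>) (H \<beta>) (W.coind_slice \<alpha> \<beta> (g \<beta> e) (\<Phi> F)) e"
        unfolding slice tensor_map_pure[OF \<Phi> id cl[OF e] V.B_closed[OF \<beta> e]] id_apply ..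
    qed
    finally show ?thesis by (simp add: W.coaction_eq)
  qed
qed

section \<open>Equivalence of the two coinduced comodules\<close>

lemma (in left_pi_coisotropic_subgroup) coinduced_comoduleI:
  assumes V: "left_pi_comodule \<pi> K C \<Delta>C \<epsilon>C V \<rho>"
    and dual: "\<And>\<beta>. \<beta> \<in> carrier \<pi> \<Longrightarrow> dual_bases K (H \<beta>) (B \<beta>) (g \<beta>)"
  shows "coinduced_comodule \<pi> K H \<Delta> \<epsilon> C \<sigma> V \<rho> B g"
proof -
  interpret V: left_pi_comodule \<pi> K C \<Delta>C \<epsilon>C V \<rho> by (rule V)
  show ?thesis
  proof (rule coinduced_comodule.intro[OF H.pi_coalgebra_axioms], rule coinduced_comodule_axioms.intro)
    show "linear_map K (H \<one>\<^bsub>\<pi>\<^esub>) (C \<one>\<^bsub>\<pi>\<^esub>) (\<sigma> \<one>\<^bsub>\<pi>\<^esub>)"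
      by (rule proj_linear) simp
    show "linear_map K (V \<one>\<^bsub>\<pi>\<^esub>) (tensor_space K (C \<one>\<^bsub>\<pi>\<^esub>) (V \<one>\<^bsub>\<pi>\<^esub>)) (\<rho> \<one>\<^bsub>\<pi>\<^esub> \<one>\<^bsub>\<pi>\<^esub>)"
      using V.coaction_linear[of "\<one>\<^bsub>\<pi>\<^esub>" "\<one>\<^bsub>\<pi>\<^esub>"] by simp
  qed (rule dual)
qed

theorem theorem5p6:
  fixes \<pi> :: "('p, 'q) monoid_scheme" and K :: "('k, 'm) ring_scheme"
    and H :: "'p \<Rightarrow> ('k, 'h) module" and \<Delta> :: "'p \<Rightarrow> 'p \<Rightarrow> 'h \<Rightarrow> ('k, 'h, 'h) tensor"
    and \<epsilon> :: "'h \<Rightarrow> 'k" and S :: "'p \<Rightarrow> 'h \<Rightarrow> 'h"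
    and C :: "'p \<Rightarrow> ('k, 'c) module" and \<Delta>C :: "'p \<Rightarrow> 'p \<Rightarrow> 'c \<Rightarrow> ('k, 'c, 'c) tensor"
    and \<epsilon>C :: "'c \<Rightarrow> 'k" and act :: "'p \<Rightarrow> 'h \<Rightarrow> 'c \<Rightarrow> 'c" and \<sigma> :: "'p \<Rightarrow> 'h \<Rightarrow> 'c"
    and V :: "'p \<Rightarrow> ('k, 'v) module" and \<rho> :: "'p \<Rightarrow> 'p \<Rightarrow> 'v \<Rightarrow> ('k, 'c, 'v) tensor"
    and W :: "'p \<Rightarrow> ('k, 'w) module" and \<psi> :: "'p \<Rightarrow> 'p \<Rightarrow> 'w \<Rightarrow> ('k, 'c, 'w) tensor"
    and B :: "'p \<Rightarrow> 'h set" and g :: "'p \<Rightarrow> 'h \<Rightarrow> 'h \<Rightarrow> 'k"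
  assumes "hopf_pi_coalgebra \<pi> K H \<Delta> \<epsilon> S"
    and "\<And>\<alpha>. \<alpha> \<in> carrier \<pi> \<Longrightarrow> vectorspace.fin_dim K (H \<alpha>)"
    and "left_pi_coisotropic_subgroup \<pi> K H \<Delta> \<epsilon> S C \<Delta>C \<epsilon>C act \<sigma>"
    and "left_pi_comodule \<pi> K C \<Delta>C \<epsilon>C V \<rho>"
    and "left_pi_comodule \<pi> K C \<Delta>C \<epsilon>C W \<psi>"
    and "\<And>\<beta>. \<beta> \<in> carrier \<pi> \<Longrightarrow> dual_bases K (H \<beta>) (B \<beta>) (g \<beta>)"
    and "\<exists>F\<^sub>1. linear_iso K (V \<one>\<^bsub>\<pi>\<^esub>) (W \<one>\<^bsub>\<pi>\<^esub>) F\<^sub>1 \<and>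
      (\<forall>v\<in>carrier (V \<one>\<^bsub>\<pi>\<^esub>).
         \<psi> \<one>\<^bsub>\<pi>\<^esub> \<one>\<^bsub>\<pi>\<^esub> (F\<^sub>1 v) = tensor_map K (C \<one>\<^bsub>\<pi>\<^esub>) (W \<one>\<^bsub>\<pi>\<^esub>) id F\<^sub>1 (\<rho> \<one>\<^bsub>\<pi>\<^esub> \<one>\<^bsub>\<pi>\<^esub> v))"
  shows "equivalent_right_pi_comodules \<pi> K H \<Delta> \<epsilon>
    (coind \<pi> K H \<Delta> C \<sigma> V \<rho>) (coind_coaction \<pi> K H \<Delta> C \<sigma> B g V \<rho>)
    (coind \<pi> K H \<Delta> C \<sigma> W \<psi>) (coind_coaction \<pi> K H \<Delta> C \<sigma> B g W \<psi>)"
proof -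
  interpret Q: left_pi_coisotropic_subgroup \<pi> K H \<Delta> \<epsilon> S C \<Delta>C \<epsilon>C act \<sigma> by (rule assms(3))
  note V = Q.coinduced_comoduleI[OF assms(4,6)] and W = Q.coinduced_comoduleI[OF assms(5,6)]
  interpret V: coinduced_comodule \<pi> K H \<Delta> \<epsilon> C \<sigma> V \<rho> B g by (rule V)
  interpret W: coinduced_comodule \<pi> K H \<Delta> \<epsilon> C \<sigma> W \<psi> B g by (rule W)
  obtain F1 where iso: "linear_iso K V.V1 W.V1 F1"
    and colin: "\<And>v. v \<in> carrier V.V1 \<Longrightarrow>
      \<psi> \<one>\<^bsub>\<pi>\<^esub> \<one>\<^bsub>\<pi>\<^esub> (F1 v) = tensor_map K V.C1 W.V1 id F1 (\<rho> \<one>\<^bsub>\<pi>\<^esub> \<one>\<^bsub>\<pi>\<^esub> v)"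
    using assms(7) by blast
  have lin: "linear_map K V.V1 W.V1 F1" and bij: "bij_betw F1 (carrier V.V1) (carrier W.V1)"
    using iso by (auto simp: linear_iso_def)
  define G where "G = inv_into (carrier V.V1) F1"
  have G: "linear_map K W.V1 V.V1 G" unfolding G_def by (rule linear_iso_inverse[OF iso])
  have GF: "G (F1 v) = v" if "v \<in> carrier V.V1" for v
    unfolding G_def using bij that by (simp add: bij_betw_def)
  have FG: "F1 (G w) = w" if "w \<in> carrier W.V1" for w
    unfolding G_def using bij that by (simp add: bij_betw_def f_inv_into_f)
  note Gw = linear_map_closed[OF G] and Fv = linear_map_closed[OF lin]
  \<comment> \<open>Colinearity passes to the inverse: apply I \<otimes> G to the hypothesis at the
    point G w and cancel G against \<open>F1\<close>.\<close>
  have colin': "\<rho> \<one>\<^bsub>\<pi>\<^esub> \<one>\<^bsub>\<pi>\<^esub> (G w) = tensor_map K V.C1 V.V1 id G (\<psi> \<one>\<^bsub>\<pi>\<^esub> \<one>\<^bsub>\<pi>\<^esub> w)"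
    if w: "w \<in> carrier W.V1" for w
  proof -
    note \<rho>w = linear_map_closed[OF V.rho_linear Gw[OF w]]
    note idC = linear_map_id[OF V.C1_space] and idV = linear_map_id[OF V.V1_space]
    have "tensor_map K V.C1 V.V1 id G (\<psi> \<one>\<^bsub>\<pi>\<^esub> \<one>\<^bsub>\<pi>\<^esub> w) =
        tensor_map K V.C1 V.V1 id G (tensor_map K V.C1 W.V1 id F1 (\<rho> \<one>\<^bsub>\<pi>\<^esub> \<one>\<^bsub>\<pi>\<^esub> (G w)))"
      using colin[OF Gw[OF w]] by (simp add: FG[OF w])
    also have "\<dots> = tensor_map K V.C1 V.V1 (\<lambda>m. id (id m)) (\<lambda>v. G (F1 v)) (\<rho> \<one>\<^bsub>\<pi>\<^esub> \<one>\<^bsub>\<pi>\<^esub> (G w))"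
      by (rule tensor_map_comp[OF idC lin idC G \<rho>w])
    also have "\<dots> = tensor_map K V.C1 V.V1 id id (\<rho> \<one>\<^bsub>\<pi>\<^esub> \<one>\<^bsub>\<pi>\<^esub> (G w))"
      by (rule tensor_map_cong[OF idC idV _ _ \<rho>w]) (simp_all add: GF)
    also have "\<dots> = \<rho> \<one>\<^bsub>\<pi>\<^esub> \<one>\<^bsub>\<pi>\<^esub> (G w)"
      by (rule tensor_map_id[OF V.C1_space V.V1_space \<rho>w])
    finally show ?thesis by (rule sym)
  qed
  \<comment> \<open>Linear maps out of V1 are contravariant in V1, so the passage from V to W
    composes with G. The formulas do not mention \<alpha>; one formula serves all
    components.\<close>
  let ?\<Phi> = "\<lambda>F. \<lambda>w\<in>carrier W.V1. F (G w)" and ?\<Psi> = "\<lambda>F. \<lambda>v\<in>carrier V.V1. F (F1 v)"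
  have \<Phi>: "linear_map K (V.X \<alpha>) (W.X \<alpha>) ?\<Phi>" if "\<alpha> \<in> carrier \<pi>" for \<alpha>
    by (rule coind_pullback_linear[OF V W G colin' that])
  have \<Psi>: "linear_map K (W.X \<alpha>) (V.X \<alpha>) ?\<Psi>" if "\<alpha> \<in> carrier \<pi>" for \<alpha>
    by (rule coind_pullback_linear[OF W V lin colin that])
  have "linear_iso K (V.X \<alpha>) (W.X \<alpha>) ?\<Phi>" if \<alpha>: "\<alpha> \<in> carrier \<pi>" for \<alpha>
    unfolding linear_iso_def
  proof (rule conjI[OF \<Phi>[OF \<alpha>]])
    note \<Phi>F = linear_map_closed[OF \<Phi>[OF \<alpha>]] and \<Psi>F = linear_map_closed[OF \<Psi>[OF \<alpha>]]
    show "bij_betw ?\<Phi> (carrier (V.X \<alpha>)) (carrier (W.X \<alpha>))"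
    \<comment> \<open>The pullback along \<open>F1\<close> is the inverse: in either order the
      composite precomposes with G and \<open>F1\<close>, which cancel on the carriers, and
      coinduced maps are determined there.\<close>
    proof (rule bij_betw_byWitness[where f' = ?\<Psi>])
      show "\<forall>F\<in>carrier (V.X \<alpha>). ?\<Psi> (?\<Phi> F) = F"
      proof
        fix F assume F: "F \<in> carrier (V.X \<alpha>)"
        show "?\<Psi> (?\<Phi> F) = F"
          by (rule V.coind_eqI[OF \<alpha> \<Psi>F[OF \<Phi>F[OF F]] F]) (simp_all add: GF Fv)
      qed
      show "\<forall>F\<in>carrier (W.X \<alpha>). ?\<Phi> (?\<Psi> F) = F"
      proof
        fix F assume F: "F \<in> carrier (W.X \<alpha>)"
        show "?\<Phi> (?\<Psi> F) = F"
          by (rule W.coind_eqI[OF \<alpha> \<Phi>F[OF \<Psi>F[OF F]] F]) (simp_all add: FG Gw)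
      qed
    qed (use \<Phi>F \<Psi>F in blast)+
  qed
  moreover have "W.\<theta> \<alpha> \<beta> (?\<Phi> F) = tensor_map K (W.X \<alpha>) (H \<beta>) ?\<Phi> id (V.\<theta> \<alpha> \<beta> F)"
    if "\<alpha> \<in> carrier \<pi>" "\<beta> \<in> carrier \<pi>" "F \<in> carrier (V.X (\<alpha> \<otimes>\<^bsub>\<pi>\<^esub> \<beta>))" for \<alpha> \<beta> F
    by (rule coind_pullback_coaction[OF V W G colin' that])
  ultimately show ?thesis
    unfolding equivalent_right_pi_comodules_def
    by (intro conjI V.coind_right_pi_comodule W.coind_right_pi_comodule exI[of _ "\<lambda>\<alpha>. ?\<Phi>"] ballI)
qed

end
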